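(* Let $s>-1$, let $v_1,\dots,v_m>0$ be distinct, and let $r_i^{(n)}=\frac{v_i}{2n^2}$ for $1\le i\le m$. For $z_1,z_2>0$, $z_1\ne z_2$, $$\lim_{n\to\infty}\widetilde\Pi_n^{(n)}(z_1,z_2)=\frac{A_{II}^{(s,v)}(1,z_1)B_{II}^{(s,v)}(1,z_2)-A_{II}^{(s,v)}(1,z_2)B_{II}^{(s,v)}(1,z_1)}{2\prod_{i=1}^m\sqrt{(v_i+z_1)(v_i+z_2)}\cdot\big[C_{II}^{(s,v)}(1)\big]^2\cdot(z_1-z_2)}.$$
   Context: Consider the weight $w_s^{(r^{(n)})}(t)=\dfrac{(1-t)^s}{\prod_{i=1}^m(1+r_i^{(n)}-t)}$ on $(-1,1)$. Let $\Pi_n^{(n)}(x_1,x_2)=\sqrt{w_s^{(r^{(n)})}(x_1)w_s^{(r^{(n)})}(x_2)}\sum_{j=0}^{n-1}p_j(x_1)p_j(x_2)$ be its $n$-th Christoffel–Darboux kernel, where $p_0,p_1,\dots$ are the orthonormal polynomials with respect to this weight, and let $\widetilde\Pi_n^{(n)}(z_1,z_2)=\frac1{2n^2}\Pi_n^{(n)}\big(1-\frac{z_1}{2n^2},1-\frac{z_2}{2n^2}\big)$. $W(f_1,\dots,f_N)(\kappa)=\det(f_i^{(j-1)}(\kappa))_{1\le i,j\le N}$ denotes the Wronskian. With $J_s$ the Bessel function and $K_s$ the modified Bessel function of the second kind, put $K_{s,v_i}(\kappa)=K_s(\kappa\sqrt{v_i})$, $J_{s,z}(\kappa)=J_s(\kappa\sqrt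 z)$, and $$C_{II}^{(s,v)}(\kappa)=W(K_{s,v_1},\dots,K_{s,v_m})(\kappa),\quad A_{II}^{(s,v)}(\kappa,z)=W(K_{s,v_1},\dots,K_{s,v_m},J_{s,z})(\kappa),\quad B_{II}^{(s,v)}(\kappa,z)=\frac{\partial}{\partial\kappa}A_{II}^{(s,v)}(\kappa,z).$$ *)

theory Defs
  imports
    "HOL-Analysis.Analysis"
    "HOL-Computational_Algebra.Polynomial"
    "Jordan_Normal_Form.Determinant"
begin

text \<open>
  The Bessel function of the first kind of real order, for arguments \<open>x > 0\<close> and orders
  \<open>s > -1\<close>, by its power series; \<open>powr\<close> is the positive branch of the power.
\<close>

definition bessel_J :: "real \<Rightarrow> real \<Rightarrow> real" where
  "bessel_J s x =
     (\<Sum>k. (- 1) ^ k / (fact k * Gamma (real k + s + 1)) * (x / 2) powr (2 * real k + s))"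

text \<open>
  The modified Bessel function of the second kind for \<open>x > 0\<close>, by Schlaefli's integral
  (DLMF 10.32.9). It is valid for every real order, so that integer orders need no
  limiting procedure.
\<close>

definition bessel_K :: "real \<Rightarrow> real \<Rightarrow> real" where
  "bessel_K s x = (LBINT t:{0..}. exp (- x * cosh t) * cosh (s * t))"

definition wronskian :: "(real \<Rightarrow> real) list \<Rightarrow> real \<Rightarrow> real" where
  "wronskian fs x =
     Determinant.det (Matrix.mat (length fs) (length fs) (\<lambda>(i, j). (deriv ^^ j) (fs ! i) x))"

text \<open>The points \<open>v 1, \<dots>, v m\<close> are the values of a function on \<open>{1..m}\<close>.\<close>

definition K_family :: "real \<Rightarrow> nat \<Rightarrow> (nat \<Rightarrow> real) \<Rightarrow> (real \<Rightarrow> real) list" where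
  "K_family s m v = map (\<lambda>i \<kappa>. bessel_K s (\<kappa> * sqrt (v i))) [1..<Suc m]"

definition C_II :: "real \<Rightarrow> nat \<Rightarrow> (nat \<Rightarrow> real) \<Rightarrow> real \<Rightarrow> real" where
  "C_II s m v \<kappa> = wronskian (K_family s m v) \<kappa>"

definition A_II :: "real \<Rightarrow> nat \<Rightarrow> (nat \<Rightarrow> real) \<Rightarrow> real \<Rightarrow> real \<Rightarrow> real" where
  "A_II s m v \<kappa> z = wronskian (K_family s m v @ [\<lambda>\<kappa>. bessel_J s (\<kappa> * sqrt z)]) \<kappa>"

definition B_II :: "real \<Rightarrow> nat \<Rightarrow> (nat \<Rightarrow> real) \<Rightarrow> real \<Rightarrow> real \<Rightarrow> real" where
  "B_II s m v \<kappa> z = deriv (\<lambda>\<kappa>. A_II s m v \<kappa> z) \<kappa>"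

definition weight :: "real \<Rightarrow> nat \<Rightarrow> (nat \<Rightarrow> real) \<Rightarrow> real \<Rightarrow> real" where
  "weight s m r t = (1 - t) powr s / (\<Prod>i=1..m. 1 + r i - t)"

text \<open>
  Orthonormality on \<open>(-1, 1)\<close>. The signs of the leading coefficients are left free; they
  cancel in the Christoffel--Darboux kernel. Integrability of the squares is implicit: the
  integral of a non-integrable function is \<open>0\<close>, not \<open>1\<close>.
\<close>

definition orthonormal_polys :: "(real \<Rightarrow> real) \<Rightarrow> (nat \<Rightarrow> real poly) \<Rightarrow> bool" where
  "orthonormal_polys w p \<longleftrightarrow>
     (\<forall>j. degree (p j) = j) \<and>
     (\<forall>i j. (LBINT t:{-1<..<1}. poly (p i) t * poly (p j) t * w t) = (if i = j then 1 else 0))"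

definition CD_kernel ::
  "(real \<Rightarrow> real) \<Rightarrow> (nat \<Rightarrow> real poly) \<Rightarrow> nat \<Rightarrow> real \<Rightarrow> real \<Rightarrow> real" where
  "CD_kernel w p n x1 x2 = sqrt (w x1 * w x2) * (\<Sum>j<n. poly (p j) x1 * poly (p j) x2)"

definition scaled_CD_kernel ::
  "(real \<Rightarrow> real) \<Rightarrow> (nat \<Rightarrow> real poly) \<Rightarrow> nat \<Rightarrow> real \<Rightarrow> real \<Rightarrow> real" where
  "scaled_CD_kernel w p n z1 z2 =
     1 / (2 * (real n)\<^sup>2) *
     CD_kernel w p n (1 - z1 / (2 * (real n)\<^sup>2)) (1 - z2 / (2 * (real n)\<^sup>2))"

end

theory Submission
  imports Defs
begin

text \<open>
  Write \<open>u = 1 - t\<close>, \<open>N = n - 1 - m\<close>, and let \<open>J\<close> range over the Jacobi polynomials $P_N^{(s+j,0)}$. The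
  polynomials \<open>E j = u ^ j * J\<close> for \<open>j \<le> m + 1\<close> are orthogonal with respect to \<open>u powr s\<close> to all polynomials of
  degree less than \<open>N\<close>. Hence a combination of them is orthogonal to degree less than \<open>n - 1\<close> for the
  weight of the theorem iff its Cauchy transforms at the \<open>m\<close> poles vanish, and the determinants with rows
  (Cauchy transforms of \<open>E j\<close> at the \<open>i\<close>-th pole) and (values of \<open>E j\<close>), over \<open>j = 0, \<dots>, m\<close> and over
  \<open>j = 0, \<dots>, m - 1, m + 1\<close>, span the same plane as the orthonormal polynomials of degrees \<open>n - 1\<close> and \<open>n\<close>.
  The Christoffel--Darboux formula holds for this pair. Raising the Jacobi parameter with \<open>j\<close>, instead of
  varying the degree, makes the determinants nondegenerate in the limit: by the
  Mehler--Heine formula the entries tend to multiples of $z^{j/2} J_{s+j}(\sqrt z)$, and by Rodrigues' formula and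
  dominated convergence to multiples of $v_i^{j/2} K_{s+j}(\sqrt{v_i})$. Since the Bessel functions of order \<open>s + j\<close> arise
  from $\kappa^{-s} J_s$ and $\kappa^{-s} K_s$ by applying $\kappa^{-1} d/d\kappa$, the limits are the Wronskians
  and the derivative of the theorem, up to triangular transformations. The Wronskian in the denominator does not
  vanish, by a sign-change count for Laplace transforms.
\<close>

section \<open>Laplace transforms on the half-line\<close>

text \<open>Two scales meet. The poles and the evaluation points lie at distance of order 1 / n^2
  from the endpoint, but after Rodrigues' formula the Cauchy integrals concentrate where u is of
  order 1 / n. There the N-th powers turn into exp (- y / 2) and exp (- v / (2 * y)), so K enters
  through an integral over the half-line with this kernel. In this form K is a Laplace transform in
  v: differentiation only shifts the index, and a combination over j acquires a polynomial factor
  whose positive roots bound the number of zeros. The normalising constant is not computed from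
  norms of orthogonal polynomials. It is the leading coefficient of one determinant times the
  pairing of the other with a monic test polynomial. Taking Q * u^N as test polynomial, Q being the
  product of the u + r_i, cancels the denominator of the weight and leaves Jacobi moments. The
  moment with j = m dominates, since the scalings grow with j, and its product with the leading
  coefficient is elementary. Both factors carry the same minor, whence the square of
  \<open>C_II\<close>.\<close>

lemma mult_exp_minus_le:
  fixes w x :: real
  assumes "w > 0"
  shows "x * exp (- w * x) \<le> (2 / w) * exp (- (w / 2) * x)"
proof -
  have "w / 2 * x \<le> exp (w / 2 * x)"
    using exp_ge_add_one_self[of "w / 2 * x"] by linarith
  hence "x * exp (- w * x) \<le> (2 / w) * exp (w / 2 * x) * exp (- w * x)"
    using assms by (intro mult_right_mono) (auto simp: field_simps)
  also have "\<dots> = (2 / w) * exp (- (w / 2) * x)"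
    by (simp add: exp_add[symmetric] algebra_simps)
  finally show ?thesis .
qed

text \<open>Integrability is assumed for every positive parameter so that half of the decay rate can
  be spent: \<open>mult_exp_minus_le\<close> absorbs the factor \<theta> that differentiation brings
  down, and the integrand at w / 2 dominates the difference quotients. The phase \<theta> is left
  general because the application uses 1 / (2 * y).\<close>

lemma laplace_transform_derivative:
  fixes M :: "'a measure" and g \<theta> :: "'a \<Rightarrow> real" and w :: real
  assumes [measurable]: "g \<in> borel_measurable M" "\<theta> \<in> borel_measurable M"
    and nonneg: "\<And>y. y \<in> space M \<Longrightarrow> \<theta> y \<ge> 0"
    and int: "\<And>w. w > 0 \<Longrightarrow> integrable M (\<lambda>y. g y * exp (- w * \<theta> y))"
    and w: "w > 0"
  shows integrable_laplace_transform_derivative: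
      "integrable M (\<lambda>y. (- \<theta> y * g y) * exp (- w * \<theta> y))" (is ?int)
    and has_derivative_laplace_transform:
      "((\<lambda>w. \<integral>y. g y * exp (- w * \<theta> y) \<partial>M) has_real_derivative
        (\<integral>y. (- \<theta> y * g y) * exp (- w * \<theta> y) \<partial>M)) (at w)" (is ?deriv)
proof -
  have dom: "integrable M (\<lambda>y. (\<theta> y * \<bar>g y\<bar>) * exp (- w * \<theta> y))" if "w > 0" for w
  proof (rule Bochner_Integration.integrable_bound)
    show "integrable M (\<lambda>y. (2 / w) * (g y * exp (- (w / 2) * \<theta> y)))"
      using int[of "w / 2"] that by auto
    show "AE y in M. norm ((\<theta> y * \<bar>g y\<bar>) * exp (- w * \<theta> y))
        \<le> norm ((2 / w) * (g y * exp (- (w / 2) * \<theta> y)))"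
    proof (rule AE_I2)
      fix y assume y: "y \<in> space M"
      have "\<bar>g y\<bar> * (\<theta> y * exp (- w * \<theta> y)) \<le> \<bar>g y\<bar> * ((2 / w) * exp (- (w / 2) * \<theta> y))"
        using mult_exp_minus_le[OF that] by (intro mult_left_mono) auto
      thus "norm ((\<theta> y * \<bar>g y\<bar>) * exp (- w * \<theta> y))
        \<le> norm ((2 / w) * (g y * exp (- (w / 2) * \<theta> y)))"
        using nonneg[OF y] that by (simp add: abs_mult mult_ac)
    qed
  qed measurable
  show ?int
    by (rule Bochner_Integration.integrable_bound[OF dom[OF w]]) (auto simp: abs_mult nonneg intro!: AE_I2)
  have "(\<lambda>n. ((\<integral>y. g y * exp (- (w + X n) * \<theta> y) \<partial>M) - (\<integral>y. g y * exp (- w * \<theta> y) \<partial>M)) / X n)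
      \<longlonglongrightarrow> (\<integral>y. (- \<theta> y * g y) * exp (- w * \<theta> y) \<partial>M)"
    if X: "X \<longlonglongrightarrow> 0" "\<And>n. X n \<noteq> 0" for X
  proof -
    have "eventually (\<lambda>n. \<bar>X n\<bar> < w / 2) sequentially"
      using X(1) w tendsto_rabs_zero[OF X(1)] order_tendstoD(2)[of "\<lambda>n. \<bar>X n\<bar>" 0 sequentially "w/2"] by auto
    then obtain N where N: "\<And>n. n \<ge> N \<Longrightarrow> \<bar>X n\<bar> < w / 2"
      by (auto simp: eventually_at_top_linorder)
    \<comment> \<open>The tail of the sequence keeps w + Y n above w / 2 for every n, so that one
      dominating function serves the whole sequence.\<close>
    define Y where "Y = (\<lambda>n. X (n + N))"
    have Y: "Y \<longlonglongrightarrow> 0" "\<And>n. Y n \<noteq> 0" "\<And>n. \<bar>Y n\<bar> < w / 2"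
      using X N LIMSEQ_ignore_initial_segment[OF X(1), of N] by (auto simp: Y_def)
    have "(\<lambda>n. \<integral>y. g y * ((exp (- (w + Y n) * \<theta> y) - exp (- w * \<theta> y)) / Y n) \<partial>M)
      \<longlonglongrightarrow> (\<integral>y. (- \<theta> y * g y) * exp (- w * \<theta> y) \<partial>M)"
    proof (rule integral_dominated_convergence)
      show "integrable M (\<lambda>y. (\<theta> y * \<bar>g y\<bar>) * exp (- (w / 2) * \<theta> y))"
        using w by (intro dom) auto
      show "AE y in M. (\<lambda>n. g y * ((exp (- (w + Y n) * \<theta> y) - exp (- w * \<theta> y)) / Y n))
              \<longlonglongrightarrow> (- \<theta> y * g y) * exp (- w * \<theta> y)"
      proof (rule AE_I2)
        fix y
        have "((\<lambda>w. exp (- w * \<theta> y)) has_real_derivative (- \<theta> y * exp (- w * \<theta> y))) (at w)"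
          by (auto intro!: derivative_eq_intros)
        hence lim: "((\<lambda>h. (exp (- (w + h) * \<theta> y) - exp (- w * \<theta> y)) / h) \<longlongrightarrow> - \<theta> y * exp (- w * \<theta> y)) (at 0)"
          unfolding DERIV_def .
        have "(\<lambda>n. (exp (- (w + Y n) * \<theta> y) - exp (- w * \<theta> y)) / Y n) \<longlonglongrightarrow> - \<theta> y * exp (- w * \<theta> y)"
          by (rule filterlim_compose[OF lim]) (use Y in \<open>auto simp: filterlim_at\<close>)
        from tendsto_mult[OF tendsto_const[of "g y"] this]
        show "(\<lambda>n. g y * ((exp (- (w + Y n) * \<theta> y) - exp (- w * \<theta> y)) / Y n))
              \<longlonglongrightarrow> (- \<theta> y * g y) * exp (- w * \<theta> y)" by (simp add: mult_ac)
      qed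
      show "AE y in M. norm (g y * ((exp (- (w + Y n) * \<theta> y) - exp (- w * \<theta> y)) / Y n))
          \<le> (\<theta> y * \<bar>g y\<bar>) * exp (- (w / 2) * \<theta> y)" for n
      proof (rule AE_I2)
        fix y assume y: "y \<in> space M"
        have "norm (exp (- (w + Y n) * \<theta> y) - exp (- w * \<theta> y)) \<le> (\<theta> y * exp (- (w / 2) * \<theta> y)) * norm ((w + Y n) - w)"
        proof (rule field_differentiable_bound[where S = "{w/2..}" and f' = "\<lambda>u. - \<theta> y * exp (- u * \<theta> y)"])
          show "((\<lambda>u. exp (- u * \<theta> y)) has_field_derivative - \<theta> y * exp (- u * \<theta> y)) (at u within {w/2..})" for u
            by (auto intro!: derivative_eq_intros)
          show "norm (- \<theta> y * exp (- u * \<theta> y)) \<le> \<theta> y * exp (- (w / 2) * \<theta> y)" if "u \<in> {w/2..}" for u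
            using that nonneg[OF y] mult_right_mono[of w "u * 2" "\<theta> y"]
            by (auto simp: abs_mult intro!: mult_left_mono)
        qed (use Y(3)[of n] w in auto)
        hence "\<bar>g y\<bar> * (norm (exp (- (w + Y n) * \<theta> y) - exp (- w * \<theta> y)) / \<bar>Y n\<bar>)
            \<le> \<bar>g y\<bar> * (\<theta> y * exp (- (w / 2) * \<theta> y))"
          using Y(2)[of n] by (intro mult_left_mono) (auto simp: field_simps)
        thus "norm (g y * ((exp (- (w + Y n) * \<theta> y) - exp (- w * \<theta> y)) / Y n))
          \<le> (\<theta> y * \<bar>g y\<bar>) * exp (- (w / 2) * \<theta> y)"
          by (simp add: abs_mult mult_ac)
      qed
    qed measurable
    also have "(\<lambda>n. \<integral>y. g y * ((exp (- (w + Y n) * \<theta> y) - exp (- w * \<theta> y)) / Y n) \<partial>M)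
      = (\<lambda>n. ((\<integral>y. g y * exp (- (w + Y n) * \<theta> y) \<partial>M) - (\<integral>y. g y * exp (- w * \<theta> y) \<partial>M)) / Y n)"
    proof
      fix n
      have "w + Y n > 0" using Y(3)[of n] w by linarith
      from Bochner_Integration.integral_diff[OF int[OF this] int[OF w]]
      have "((\<integral>y. g y * exp (- (w + Y n) * \<theta> y) \<partial>M) - (\<integral>y. g y * exp (- w * \<theta> y) \<partial>M)) / Y n
         = (\<integral>y. (g y * exp (- (w + Y n) * \<theta> y) - g y * exp (- w * \<theta> y)) / Y n \<partial>M)"
        by simp
      also have "\<dots> = (\<integral>y. g y * ((exp (- (w + Y n) * \<theta> y) - exp (- w * \<theta> y)) / Y n) \<partial>M)"
        by (intro Bochner_Integration.integral_cong) (auto simp: field_simps)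
      finally show "(\<integral>y. g y * ((exp (- (w + Y n) * \<theta> y) - exp (- w * \<theta> y)) / Y n) \<partial>M) = ((\<integral>y. g y * exp (- (w + Y n) * \<theta> y) \<partial>M) - (\<integral>y. g y * exp (- w * \<theta> y) \<partial>M)) / Y n" ..
    qed
    finally show ?thesis
      unfolding Y_def by (rule LIMSEQ_offset)
  qed
  thus ?deriv
    unfolding DERIV_def
    by (auto simp: tendsto_at_iff_sequentially o_def)
qed

section \<open>The modified Bessel function as a Laplace transform\<close>

abbreviation halfline :: "real measure" where
  "halfline \<equiv> restrict_space lborel {0<..}"

lemma borel_measurable_halfline [measurable (raw)]:
  "f \<in> borel_measurable borel \<Longrightarrow> f \<in> borel_measurable halfline"
  by (intro measurable_restrict_space1) simp

lemma integrable_halfline_iff: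
  fixes f :: "real \<Rightarrow> real"
  shows "integrable halfline f \<longleftrightarrow> set_integrable lborel {0<..} f"
  by (simp add: integrable_restrict_space set_integrable_def)

lemma integral_halfline_eq:
  fixes f :: "real \<Rightarrow> real"
  shows "(\<integral>y. f y \<partial>halfline) = (LBINT y:{0<..}. f y)"
  by (simp add: integral_restrict_space set_lebesgue_integral_def)

lemma set_integrable_lborel_iff_absolutely_integrable:
  fixes f :: "real \<Rightarrow> real"
  assumes "f \<in> borel_measurable borel" "S \<in> sets borel"
  shows "set_integrable lborel S f \<longleftrightarrow> f absolutely_integrable_on S"
  unfolding set_integrable_def using assms by (subst integrable_completion) auto

lemma integrable_gamma_density:
  assumes "a > 0" "c > (0::real)"
  shows "integrable halfline (\<lambda>y. y powr (a - 1) * exp (- c * y))"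
proof -
  have "(\<lambda>t. complex_of_real t powr (of_real a - 1) / of_real (exp (c * t))) absolutely_integrable_on {0<..}"
    using assms by (intro absolutely_integrable_Gamma_integral) auto
  hence "(\<lambda>t. norm (complex_of_real t powr (of_real a - 1) / of_real (exp (c * t)))) absolutely_integrable_on {0<..}"
    by (rule absolutely_integrable_norm[unfolded o_def])
  also have "?this \<longleftrightarrow> (\<lambda>y. y powr (a - 1) * exp (- c * y)) absolutely_integrable_on {0<..}"
    by (intro set_integrable_cong refl) 
       (auto simp: norm_divide norm_powr_real_powr exp_minus field_simps)
  finally show ?thesis
    unfolding integrable_halfline_iff by (subst set_integrable_lborel_iff_absolutely_integrable) auto
qed

lemma power_le_fact_mult_exp:
  assumes "x \<ge> (0::real)"
  shows "x ^ k \<le> fact k * exp x"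
proof -
  have "(\<Sum>n\<in>{k}. inverse (fact n) * x ^ n) \<le> (\<Sum>n. inverse (fact n) * x ^ n)"
    using assms by (intro sum_le_suminf summable_exp) auto
  thus ?thesis by (simp add: exp_def scaleR_conv_of_real field_simps)
qed

text \<open>Multiplied by exp (- w / (2 * y)) this is the unnormalised generalised inverse Gaussian
  density, whose total mass is a Bessel function K.\<close>

definition bessel_kernel :: "real \<Rightarrow> real \<Rightarrow> real" where
  "bessel_kernel \<beta> y = y powr (\<beta> - 1) * exp (- (y / 2))"

lemma borel_measurable_bessel_kernel [measurable]: "bessel_kernel \<beta> \<in> borel_measurable borel"
  unfolding bessel_kernel_def [abs_def] by measurable

text \<open>The index \<beta> is an arbitrary real, so the power of y may be singular at 0. The
  factor exp (- w / (2 * y)) is at most a constant times y^k, and k is chosen to make \<beta> + k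
  positive, which reduces the claim to a Gamma density.\<close>

lemma integrable_bessel_kernel:
  assumes "w > 0"
  shows "integrable halfline (\<lambda>y. bessel_kernel \<beta> y * exp (- w * (1 / (2 * y))))"
proof -
  define k where "k = nat \<lceil>\<bar>\<beta>\<bar>\<rceil> + 1"
  have k: "\<beta> + real k > 0" unfolding k_def by linarith
  show ?thesis
  proof (rule Bochner_Integration.integrable_bound)
    show "integrable halfline (\<lambda>y. fact k * (2 / w) ^ k * (y powr (\<beta> + real k - 1) * exp (- (1/2) * y)))"
      using integrable_gamma_density[OF k, of "1/2"] by simp
    show "AE y in halfline. norm (bessel_kernel \<beta> y * exp (- w * (1 / (2 * y))))
        \<le> norm (fact k * (2 / w) ^ k * (y powr (\<beta> + real k - 1) * exp (- (1/2) * y)))"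
    proof (rule AE_I2)
      fix y assume "y \<in> space halfline"
      hence y: "y > 0" by (simp add: space_restrict_space)
      have "(w / (2 * y)) ^ k * exp (- (w / (2 * y))) \<le> fact k * exp (w / (2 * y)) * exp (- (w / (2 * y)))"
        using y assms by (intro mult_right_mono power_le_fact_mult_exp) auto
      also have "\<dots> = fact k" by (simp add: exp_add[symmetric] mult.assoc)
      finally have "exp (- (w / (2 * y))) \<le> fact k * (2 / w) ^ k * y ^ k"
        using y assms by (simp add: field_simps power_divide power_mult_distrib)
      hence "y powr (\<beta> - 1) * exp (- (y / 2)) * exp (- (w / (2 * y)))
        \<le> y powr (\<beta> - 1) * exp (- (y / 2)) * (fact k * (2 / w) ^ k * y ^ k)"
        by (intro mult_left_mono) auto
      also have "\<dots> = fact k * (2 / w) ^ k * (y powr (\<beta> + real k - 1) * exp (- (1/2) * y))"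
        using y by (simp add: powr_add[symmetric] powr_realpow[symmetric] algebra_simps)
      finally show "norm (bessel_kernel \<beta> y * exp (- w * (1 / (2 * y))))
        \<le> norm (fact k * (2 / w) ^ k * (y powr (\<beta> + real k - 1) * exp (- (1/2) * y)))"
        using assms by (simp add: bessel_kernel_def abs_mult)
    qed
  qed measurable
qed

text \<open>The phase 1 / (2 * y) is what makes the family closed under differentiation in w: the
  factor brought down lowers \<beta> by one.\<close>

definition bessel_transform :: "real \<Rightarrow> real \<Rightarrow> real" where
  "bessel_transform \<beta> w = (\<integral>y. bessel_kernel \<beta> y * exp (- w * (1 / (2 * y))) \<partial>halfline)"

lemma has_derivative_bessel_transform:
  assumes "w > 0"
  shows "(bessel_transform \<beta> has_real_derivative - bessel_transform (\<beta> - 1) w / 2) (at w)"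
proof -
  have "((\<lambda>w. \<integral>y. bessel_kernel \<beta> y * exp (- w * (1 / (2 * y))) \<partial>halfline) has_real_derivative
        (\<integral>y. (- (1 / (2 * y)) * bessel_kernel \<beta> y) * exp (- w * (1 / (2 * y))) \<partial>halfline)) (at w)"
    by (rule has_derivative_laplace_transform)
       (use assms integrable_bessel_kernel in \<open>auto simp: space_restrict_space\<close>)
  also have "(\<integral>y. (- (1 / (2 * y)) * bessel_kernel \<beta> y) * exp (- w * (1 / (2 * y))) \<partial>halfline)
     = (\<integral>y. (- 1 / 2) * (bessel_kernel (\<beta> - 1) y * exp (- w * (1 / (2 * y)))) \<partial>halfline)"
    by (intro Bochner_Integration.integral_cong)
       (auto simp: bessel_kernel_def space_restrict_space powr_diff field_simps power2_eq_square)
  also have "\<dots> = - bessel_transform (\<beta> - 1) w / 2"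
    by (subst integral_mult_right_zero) (simp add: bessel_transform_def)
  finally show ?thesis unfolding bessel_transform_def[abs_def] .
qed

text \<open>With x = sqrt w, the exponent y / 2 + w / (2 * y) is minimal at y = x and equals x *
  cosh t at y = x * exp t and at y = x * exp (- t). Splitting the half-line at x and substituting on
  each half gives exp (\<beta> * t) and exp (- \<beta> * t), which add up to 2 * cosh (\<beta> * t).
  The sign \<sigma> distinguishes the halves.\<close>

lemma bessel_transform_eq_bessel_K:
  assumes w: "w > 0"
  shows "bessel_transform \<beta> w = 2 * w powr (\<beta> / 2) * bessel_K \<beta> (sqrt w)"
proof -
  define x where "x = sqrt w"
  have x: "x > 0" "x\<^sup>2 = w" "x * x = w" using w by (auto simp: x_def)
  define F where "F = (\<lambda>y. bessel_kernel \<beta> y * exp (- w * (1 / (2 * y))))"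
  define G where "G = (\<lambda>\<gamma> t. exp (\<gamma> * t) * exp (- x * cosh t))"
  have [measurable]: "F \<in> borel_measurable borel" "G \<gamma> \<in> borel_measurable borel" for \<gamma>
    unfolding F_def G_def cosh_def by measurable
  have "set_integrable lborel {0<..} F"
    using integrable_bessel_kernel[OF w] by (simp add: F_def integrable_halfline_iff)
  hence F: "F absolutely_integrable_on {0<..}"
    by (subst set_integrable_lborel_iff_absolutely_integrable[symmetric]) auto
  have substitution: "\<bar>\<sigma> * (x * exp (\<sigma> * t))\<bar> * F (x * exp (\<sigma> * t)) = w powr (\<beta> / 2) * G (\<sigma> * \<beta>) t"
    if "\<sigma> = 1 \<or> \<sigma> = -1" for \<sigma> t
  proof -
    have E: "x * exp (\<sigma> * t) / 2 + w * (1 / (2 * (x * exp (\<sigma> * t)))) = x * cosh t"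
      using that x(1) unfolding x(3)[symmetric] cosh_field_def
      by (auto simp: field_simps exp_minus)
    have "x * exp (\<sigma> * t) * (x * exp (\<sigma> * t)) powr (\<beta> - 1) = (x * exp (\<sigma> * t)) powr \<beta>"
      using x(1) by (simp add: powr_diff)
    also have "\<dots> = w powr (\<beta> / 2) * exp (\<sigma> * \<beta> * t)"
      using x by (simp add: powr_mult x_def powr_half_sqrt[symmetric] powr_powr exp_powr_real mult_ac)
    finally have P: "x * exp (\<sigma> * t) * (x * exp (\<sigma> * t)) powr (\<beta> - 1) = w powr (\<beta> / 2) * exp (\<sigma> * \<beta> * t)" .
    have "\<bar>\<sigma> * (x * exp (\<sigma> * t))\<bar> * F (x * exp (\<sigma> * t)) = 
       x * exp (\<sigma> * t) * (x * exp (\<sigma> * t)) powr (\<beta> - 1) *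
       exp (- (x * exp (\<sigma> * t) / 2 + w * (1 / (2 * (x * exp (\<sigma> * t))))))"
      using that x(1) by (auto simp: F_def bessel_kernel_def abs_mult exp_add[symmetric])
    thus ?thesis unfolding E P G_def by simp
  qed
  have im: "(\<lambda>t. x * exp (1 * t)) ` {0..} = {x..}" "(\<lambda>t. x * exp (- 1 * t)) ` {0..} = {0<..x}"
  proof -
    show "(\<lambda>t. x * exp (1 * t)) ` {0..} = {x..}"
    proof (intro equalityI subsetI)
      fix y assume "y \<in> {x..}"
      thus "y \<in> (\<lambda>t. x * exp (1 * t)) ` {0..}"
        using x(1) by (intro image_eqI[of _ _ "ln (y / x)"]) auto
    qed (use x(1) in auto)
    show "(\<lambda>t. x * exp (- 1 * t)) ` {0..} = {0<..x}"
    proof (intro equalityI subsetI)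
      fix y assume "y \<in> {0<..x}"
      thus "y \<in> (\<lambda>t. x * exp (- 1 * t)) ` {0..}"
        using x(1) by (intro image_eqI[of _ _ "ln (x / y)"]) (auto simp: exp_minus)
    qed (use x(1) in auto)
  qed
  have change: "(\<lambda>t. w powr (\<beta> / 2) * G (\<sigma> * \<beta>) t) absolutely_integrable_on {0..} \<and>
     integral {0..} (\<lambda>t. w powr (\<beta> / 2) * G (\<sigma> * \<beta>) t) = integral ((\<lambda>t. x * exp (\<sigma> * t)) ` {0..}) F"
    if \<sigma>: "\<sigma> = 1 \<or> \<sigma> = -1" for \<sigma>
  proof -
    have "(\<lambda>t. \<bar>\<sigma> * (x * exp (\<sigma> * t))\<bar> * F (x * exp (\<sigma> * t))) absolutely_integrable_on {0..} \<and>
     integral {0..} (\<lambda>t. \<bar>\<sigma> * (x * exp (\<sigma> * t))\<bar> * F (x * exp (\<sigma> * t))) = integral ((\<lambda>t. x * exp (\<sigma> * t)) ` {0..}) F"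
    proof (subst has_absolute_integral_change_of_variables_1'[where g = "\<lambda>t. x * exp (\<sigma> * t)" and f = F])
      show "((\<lambda>t. x * exp (\<sigma> * t)) has_real_derivative \<sigma> * (x * exp (\<sigma> * t))) (at t within {0..})" for t
        by (auto intro!: derivative_eq_intros)
      show "inj_on (\<lambda>t. x * exp (\<sigma> * t)) {0..}"
        using x(1) \<sigma> by (auto simp: inj_on_def)
      have "F absolutely_integrable_on (\<lambda>t. x * exp (\<sigma> * t)) ` {0..}"
        using \<sigma> by (intro set_integrable_subset[OF F]) (use im x(1) in auto)
      thus "F absolutely_integrable_on (\<lambda>t. x * exp (\<sigma> * t)) ` {0..} \<and>
         integral ((\<lambda>t. x * exp (\<sigma> * t)) ` {0..}) F = integral ((\<lambda>t. x * exp (\<sigma> * t)) ` {0..}) F" by simp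
    qed auto
    thus ?thesis by (subst (asm) (1 2) substitution[OF \<sigma>])
  qed
  note change = change[of 1] change[of "-1"]
  have wpos: "w powr (\<beta> / 2) > 0" using w by simp
  have GI: "G \<beta> absolutely_integrable_on {0..}" "G (-\<beta>) absolutely_integrable_on {0..}"
    using change wpos by (auto simp: set_integrable_mult_right_iff)
  have cosh_eq: "exp (- x * cosh t) * cosh (\<beta> * t) = (G \<beta> t + G (- \<beta>) t) / 2" for t
    by (simp add: G_def cosh_field_def field_simps)
  have "set_integrable lborel {0..} (\<lambda>t. exp (- x * cosh t) * cosh (\<beta> * t))"
    unfolding cosh_eq using GI by (subst set_integrable_lborel_iff_absolutely_integrable) auto
  from set_borel_integral_eq_integral(2)[OF this]
  have "bessel_K \<beta> x = integral {0..} (\<lambda>t. (G \<beta> t + G (- \<beta>) t) / 2)"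
    unfolding bessel_K_def cosh_eq .
  also have "\<dots> = (integral {0..} (G \<beta>) + integral {0..} (G (- \<beta>))) / 2"
    using GI by (simp add: integral_add set_lebesgue_integral_eq_integral(1))
  finally have "2 * bessel_K \<beta> x = integral {0..} (G \<beta>) + integral {0..} (G (- \<beta>))"
    by simp
  from arg_cong[OF this, of "\<lambda>u. w powr (\<beta> / 2) * u"]
  have K: "2 * w powr (\<beta> / 2) * bessel_K \<beta> x = integral {x..} F + integral {0<..x} F"
    using conjunct2[OF change(1)] conjunct2[OF change(2)] unfolding im
    by (simp add: distrib_left mult_ac)
  have "bessel_transform \<beta> w = integral {0<..} F"
    using set_borel_integral_eq_integral(2)[of "{0<..}" F] integrable_bessel_kernel[OF w]
    by (simp add: bessel_transform_def integral_halfline_eq F_def integrable_halfline_iff)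
  also have "{0<..} = {x..} \<union> {0<..x}" using x(1) by auto
  also have "integral ({x..} \<union> {0<..x}) F = integral {x..} F + integral {0<..x} F"
  proof (rule Henstock_Kurzweil_Integration.integral_Un)
    show "F integrable_on {x..}" "F integrable_on {0<..x}"
      using x(1) by (auto intro!: set_lebesgue_integral_eq_integral(1) set_integrable_subset[OF F])
    have "{x..} \<inter> {0<..x} \<subseteq> {x}" by auto
    thus "negligible ({x..} \<inter> {0<..x})" using negligible_subset by blast
  qed
  finally show ?thesis using K by (simp add: x_def)
qed

section \<open>Counting zeros of transforms\<close>

lemma borel_measurable_poly [measurable]:
  fixes p :: "real poly"
  shows "poly p \<in> borel_measurable borel"
  by (intro borel_measurable_continuous_onI continuous_on_poly continuous_on_id)

text \<open>The points are added in increasing order. The last conjunct keeps all earlier zeros of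
  \<open>f'\<close> below the largest old zero of \<open>f\<close>, hence the one that the mean
  value theorem places between that zero and the new point is new.\<close>

lemma rolle_zeros:
  fixes f f' :: "real \<Rightarrow> real"
  assumes f': "\<And>x. x > a \<Longrightarrow> (f has_real_derivative f' x) (at x)"
  assumes "finite Z" "Z \<subseteq> {a<..}" "\<And>z. z \<in> Z \<Longrightarrow> f z = 0"
  shows "\<exists>Z'. finite Z' \<and> card Z \<le> card Z' + 1 \<and> Z' \<subseteq> {a<..} \<and>
              (\<forall>z\<in>Z'. f' z = 0) \<and> (\<forall>z\<in>Z'. \<exists>y\<in>Z. z < y)"
  using assms(2-)
proof (induction Z rule: finite_linorder_max_induct)
  case empty
  show ?case by (intro exI[of _ "{}"]) auto
next
  case (insert b A)
  then obtain Z' where Z': "finite Z'" "card A \<le> card Z' + 1" "Z' \<subseteq> {a<..}"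
    "\<forall>z\<in>Z'. f' z = 0" "\<forall>z\<in>Z'. \<exists>y\<in>A. z < y"
    by auto
  show ?case
  proof (cases "A = {}")
    case True
    thus ?thesis by (intro exI[of _ "{}"]) auto
  next
    case False
    define c where "c = Max A"
    have c: "c \<in> A" "\<And>y. y \<in> A \<Longrightarrow> y \<le> c" "c < b"
      using False insert by (auto simp: c_def)
    have "\<exists>z. c < z \<and> z < b \<and> f b - f c = (b - c) * f' z"
      by (rule MVT2) (use c insert.prems f' in auto)
    then obtain z where z: "c < z" "z < b" "f b - f c = (b - c) * f' z" by blast
    hence "f' z = 0" using c insert.prems by auto
    moreover have "z \<notin> Z'" using Z'(5) c(2) z(1) by force
    ultimately show ?thesis
      using Z' z c insert.hyps insert.prems by (intro exI[of _ "insert z Z'"]) auto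
  qed
qed

lemma AE_halfline_pos: "AE y in halfline. y > 0"
  by (rule AE_I2) (simp add: space_restrict_space)

lemma not_AE_halfline_False: "\<not> (AE y in halfline. False)"
proof
  assume "AE y in halfline. False"
  hence "emeasure halfline (space halfline) = 0" 
    by (subst (asm) AE_iff_measurable[OF sets.top]) auto
  hence "emeasure lborel {0::real<..} = 0"
    by (simp add: space_restrict_space emeasure_restrict_space)
  moreover have "emeasure lborel {0::real<..<1} \<le> emeasure lborel {0::real<..}"
    by (intro emeasure_mono) auto
  ultimately show False by simp
qed

text \<open>
  Descartes' rule of signs for the transform, by induction on the degree: multiplying the
  transform by \<open>exp (v / (2 * c))\<close> for a positive root \<open>c\<close> of \<open>b\<close> and differentiating removes
  this root, at the price of the nonnegative factor \<open>(y - c)\<^sup>2 / y\<close> in the weight.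
\<close>

lemma card_zeros_laplace_transform_le:
  fixes \<omega> :: "real \<Rightarrow> real" and b :: "real poly"
  assumes "\<omega> \<in> borel_measurable borel"
    and "AE y in halfline. \<omega> y > 0"
    and "\<And>k w. w > 0 \<Longrightarrow> integrable halfline (\<lambda>y. \<omega> y * y ^ k * exp (- w * (1 / (2 * y))))"
    and "b \<noteq> 0"
    and "finite Z" "Z \<subseteq> {0<..}"
    and "\<And>v. v \<in> Z \<Longrightarrow> (\<integral>y. \<omega> y * poly b y * exp (- v * (1 / (2 * y))) \<partial>halfline) = 0"
  shows "card Z \<le> degree b"
  using assms
proof (induction "degree b" arbitrary: b \<omega> Z rule: less_induct)
  case (less b \<omega> Z)
  note [measurable] = less.prems(1)
  have int: "integrable halfline (\<lambda>y. \<omega> y * poly b y * exp (- w * (1 / (2 * y))))" if "w > 0" for w b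
  proof -
    have "integrable halfline (\<lambda>y. \<Sum>k\<le>degree b. coeff b k * (\<omega> y * y ^ k * exp (- w * (1 / (2 * y)))))"
      using less.prems(3)[OF that] by (intro Bochner_Integration.integrable_sum) auto
    thus ?thesis by (simp add: poly_altdef sum_distrib_left sum_distrib_right mult_ac)
  qed
  show ?case
  proof (cases "\<exists>c>0. poly b c = 0")
    case True
    then obtain c b1 where c: "c > 0" and b1: "b = [:-c, 1:] * b1"
      by (metis poly_eq_0_iff_dvd dvdE)
    have "b1 \<noteq> 0" using b1 less.prems(4) by auto
    hence deg: "degree b = Suc (degree b1)" 
      unfolding b1 by (subst degree_mult_eq) auto
    define F where "F = (\<lambda>v. \<integral>y. \<omega> y * poly b y * exp (- v * (1 / (2 * y))) \<partial>halfline)"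
    define F' where "F' = (\<lambda>v. \<integral>y. (- (1 / (2 * y)) * (\<omega> y * poly b y)) * exp (- v * (1 / (2 * y))) \<partial>halfline)"
    define \<omega>' where "\<omega>' = (\<lambda>y. \<omega> y * (y - c)\<^sup>2 / y)"
    have [measurable]: "\<omega>' \<in> borel_measurable borel" unfolding \<omega>'_def by measurable
    have F': "(F has_real_derivative F' v) (at v)" if "v > 0" for v
      unfolding F_def F'_def
      by (rule has_derivative_laplace_transform)
         (use that int in \<open>auto simp: space_restrict_space\<close>)
    have F'_int: "integrable halfline (\<lambda>y. (- (1 / (2 * y)) * (\<omega> y * poly b y)) * exp (- v * (1 / (2 * y))))"
      if "v > 0" for b v
      by (rule integrable_laplace_transform_derivative)
         (use that int in \<open>auto simp: space_restrict_space\<close>)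
    \<comment> \<open>The new integrand is - 2 times the differentiated integrand for the polynomial
      y^k * (y - c)^2, so its integrability comes with the differentiation lemma.\<close>
    have int': "integrable halfline (\<lambda>y. \<omega>' y * y ^ k * exp (- w * (1 / (2 * y))))" if "w > 0" for w k
    proof -
      let ?p = "monom 1 k * [:-c, 1:] ^ 2 :: real poly"
      have "integrable halfline (\<lambda>y. -2 * ((- (1 / (2 * y)) * (\<omega> y * poly ?p y)) * exp (- w * (1 / (2 * y)))))"
        using F'_int[OF that] by (intro integrable_mult_right)
      thus ?thesis 
        by (rule Bochner_Integration.integrable_cong[OF refl, THEN iffD1, rotated])
           (auto simp: \<omega>'_def space_restrict_space poly_monom field_simps)
    qed
    \<comment> \<open>Differentiating exp (v / (2 * c)) * exp (- v / (2 * y)) brings down (y - c) /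
      (2 * c * y). Together with the factor y - c of \<open>b\<close> this is the square that is
      moved into \<omega>'.\<close>
    have "\<exists>Z'. finite Z' \<and> card Z \<le> card Z' + 1 \<and> Z' \<subseteq> {0<..} \<and>
              (\<forall>v\<in>Z'. exp (v / (2 * c)) * (F v / (2 * c) + F' v) = 0) \<and> (\<forall>z\<in>Z'. \<exists>y\<in>Z. z < y)"
    proof (rule rolle_zeros[where f = "\<lambda>v. exp (v / (2 * c)) * F v"])
      show "((\<lambda>v. exp (v / (2 * c)) * F v) has_real_derivative exp (v / (2 * c)) * (F v / (2 * c) + F' v)) (at v)"
        if "v > 0" for v
        using F'[OF that] c by (auto intro!: derivative_eq_intros simp: field_simps)
    qed (use less.prems in \<open>auto simp: F_def\<close>)
    then obtain Z' where Z': "finite Z'" "card Z \<le> card Z' + 1" "Z' \<subseteq> {0<..}"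
      "\<And>v. v \<in> Z' \<Longrightarrow> F v / (2 * c) + F' v = 0" by auto
    have "card Z' \<le> degree b1"
    proof (rule less.hyps[of b1 \<omega>' Z'])
      have "AE y in halfline. y \<noteq> c"
        by (subst AE_restrict_space_iff) (auto intro: AE_mp[OF AE_lborel_singleton[of c]])
      thus "AE y in halfline. \<omega>' y > 0"
        using less.prems(2) AE_halfline_pos by eventually_elim (auto simp: \<omega>'_def)
      show "(\<integral>y. \<omega>' y * poly b1 y * exp (- v * (1 / (2 * y))) \<partial>halfline) = 0" if v: "v \<in> Z'" for v
      proof -
        have v0: "v > 0" using v Z' by auto
        have "(\<integral>y. \<omega>' y * poly b1 y * exp (- v * (1 / (2 * y))) \<partial>halfline) =
          (\<integral>y. (\<omega> y * poly b y * exp (- v * (1 / (2 * y)))) +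
            2 * c * ((- (1 / (2 * y)) * (\<omega> y * poly b y)) * exp (- v * (1 / (2 * y)))) \<partial>halfline)"
          by (intro Bochner_Integration.integral_cong)
             (auto simp: space_restrict_space \<omega>'_def b1 field_simps power2_eq_square)
        also have "\<dots> = F v + 2 * c * F' v"
          unfolding F_def F'_def
          by (subst Bochner_Integration.integral_add[OF int[OF v0] integrable_mult_right[OF F'_int[OF v0]]])
             (simp only: integral_mult_right_zero)
        also have "\<dots> = 2 * c * (F v / (2 * c) + F' v)" using c by (simp add: field_simps)
        finally show ?thesis using Z'(4)[OF v] by simp
      qed
    qed (use deg \<open>b1 \<noteq> 0\<close> Z' int' in auto)
    thus ?thesis using deg Z'(2) by simp
  next
    case False
    \<comment> \<open>Without a positive root \<open>b\<close> has constant sign on the half-line,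
      so the integrand is strictly of one sign and the transform has no zero at all.\<close>
    have same_sign: "poly b x * poly b y > 0" if "x > 0" "y > 0" for x y
    proof -
      have "poly b x * poly b y > 0" if "0 < x" "x < y" for x y
        using poly_IVT[OF that(2)] False that by (metis less_trans linorder_neqE_linordered_idom mult_eq_0_iff)
      moreover have "poly b x * poly b x > 0" using False that by (metis not_real_square_gt_zero)
      ultimately show ?thesis using that by (metis linorder_neqE_linordered_idom mult.commute)
    qed
    have "Z = {}"
    proof (rule ccontr)
      assume "Z \<noteq> {}"
      then obtain v where v: "v \<in> Z" by auto
      hence v0: "v > 0" using less.prems by auto
      define f where "f = (\<lambda>y. poly b 1 * (\<omega> y * poly b y * exp (- v * (1 / (2 * y)))))"
      have "integrable halfline f" unfolding f_def using int[OF v0] by auto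
      moreover have pos: "AE y in halfline. f y > 0"
        using less.prems(2) AE_halfline_pos
      proof eventually_elim
        case (elim y)
        hence "\<omega> y * (poly b 1 * poly b y) * exp (- v * (1 / (2 * y))) > 0"
          using same_sign[of 1 y] by (intro mult_pos_pos[OF mult_pos_pos]) auto
        thus ?case by (simp add: f_def mult_ac)
      qed
      moreover have "(\<integral>y. f y \<partial>halfline) = 0"
        using less.prems(7)[OF v] by (simp add: f_def)
      ultimately have "AE y in halfline. f y = 0"
        by (subst (asm) integral_nonneg_eq_0_iff_AE) (auto elim: AE_mp)
      with pos have "AE y in halfline. False" by eventually_elim auto
      thus False using not_AE_halfline_False by simp
    qed
    thus ?thesis by simp
  qed
qed

text \<open>A kernel vector gives the coefficients of a nonzero polynomial of degree less than m.
  Since a power y^j in the integrand raises the index by j, the transform of this polynomial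
  vanishes at the m distinct points, more often than its degree allows.\<close>

lemma det_bessel_transform_nonzero:
  fixes x :: "nat \<Rightarrow> real"
  assumes "inj_on x {..<m}" "\<And>i. i < m \<Longrightarrow> x i > 0"
  shows "Determinant.det (Matrix.mat m m (\<lambda>(i, j). bessel_transform (s + real j) (x i))) \<noteq> 0"
proof
  let ?A = "Matrix.mat m m (\<lambda>(i, j). bessel_transform (s + real j) (x i))"
  assume "Determinant.det ?A = 0"
  then obtain c where c: "c \<in> carrier_vec m" "c \<noteq> 0\<^sub>v m" "?A *\<^sub>v c = 0\<^sub>v m"
    using det_0_iff_vec_prod_zero_field[of ?A m] by auto
  define b where "b = (\<Sum>j<m. monom (vec_index c j) j)"
  have coeff_b: "coeff b j = vec_index c j" if "j < m" for j
    using that by (simp add: b_def coeff_sum coeff_monom)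
  have "b \<noteq> 0"
  proof
    assume "b = 0"
    hence "c = 0\<^sub>v m" using c(1) coeff_b by (intro eq_vecI) auto
    thus False using c(2) by simp
  qed
  have "card (x ` {..<m}) \<le> degree b"
  proof (rule card_zeros_laplace_transform_le[of "bessel_kernel s"])
    show "AE y in halfline. bessel_kernel s y > 0"
      using AE_halfline_pos by eventually_elim (auto simp: bessel_kernel_def)
    have shift: "bessel_kernel s y * y ^ k = bessel_kernel (s + real k) y" if "y > 0" for y k
      using that by (simp add: bessel_kernel_def powr_realpow[symmetric] powr_add[symmetric] algebra_simps)
    show "integrable halfline (\<lambda>y. bessel_kernel s y * y ^ k * exp (- w * (1 / (2 * y))))" if "w > 0" for k w
      using integrable_bessel_kernel[OF that, of "s + real k"]
      by (rule Bochner_Integration.integrable_cong[OF refl, THEN iffD1, rotated])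
         (auto simp: space_restrict_space shift)
    show "(\<integral>y. bessel_kernel s y * poly b y * exp (- v * (1 / (2 * y))) \<partial>halfline) = 0"
      if v: "v \<in> x ` {..<m}" for v
    proof -
      obtain i where i: "i < m" "v = x i" using v by auto
      have "(\<integral>y. bessel_kernel s y * poly b y * exp (- v * (1 / (2 * y))) \<partial>halfline)
        = (\<integral>y. (\<Sum>j<m. vec_index c j * (bessel_kernel (s + real j) y * exp (- v * (1 / (2 * y))))) \<partial>halfline)"
        by (intro Bochner_Integration.integral_cong)
           (auto simp: b_def poly_sum poly_monom sum_distrib_left sum_distrib_right space_restrict_space shift[symmetric] mult_ac)
      also have "\<dots> = (\<Sum>j<m. \<integral>y. vec_index c j * (bessel_kernel (s + real j) y * exp (- v * (1 / (2 * y)))) \<partial>halfline)"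
        using assms(2)[OF i(1)] i
        by (intro Bochner_Integration.integral_sum integrable_mult_right integrable_bessel_kernel) auto
      also have "\<dots> = (\<Sum>j<m. vec_index c j * bessel_transform (s + real j) v)"
        by (simp only: integral_mult_right_zero bessel_transform_def)
      also have "\<dots> = vec_index (?A *\<^sub>v c) i"
        using i c(1) by (auto simp: scalar_prod_def atLeast0LessThan intro!: sum.cong)
      also have "\<dots> = 0" using c(3) i by simp
      finally show ?thesis .
    qed
  qed (use assms \<open>b \<noteq> 0\<close> in auto)
  moreover have "card (x ` {..<m}) = m" using assms(1) by (simp add: card_image)
  \<comment> \<open>The count yields m \<le> degree b, but every monomial of \<open>b\<close> has
    exponent below m.\<close>
  ultimately have "coeff b (degree b) = 0"
    by (simp add: b_def coeff_sum coeff_monom)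
  thus False using \<open>b \<noteq> 0\<close> by simp
qed

section \<open>The Bessel function of the first kind and the Mehler--Heine asymptotics\<close>

definition bessel_coeff :: "real \<Rightarrow> nat \<Rightarrow> real" where
  "bessel_coeff \<alpha> l = (- 1 / 4) ^ l / (fact l * Gamma (real l + \<alpha> + 1))"

text \<open>The entire part of the Bessel function: J_s (x) is (x / 2)^s times this series at x^2.
  Separating the branch power makes differentiation in w a shift of the index.\<close>

definition bessel_series :: "real \<Rightarrow> real \<Rightarrow> real" where
  "bessel_series \<alpha> w = (\<Sum>l. bessel_coeff \<alpha> l * w ^ l)"

lemma bessel_coeff_Suc:
  assumes "\<alpha> > - 1"
  shows "bessel_coeff \<alpha> (Suc l) = - bessel_coeff \<alpha> l / (4 * (real l + 1) * (real l + \<alpha> + 1))"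
proof -
  have "Gamma (real (Suc l) + \<alpha> + 1) = (real l + \<alpha> + 1) * Gamma (real l + \<alpha> + 1)"
    using Gamma_plus1[of "real l + \<alpha> + 1"] assms nonpos_Ints_nonpos[of "real l + \<alpha> + 1"]
    by (auto simp: add_ac)
  thus ?thesis by (simp add: bessel_coeff_def algebra_simps)
qed

lemma summable_bessel_coeff:
  assumes "\<alpha> > - 1"
  shows "summable (\<lambda>l. bessel_coeff \<alpha> l * w ^ l)"
proof (rule summable_ratio_test)
  define N where "N = nat \<lceil>\<bar>w\<bar> / (\<alpha> + 1)\<rceil>"
  show "norm (bessel_coeff \<alpha> (Suc l) * w ^ Suc l) \<le> 1/2 * norm (bessel_coeff \<alpha> l * w ^ l)" if "l \<ge> N" for l
  proof -
    have "\<bar>w\<bar> / (\<alpha> + 1) \<le> real l" using that unfolding N_def by linarith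
    hence "\<bar>w\<bar> \<le> real l * (\<alpha> + 1)" using assms by (simp add: field_simps)
    also have "\<dots> \<le> (real l + 1) * (real l + \<alpha> + 1)" using assms by (intro mult_mono) auto
    finally have "\<bar>w\<bar> \<le> (real l + 1) * (real l + \<alpha> + 1)" .
    moreover have "(real l + 1) * (real l + \<alpha> + 1) > 0" using assms by (intro mult_pos_pos) auto
    ultimately have "\<bar>w\<bar> / (4 * ((real l + 1) * (real l + \<alpha> + 1))) \<le> 1 / 2"
      by (simp only: divide_le_eq) simp
    hence "\<bar>w\<bar> / (4 * (real l + 1) * (real l + \<alpha> + 1)) \<le> 1 / 2"
      by (simp only: mult.assoc)
    hence "norm (bessel_coeff \<alpha> l * w ^ l) * (\<bar>w\<bar> / (4 * (real l + 1) * (real l + \<alpha> + 1)))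
       \<le> norm (bessel_coeff \<alpha> l * w ^ l) * (1/2)"
      by (intro mult_left_mono) auto
    thus ?thesis using assms by (simp add: bessel_coeff_Suc abs_mult mult_ac)
  qed
qed simp

lemma has_derivative_bessel_series:
  assumes "\<alpha> > - 1"
  shows "(bessel_series \<alpha> has_real_derivative - bessel_series (\<alpha> + 1) w / 4) (at w)"
proof -
  have "((\<lambda>w. \<Sum>l. bessel_coeff \<alpha> l * w ^ l) has_real_derivative (\<Sum>l. diffs (bessel_coeff \<alpha>) l * w ^ l)) (at w)"
    by (rule termdiffs_strong_converges_everywhere) (rule summable_bessel_coeff[OF assms])
  also have "diffs (bessel_coeff \<alpha>) = (\<lambda>l. - 1 / 4 * bessel_coeff (\<alpha> + 1) l)"
    by (auto simp: diffs_def bessel_coeff_def fun_eq_iff add_ac simp del: of_nat_Suc) (simp add: add_ac)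
  also have "(\<Sum>l. - 1 / 4 * bessel_coeff (\<alpha> + 1) l * w ^ l) = - 1 / 4 * bessel_series (\<alpha> + 1) w"
    unfolding bessel_series_def mult.assoc
    by (rule suminf_mult) (use assms in \<open>auto intro!: summable_bessel_coeff\<close>)
  finally show ?thesis unfolding bessel_series_def[abs_def] by simp
qed

lemma bessel_J_eq_bessel_series:
  assumes "s > - 1" "x > 0"
  shows "bessel_J s x = (x / 2) powr s * bessel_series s (x\<^sup>2)"
proof -
  have "(- 1) ^ k / (fact k * Gamma (real k + s + 1)) * (x / 2) powr (2 * real k + s)
      = (x / 2) powr s * (bessel_coeff s k * (x\<^sup>2) ^ k)" for k
  proof -
    have "(x / 2) powr (2 * real k + s) = (x / 2) powr (real (2 * k)) * (x / 2) powr s"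
      by (simp add: powr_add)
    also have "(x / 2) powr (real (2 * k)) = (x / 2) ^ (2 * k)"
      using assms by (subst powr_realpow) auto
    also have "\<dots> = (1 / 4) ^ k * (x\<^sup>2) ^ k"
      by (simp add: power_mult power_divide)
    finally have "(x / 2) powr (2 * real k + s) = (1 / 4) ^ k * (x\<^sup>2) ^ k * (x / 2) powr s" .
    moreover have "(- 1 / 4 :: real) ^ k = (- 1) ^ k * (1 / 4) ^ k"
      by (simp flip: power_mult_distrib)
    ultimately show ?thesis
      by (simp add: bessel_coeff_def)
  qed
  thus ?thesis using summable_bessel_coeff[OF assms(1)]
    by (simp add: bessel_J_def bessel_series_def suminf_mult)
qed

text \<open>The Jacobi polynomial $P_N^{(\alpha,0)}(t)$ as a polynomial in $u = 1 - t$.\<close>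

definition jacobi_coeff :: "nat \<Rightarrow> real \<Rightarrow> nat \<Rightarrow> real" where
  "jacobi_coeff N \<alpha> l = (- 1 / 2) ^ l * real (N choose l) * pochhammer (\<alpha> + real l + 1) N / fact N"

definition jacobi_poly :: "nat \<Rightarrow> real \<Rightarrow> real poly" where
  "jacobi_poly N \<alpha> = (\<Sum>l\<le>N. monom (jacobi_coeff N \<alpha> l) l)"

lemma poly_jacobi_poly: "poly (jacobi_poly N \<alpha>) u = (\<Sum>l\<le>N. jacobi_coeff N \<alpha> l * u ^ l)"
  by (simp add: jacobi_poly_def poly_sum poly_monom)

text \<open>Gauss's limit for the Gamma function taken at N n. The factor (N n / n) powr \<alpha>
  accounts for scaling by n while the degree is N n.\<close>

lemma pochhammer_growth:
  fixes N :: "nat \<Rightarrow> nat"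
  assumes "\<alpha> > - 1" and lim: "(\<lambda>n. real (N n) / real n) \<longlonglongrightarrow> 1"
  shows "(\<lambda>n. real n powr (- \<alpha>) * pochhammer (\<alpha> + 1) (N n) / fact (N n)) \<longlonglongrightarrow> 1 / Gamma (\<alpha> + 1)"
proof -
  have "eventually (\<lambda>n. real (N n) / real n > 1 / 2) sequentially"
    by (rule order_tendstoD(1)[OF lim]) simp
  hence ev: "eventually (\<lambda>n. n > 0 \<and> real n / 2 < real (N n)) sequentially"
    using eventually_gt_at_top[of 0] by eventually_elim (auto simp: field_simps)
  have N: "filterlim (\<lambda>n. real (N n)) at_top sequentially"
  proof (rule filterlim_at_top_mono)
    show "filterlim (\<lambda>n. real n / 2) at_top sequentially" by real_asymp
    show "eventually (\<lambda>n. real n / 2 \<le> real (N n)) sequentially" using ev by eventually_elim auto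
  qed
  hence N': "filterlim N at_top sequentially"
    by (subst filterlim_sequentially_iff_filterlim_real)
  have "\<alpha> + 1 > 0" using assms by simp
  from Gamma_real_pos[OF this] have "Gamma (\<alpha> + 1) \<noteq> 0" by simp
  hence L: "(\<lambda>n. (real (N n) / real n) powr \<alpha> * (real (N n) / (real (N n) + (\<alpha> + 1))) / Gamma_series (\<alpha> + 1) (N n))
      \<longlonglongrightarrow> 1 powr \<alpha> * 1 / Gamma (\<alpha> + 1)"
    by (intro tendsto_intros lim filterlim_compose[OF Gamma_series_LIMSEQ N']
          filterlim_compose[OF _ N, of "\<lambda>x. x / (x + (\<alpha> + 1))"]) (real_asymp | simp)+
  have eq: "eventually (\<lambda>n. real n powr (- \<alpha>) * pochhammer (\<alpha> + 1) (N n) / fact (N n) = 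
      (real (N n) / real n) powr \<alpha> * (real (N n) / (real (N n) + (\<alpha> + 1))) / Gamma_series (\<alpha> + 1) (N n)) sequentially"
    using ev
  proof eventually_elim
    case (elim n)
    hence pos: "real (N n) > 0" "real n > 0" by auto
    define S where "S = real (N n) + (\<alpha> + 1)"
    have "pochhammer (\<alpha> + 1) (Suc (N n)) = pochhammer (\<alpha> + 1) (N n) * S"
      unfolding S_def by (subst pochhammer_Suc) (simp add: add_ac)
    moreover have "exp ((\<alpha> + 1) * ln (real (N n))) = real (N n) powr \<alpha> * real (N n)"
      using pos by (simp add: powr_def exp_add[symmetric] ring_distribs) (simp add: exp_add)
    moreover have "S > 0" using assms by (auto simp: S_def)
    ultimately show ?case
      using pos unfolding S_def[symmetric]
      by (simp add: Gamma_series_def powr_divide powr_minus field_simps)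
  qed
  show ?thesis using L by (simp add: tendsto_cong[OF eq])
qed

text \<open>After division by the value at 0 the coefficients converge one by one, and Tannery's
  theorem exchanges limit and sum. The degree is only asymptotic to n because the application has
  degree n - m - 1 but scales by n.\<close>

lemma mehler_heine:
  fixes N :: "nat \<Rightarrow> nat"
  assumes \<alpha>: "\<alpha> > - 1" and N_le: "\<And>n. N n \<le> n" and lim: "(\<lambda>n. real (N n) / real n) \<longlonglongrightarrow> 1"
  shows "(\<lambda>n. real n powr (- \<alpha>) * poly (jacobi_poly (N n) \<alpha>) (z / (2 * (real n)\<^sup>2)))
           \<longlonglongrightarrow> bessel_series \<alpha> z"
proof -
  \<comment> \<open>The ratio of the l-th term to its limit. It contains a zero factor as soon as l
    exceeds N n, which turns the finite sum into an infinite series.\<close>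
  define T where "T = (\<lambda>l n. \<Prod>i<l. (real (N n) - real i) * (real (N n) + \<alpha> + 1 + real i) / (real n)\<^sup>2)"
  define c where "c = (\<lambda>l. (- z / 4) ^ l / (fact l * pochhammer (\<alpha> + 1) l))"
  \<comment> \<open>For i < N n a factor of \<open>T\<close> is at most N (N + \<alpha> + 1) / n^2,
    and N + \<alpha> + 1 is at most n + \<bar>\<alpha>\<bar> * n + n.\<close>
  define C where "C = 2 + \<bar>\<alpha>\<bar>"
  have Gpos: "Gamma (\<alpha> + 1) > 0" using \<alpha> by simp
  have ppos: "pochhammer (\<alpha> + 1) l > 0" for l using \<alpha> by (intro pochhammer_pos) auto
  have c_eq: "(- z / 4) ^ l / (fact l * pochhammer (\<alpha> + 1) l) = Gamma (\<alpha> + 1) * (bessel_coeff \<alpha> l * z ^ l)" for l z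
  proof -
    have "\<alpha> + 1 \<notin> \<int>\<^sub>\<le>\<^sub>0" using \<alpha> nonpos_Ints_nonpos[of "\<alpha> + 1"] by auto
    from pochhammer_Gamma[OF this, of l]
    have "pochhammer (\<alpha> + 1) l = Gamma (real l + \<alpha> + 1) / Gamma (\<alpha> + 1)"
      by (simp only: add_ac)
    hence "Gamma (real l + \<alpha> + 1) = pochhammer (\<alpha> + 1) l * Gamma (\<alpha> + 1)"
      using Gpos by (simp del: Gamma_eq_zero_iff)
    moreover have "(- z / 4) ^ l = (- 1 / 4) ^ l * z ^ l"
      by (simp flip: power_mult_distrib)
    ultimately show ?thesis using Gpos
      by (simp add: bessel_coeff_def del: Gamma_eq_zero_iff)
  qed
  have c_eq': "c l = Gamma (\<alpha> + 1) * (bessel_coeff \<alpha> l * z ^ l)" for l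
    by (simp only: c_def c_eq)
  have T_lim: "(\<lambda>n. T l n) \<longlonglongrightarrow> 1" for l
  proof -
    have L: "(\<lambda>n. \<Prod>i<l. (real (N n) / real n - real i * (1 / real n)) * (real (N n) / real n + (\<alpha> + 1 + real i) * (1 / real n)))
       \<longlonglongrightarrow> (\<Prod>i<l. (1 - real i * 0) * (1 + (\<alpha> + 1 + real i) * 0))"
      by (intro tendsto_prod tendsto_mult tendsto_diff tendsto_add lim tendsto_const lim_1_over_n)
    have eq: "eventually (\<lambda>n. (\<Prod>i<l. (real (N n) / real n - real i * (1 / real n)) * (real (N n) / real n + (\<alpha> + 1 + real i) * (1 / real n))) = T l n) sequentially"
      using eventually_gt_at_top[of 0]
      by eventually_elim (auto simp: T_def field_simps power2_eq_square intro!: prod.cong)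
    from Lim_transform_eventually[OF L eq] show ?thesis by simp
  qed
  have T_bound: "0 \<le> T l n \<and> T l n \<le> C ^ l" for l n
  proof (cases "l \<le> N n")
    case True
    have "0 \<le> (real (N n) - real i) * (real (N n) + \<alpha> + 1 + real i) / (real n)\<^sup>2 \<and>
        (real (N n) - real i) * (real (N n) + \<alpha> + 1 + real i) / (real n)\<^sup>2 \<le> C" if "i < l" for i
    proof -
      have i: "i < N n" "n > 0" using that True N_le[of n] by auto
      have "(real (N n) - real i) * (real (N n) + \<alpha> + 1 + real i)
          = real (N n) * (real (N n) + \<alpha> + 1) - real i * (real i + \<alpha> + 1)"
        by (simp add: algebra_simps)
      also have "\<dots> \<le> real (N n) * (real (N n) + \<alpha> + 1)"
        using \<alpha> by auto
      also have "\<dots> \<le> real n * (real n * C)"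
      proof (rule mult_mono)
        have "real (N n) + \<alpha> + 1 \<le> real n + \<bar>\<alpha>\<bar> * 1 + 1" using N_le[of n] by simp
        also have "\<dots> \<le> real n + \<bar>\<alpha>\<bar> * real n + real n"
          using i by (intro add_mono mult_left_mono) auto
        finally show "real (N n) + \<alpha> + 1 \<le> real n * C" by (simp add: C_def algebra_simps)
      qed (use N_le[of n] \<alpha> in auto)
      finally have "(real (N n) - real i) * (real (N n) + \<alpha> + 1 + real i) / (real n)\<^sup>2 \<le> C"
        using i by (simp add: field_simps power2_eq_square)
      moreover have "0 \<le> (real (N n) - real i) * (real (N n) + \<alpha> + 1 + real i)"
        using i \<alpha> by (intro mult_nonneg_nonneg) auto
      ultimately show ?thesis by auto
    qed
    hence "0 \<le> T l n \<and> T l n \<le> (\<Prod>i<l. C)"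
      unfolding T_def by (intro conjI prod_nonneg prod_mono) auto
    thus ?thesis by simp
  next
    case False
    hence "T l n = 0" by (auto simp: T_def)
    thus ?thesis by (simp add: C_def)
  qed
  have expand: "real n powr (- \<alpha>) * poly (jacobi_poly (N n) \<alpha>) (z / (2 * (real n)\<^sup>2))
      = (real n powr (- \<alpha>) * pochhammer (\<alpha> + 1) (N n) / fact (N n)) * (\<Sum>l. c l * T l n)" for n
  proof -
    have "jacobi_coeff (N n) \<alpha> l * (z / (2 * (real n)\<^sup>2)) ^ l = pochhammer (\<alpha> + 1) (N n) / fact (N n) * (c l * T l n)" for l
    proof -
      \<comment> \<open>Both sides are the rising factorial of \<alpha> + 1 of length l + N n, split
        at l and at N n.\<close>
      have "pochhammer (\<alpha> + 1) l * pochhammer (\<alpha> + 1 + real l) (N n) = pochhammer (\<alpha> + 1) (N n) * pochhammer (\<alpha> + 1 + real (N n)) l"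
        using pochhammer_product[of l "l + N n" "\<alpha> + 1"] pochhammer_product[of "N n" "l + N n" "\<alpha> + 1"] by simp
      hence 1: "pochhammer (\<alpha> + real l + 1) (N n) = pochhammer (\<alpha> + 1) (N n) * pochhammer (\<alpha> + 1 + real (N n)) l / pochhammer (\<alpha> + 1) l"
        using ppos[of l] by (simp add: field_simps)
      have 2: "pochhammer (\<alpha> + 1 + real (N n)) l = (\<Prod>i<l. real (N n) + \<alpha> + 1 + real i)"
        by (simp add: pochhammer_prod atLeast0LessThan add_ac)
      have 3: "real (N n choose l) = (\<Prod>i<l. real (N n) - real i) / fact l"
        using gbinomial_mult_fact[of l "real (N n)"] by (simp add: binomial_gbinomial atLeast0LessThan field_simps)
      have 4: "T l n = (\<Prod>i<l. real (N n) - real i) * (\<Prod>i<l. real (N n) + \<alpha> + 1 + real i) / ((real n)\<^sup>2) ^ l"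
        by (simp add: T_def prod_dividef prod.distrib)
      have e: "(- 1 / 2) ^ l * (z / (2 * (real n)\<^sup>2)) ^ l = (- z / 4) ^ l / ((real n)\<^sup>2) ^ l"
        by (simp add: field_simps flip: power_mult_distrib power_divide)
      have regroup: "A * (P1 / f) * (p * P2 / d) / F * B = p / F * (Z / (f * d) * (P1 * P2 / W))"
        if "A * B = Z / W" for A B Z W P1 P2 p f d F :: real
      proof -
        have "A * (P1 / f) * (p * P2 / d) / F * B = (A * B) * (P1 * p * P2 / (f * d * F))" by simp
        thus ?thesis unfolding that by (simp add: mult_ac)
      qed
      show ?thesis unfolding jacobi_coeff_def 1 2 3 4 c_def
        by (rule regroup[OF e])
    qed
    hence "poly (jacobi_poly (N n) \<alpha>) (z / (2 * (real n)\<^sup>2)) = pochhammer (\<alpha> + 1) (N n) / fact (N n) * (\<Sum>l\<le>N n. c l * T l n)"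
      by (simp add: poly_jacobi_poly sum_distrib_left)
    also have "(\<Sum>l\<le>N n. c l * T l n) = (\<Sum>l. c l * T l n)"
      by (rule suminf_finite[symmetric]) (auto simp: T_def)
    finally show ?thesis by simp
  qed
  have tannery: "(\<lambda>n. \<Sum>l. c l * T l n) \<longlonglongrightarrow> (\<Sum>l. c l * 1)"
  proof (intro tannerys_theorem[THEN conjunct2, THEN conjunct2] tendsto_mult tendsto_const T_lim)
    show "eventually (\<lambda>(l, n). norm (c l * T l n) \<le> norm (c l * C ^ l)) (at_top \<times>\<^sub>F sequentially)"
      using T_bound by (intro always_eventually) (auto simp: abs_mult C_def intro!: mult_left_mono)
    have "norm (c l * C ^ l) = Gamma (\<alpha> + 1) * norm (bessel_coeff \<alpha> l * (z * C) ^ l)" for l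
      using Gpos by (simp add: c_eq' abs_mult power_mult_distrib power_abs)
    moreover have "summable (\<lambda>l. norm (bessel_coeff \<alpha> l * (z * C) ^ l))"
      by (rule powser_insidea[OF summable_bessel_coeff[OF \<alpha>, of "\<bar>z * C\<bar> + 1"]]) auto
    ultimately show "summable (\<lambda>l. norm (c l * C ^ l))"
      by (simp add: summable_mult)
  qed auto
  have "(\<Sum>l. c l * 1) = Gamma (\<alpha> + 1) * bessel_series \<alpha> z"
    using summable_bessel_coeff[OF \<alpha>] by (simp add: c_eq' suminf_mult bessel_series_def)
  from tendsto_mult[OF pochhammer_growth[OF \<alpha> lim] tannery[unfolded this]]
  show ?thesis unfolding expand using Gpos by simp
qed

section \<open>Rodrigues' formula\<close>

text \<open>The k-th derivative of u^(\<alpha> + N) * (1 - u / 2)^N is u^(\<alpha> + N - k) times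
  this polynomial; the recursion is the product rule.\<close>

primrec rodrigues_poly :: "nat \<Rightarrow> real \<Rightarrow> nat \<Rightarrow> real poly" where
  "rodrigues_poly N \<alpha> 0 = [:1, - 1 / 2:] ^ N"
| "rodrigues_poly N \<alpha> (Suc k) =
     Polynomial.smult (\<alpha> + real N - real k) (rodrigues_poly N \<alpha> k) + pCons 0 (pderiv (rodrigues_poly N \<alpha> k))"

text \<open>Each step applies an operator a + u * d/du, which is diagonal on monomials and
  multiplies u^l by a + l.\<close>

lemma coeff_rodrigues_poly:
  "coeff (rodrigues_poly N \<alpha> k) l =
     (- 1 / 2) ^ l * real (N choose l) * (\<Prod>i<k. \<alpha> + real N - real i + real l)"
proof (induction k arbitrary: l)
  case 0
  have "[:1, - 1 / 2 :: real:] ^ N = (\<Sum>l\<le>N. monom ((- 1 / 2) ^ l * real (N choose l)) l)"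
  proof (rule poly_eq_poly_eq_iff[THEN iffD1, OF ext])
    fix x :: real
    have "(- (x / 2) + 1) ^ N = (\<Sum>k\<le>N. real (N choose k) * (- (x / 2)) ^ k * 1 ^ (N - k))"
      by (rule binomial_ring)
    moreover have "(- (x / 2)) ^ k = (- 1 / 2) ^ k * x ^ k" for k
      by (simp flip: power_mult_distrib)
    ultimately show "poly ([:1, - 1 / 2:] ^ N) x = poly (\<Sum>l\<le>N. monom ((- 1 / 2) ^ l * real (N choose l)) l) x"
      by (simp add: poly_sum poly_monom mult_ac)
  qed
  thus ?case by (simp add: coeff_sum coeff_monom) 
next
  case (Suc k)
  have "coeff (pCons 0 (pderiv (rodrigues_poly N \<alpha> k))) l = real l * coeff (rodrigues_poly N \<alpha> k) l"
    by (cases l) (auto simp: coeff_pderiv)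
  thus ?case by (simp add: Suc algebra_simps)
qed

lemma jacobi_poly_eq_rodrigues_poly:
  "jacobi_poly N \<alpha> = Polynomial.smult (1 / fact N) (rodrigues_poly N \<alpha> N)"
proof (rule poly_eqI)
  fix l
  have "(\<Prod>i<N. \<alpha> + real N - real i + real l) = pochhammer (\<alpha> + real l + 1) N"
    unfolding pochhammer_prod atLeast0LessThan
    by (rule prod.reindex_bij_witness[of _ "\<lambda>i. N - 1 - i" "\<lambda>i. N - 1 - i"]) (auto simp: of_nat_diff)
  thus "coeff (jacobi_poly N \<alpha>) l = coeff (Polynomial.smult (1 / fact N) (rodrigues_poly N \<alpha> N)) l"
    by (simp add: coeff_rodrigues_poly jacobi_poly_def coeff_sum coeff_monom jacobi_coeff_def)
qed

text \<open>Each differentiation costs at most one order of vanishing at u = 2. What is left makes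
  the boundary terms at 2 vanish in the integration by parts.\<close>

lemma rodrigues_poly_dvd:
  assumes "k \<le> N"
  shows "[:1, - 1 / 2:] ^ (N - k) dvd rodrigues_poly N \<alpha> k"
  using assms
proof (induction k)
  case (Suc k)
  define L where "L = ([:1, - 1 / 2:] :: real poly)"
  have "N - k = Suc (N - Suc k)" using Suc.prems by simp
  hence "L ^ Suc (N - Suc k) dvd rodrigues_poly N \<alpha> k" using Suc by (simp add: L_def)
  then obtain S where S: "rodrigues_poly N \<alpha> k = L ^ Suc (N - Suc k) * S" by (elim dvdE)
  have "pderiv (L ^ Suc (N - Suc k) * S) = L ^ (N - Suc k) * (L * pderiv S + Polynomial.smult (1 + of_nat (N - Suc k)) (pderiv L) * S)"
    by (simp add: pderiv_mult pderiv_power_Suc algebra_simps del: power_Suc) (simp add: algebra_simps)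
  hence "L ^ (N - Suc k) dvd pderiv (rodrigues_poly N \<alpha> k)"
    unfolding S by (metis dvd_triv_left)
  hence "L ^ (N - Suc k) dvd [:0, 1:] * pderiv (rodrigues_poly N \<alpha> k)"
    by (rule dvd_mult)
  hence "L ^ (N - Suc k) dvd pCons 0 (pderiv (rodrigues_poly N \<alpha> k))" by simp
  moreover have "L ^ (N - Suc k) dvd Polynomial.smult (\<alpha> + real N - real k) (rodrigues_poly N \<alpha> k)"
    unfolding S by (intro dvd_smult) (simp add: mult.assoc)
  ultimately have "L ^ (N - Suc k) dvd rodrigues_poly N \<alpha> (Suc k)" by simp
  thus ?case by (simp add: L_def)
qed simp

lemma poly_rodrigues_poly_2:
  assumes "k < N"
  shows "poly (rodrigues_poly N \<alpha> k) 2 = 0"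
proof -
  obtain S where "rodrigues_poly N \<alpha> k = [:1, - 1 / 2:] ^ (N - k) * S"
    using rodrigues_poly_dvd[of k N \<alpha>] assms by (auto elim: dvdE)
  thus ?thesis using assms by (simp add: poly_power)
qed

text \<open>Rodrigues' formula, integrated by parts \<open>N\<close> times against \<open>f 0\<close>.\<close>

lemma has_integral_jacobi_poly:
  fixes f :: "nat \<Rightarrow> real \<Rightarrow> real"
  assumes \<alpha>: "\<alpha> > - 1"
    and f: "\<And>j u. u \<in> {0..2} \<Longrightarrow> (f j has_real_derivative f (Suc j) u) (at u)"
    and I: "((\<lambda>u. u powr (\<alpha> + real N) * (1 - u / 2) ^ N * f N u) has_integral I) {0..2}"
  shows "((\<lambda>u. u powr \<alpha> * (poly (jacobi_poly N \<alpha>) u * f 0 u)) has_integral ((- 1) ^ N / fact N * I)) {0..2}"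
proof -
  define R where "R = rodrigues_poly N \<alpha>"
  have "((\<lambda>u. u powr (\<alpha> + real N - real k) * poly (R k) u * f (N - k) u) has_integral ((- 1) ^ k * I)) {0..2}"
    if "k \<le> N" for k
    using that
  proof (induction k)
    case 0
    thus ?case using I by (simp add: R_def poly_power)
  next
    case (Suc k)
    define e where "e = \<alpha> + real N - real k"
    define j where "j = N - Suc k"
    \<comment> \<open>Here k < N, so the exponent is positive and the boundary term at 0 vanishes
      even for negative \<alpha>. Each step moves one derivative from \<open>f\<close> to the
      weight.\<close>
    have e: "e > 0" using \<alpha> Suc.prems by (simp add: e_def)
    have j: "N - k = Suc j" using Suc.prems by (simp add: j_def)
    have "((\<lambda>u. u powr (e - 1) * poly (R (Suc k)) u * f j u + u powr e * poly (R k) u * f (Suc j) u) has_integral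
       (2 powr e * poly (R k) 2 * f j 2 - 0 powr e * poly (R k) 0 * f j 0)) {0..2}"
    \<comment> \<open>The power of u need not be differentiable at 0, only continuous there.\<close>
    proof (rule fundamental_theorem_of_calculus_interior)
      have "continuous_on {0..2} (f j)"
        by (rule DERIV_continuous_on) (use f in \<open>blast intro: has_field_derivative_at_within\<close>)
      thus "continuous_on {0..2} (\<lambda>u. u powr e * poly (R k) u * f j u)"
        using e by (intro continuous_intros continuous_on_powr') auto
      show "((\<lambda>u. u powr e * poly (R k) u * f j u) has_vector_derivative
         u powr (e - 1) * poly (R (Suc k)) u * f j u + u powr e * poly (R k) u * f (Suc j) u) (at u)"
        if "u \<in> {0<..<2}" for u
      proof -
        have "((\<lambda>u. u powr e * poly (R k) u * f j u) has_real_derivative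
          (e * u powr (e - 1) * poly (R k) u + u powr e * poly (pderiv (R k)) u) * f j u + u powr e * poly (R k) u * f (Suc j) u) (at u)"
          using that by (auto intro!: derivative_eq_intros f)
        moreover have "u powr e = u powr (e - 1) * u" using that by (simp add: powr_diff)
        hence "e * u powr (e - 1) * poly (R k) u + u powr e * poly (pderiv (R k)) u = u powr (e - 1) * poly (R (Suc k)) u"
          by (simp add: R_def e_def algebra_simps)
        ultimately show ?thesis
          by (simp add: has_real_derivative_iff_has_vector_derivative)
      qed
    qed simp
    hence "((\<lambda>u. u powr (e - 1) * poly (R (Suc k)) u * f j u + u powr e * poly (R k) u * f (Suc j) u) has_integral 0) {0..2}"
      using poly_rodrigues_poly_2[of k N \<alpha>] Suc.prems e by (simp add: R_def del: rodrigues_poly.simps)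
    moreover have "((\<lambda>u. u powr e * poly (R k) u * f (Suc j) u) has_integral (- 1) ^ k * I) {0..2}"
      using Suc j by (simp add: e_def)
    ultimately have "((\<lambda>u. (u powr (e - 1) * poly (R (Suc k)) u * f j u + u powr e * poly (R k) u * f (Suc j) u)
      - u powr e * poly (R k) u * f (Suc j) u) has_integral (0 - (- 1) ^ k * I)) {0..2}"
      by (rule has_integral_diff)
    thus ?case by (simp add: e_def j_def algebra_simps)
  qed
  from has_integral_mult_right[OF this[OF order.refl], of "1 / fact N"]
  show ?thesis by (simp add: R_def jacobi_poly_eq_rodrigues_poly mult_ac)
qed

section \<open>Integrals against the Jacobi weight\<close>

lemma set_integrable_powr_mult:
  fixes g :: "real \<Rightarrow> real"
  assumes "\<alpha> > - 1" "continuous_on {0..2} g" and [measurable]: "g \<in> borel_measurable borel"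
  shows "set_integrable lborel {0<..<2} (\<lambda>u. u powr \<alpha> * g u)"
proof -
  have "compact (g ` {0..2})" using assms by (intro compact_continuous_image) auto
  then obtain C where C: "\<And>u. u \<in> {0..2} \<Longrightarrow> \<bar>g u\<bar> \<le> C"
    using compact_imp_bounded bounded_iff by (metis imageI real_norm_def)
  have "integrable halfline (\<lambda>y. y powr \<alpha> * exp (- 1 * y))"
    using integrable_gamma_density[of "\<alpha> + 1" 1] assms by simp
  hence "set_integrable lborel {0<..<2} (\<lambda>y. C * exp 2 * (y powr \<alpha> * exp (- 1 * y)))"
    unfolding integrable_halfline_iff
    by (intro set_integrable_mult_right) (erule set_integrable_subset, auto)
  thus ?thesis
  proof (rule set_integrable_bound)
    show "AE u in lborel. u \<in> {0<..<2} \<longrightarrow> norm (u powr \<alpha> * g u) \<le> norm (C * exp 2 * (u powr \<alpha> * exp (- 1 * u)))"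
    proof (intro AE_I2 impI)
      fix u :: real assume u: "u \<in> {0<..<2}"
      \<comment> \<open>On the interval exp (2 - u) is at least 1, so a Gamma density serves as
        majorant for the power.\<close>
      have "\<bar>g u\<bar> * 1 \<le> C * exp (2 - u)"
        using C[of u] C[of 1] u by (intro mult_mono) auto
      hence "u powr \<alpha> * \<bar>g u\<bar> \<le> u powr \<alpha> * (C * exp (2 - u))"
        by (intro mult_left_mono) auto
      moreover have "exp (2 - u) = exp 2 * exp (- u)" by (simp add: exp_add[symmetric])
      moreover have "C \<ge> 0" using C[of 1] by simp
      ultimately show "norm (u powr \<alpha> * g u) \<le> norm (C * exp 2 * (u powr \<alpha> * exp (- 1 * u)))"
        by (simp add: abs_mult mult_ac)
    qed
  qed (auto simp: set_borel_measurable_def)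
qed

definition jacobi_integral :: "real \<Rightarrow> (real \<Rightarrow> real) \<Rightarrow> real" where
  "jacobi_integral \<alpha> g = (LBINT u:{0<..<2}. u powr \<alpha> * g u)"

lemma jacobi_integral_eqI:
  assumes "\<alpha> > - 1" "continuous_on {0..2} g" "g \<in> borel_measurable borel"
    and "((\<lambda>u. u powr \<alpha> * g u) has_integral I) {0..2}"
  shows "jacobi_integral \<alpha> g = I"
proof -
  have "((\<lambda>u. u powr \<alpha> * g u) has_integral I) {0<..<2}"
    using assms(4) by (simp add: has_integral_Icc_iff_Ioo)
  thus ?thesis
    using set_borel_integral_eq_integral(2)[OF set_integrable_powr_mult[OF assms(1-3)]]
    by (simp add: jacobi_integral_def integral_unique)
qed

lemma jacobi_integral_has_integral:
  assumes "\<alpha> > - 1" "continuous_on {0..2} g" "g \<in> borel_measurable borel"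
  shows "((\<lambda>u. u powr \<alpha> * g u) has_integral jacobi_integral \<alpha> g) {0..2}"
  using set_borel_integral_eq_integral[OF set_integrable_powr_mult[OF assms]]
  by (simp add: jacobi_integral_def has_integral_Icc_iff_Ioo integrable_integral)

lemma jacobi_integral_jacobi_poly:
  fixes f :: "nat \<Rightarrow> real \<Rightarrow> real"
  assumes \<alpha>: "\<alpha> > - 1"
    and f: "\<And>j u. u \<in> {0..2} \<Longrightarrow> (f j has_real_derivative f (Suc j) u) (at u)"
    and meas: "\<And>j. f j \<in> borel_measurable borel"
  shows "jacobi_integral \<alpha> (\<lambda>u. poly (jacobi_poly N \<alpha>) u * f 0 u) =
    (- 1) ^ N / fact N * jacobi_integral (\<alpha> + real N) (\<lambda>u. (1 - u / 2) ^ N * f N u)"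
proof -
  have cont: "continuous_on {0..2} (f j)" for j
    by (rule DERIV_continuous_on) (use f in \<open>blast intro: has_field_derivative_at_within\<close>)
  note [measurable] = meas
  have "((\<lambda>u. u powr (\<alpha> + real N) * ((1 - u / 2) ^ N * f N u)) has_integral
      jacobi_integral (\<alpha> + real N) (\<lambda>u. (1 - u / 2) ^ N * f N u)) {0..2}"
    using \<alpha> by (intro jacobi_integral_has_integral continuous_intros cont) auto
  from has_integral_jacobi_poly[OF \<alpha> f this[folded mult.assoc]]
  show ?thesis
    using \<alpha> by (intro jacobi_integral_eqI continuous_intros cont) auto
qed

lemma jacobi_integral_jacobi_poly_poly:
  assumes "\<alpha> > - 1"
  shows "jacobi_integral \<alpha> (\<lambda>u. poly (jacobi_poly N \<alpha>) u * poly p u) =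
    (- 1) ^ N / fact N * jacobi_integral (\<alpha> + real N) (\<lambda>u. (1 - u / 2) ^ N * poly ((pderiv ^^ N) p) u)"
  using jacobi_integral_jacobi_poly[OF assms, of "\<lambda>j. poly ((pderiv ^^ j) p)" N]
  by (auto intro: poly_DERIV)

lemma jacobi_poly_orthogonal:
  assumes "\<alpha> > - 1" "degree p < N"
  shows "jacobi_integral \<alpha> (\<lambda>u. poly (jacobi_poly N \<alpha>) u * poly p u) = 0"
proof -
  have "(pderiv ^^ N) p = 0"
    using assms(2)
  proof (induction N arbitrary: p)
    case (Suc N)
    show ?case
    proof (cases "degree p = 0")
      case True
      hence "pderiv p = 0" by (simp add: pderiv_eq_0_iff)
      hence "(pderiv ^^ N) (pderiv p) = 0" by (induction N) auto
      thus ?thesis by (simp add: funpow_Suc_right del: funpow.simps)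
    next
      case False
      hence "degree (pderiv p) < N" using Suc.prems by (simp add: degree_pderiv)
      thus ?thesis using Suc.IH by (simp add: funpow_Suc_right del: funpow.simps)
    qed
  qed simp
  thus ?thesis by (simp add: jacobi_integral_jacobi_poly_poly[OF assms(1)]) (simp add: jacobi_integral_def)
qed

lemma pderiv_funpow_monom: "(pderiv ^^ N) (monom (1::real) N) = [:fact N:]"
proof -
  have "(pderiv ^^ k) (monom (1::real) N) = monom (fact N / fact (N - k)) (N - k)" if "k \<le> N" for k
    using that
  proof (induction k)
    case (Suc k)
    hence "N - k = Suc (N - Suc k)" by simp
    thus ?case using Suc by (simp add: pderiv_monom del: of_nat_Suc)
  qed simp
  from this[of N] show ?thesis by (simp add: monom_0)
qed

lemma jacobi_integral_beta:
  assumes "\<alpha> > - 1"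
  shows "jacobi_integral \<alpha> (\<lambda>u. (1 - u / 2) ^ N) = 2 powr (\<alpha> + 1) * Beta (\<alpha> + 1) (real N + 1)"
proof (rule jacobi_integral_eqI)
  have "((\<lambda>t. t powr (\<alpha> + 1 - 1) * (1 - t) powr (real N + 1 - 1)) has_integral Beta (\<alpha> + 1) (real N + 1)) {0..1}"
    by (rule has_integral_Beta_real) (use assms in auto)
  hence "((\<lambda>t. t powr \<alpha> * (1 - t) powr (real N)) has_integral Beta (\<alpha> + 1) (real N + 1)) (cbox 0 1)"
    by simp
  from has_integral_affinity[OF this, of "1/2" 0]
  have "((\<lambda>u. (u / 2) powr \<alpha> * (1 - u / 2) powr (real N)) has_integral 2 * Beta (\<alpha> + 1) (real N + 1)) {0..2}"
    by simp
  from has_integral_mult_right[OF this, of "2 powr \<alpha>"]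
  have "((\<lambda>u. 2 powr \<alpha> * ((u / 2) powr \<alpha> * (1 - u / 2) powr (real N))) has_integral 2 powr (\<alpha> + 1) * Beta (\<alpha> + 1) (real N + 1)) {0..2}"
    by (simp add: powr_add mult_ac)
  thus "((\<lambda>u. u powr \<alpha> * (1 - u / 2) ^ N) has_integral 2 powr (\<alpha> + 1) * Beta (\<alpha> + 1) (real N + 1)) {0..2}"
  proof (rule has_integral_spike[rotated 2])
    \<comment> \<open>The endpoint is removed because for N = 0 the integrands differ there:
      \<open>0 ^ 0 = 1\<close> but \<open>0 powr 0 = 0\<close>.\<close>
    show "negligible {2::real}" by simp
    show "u powr \<alpha> * (1 - u / 2) ^ N = 2 powr \<alpha> * ((u / 2) powr \<alpha> * (1 - u / 2) powr (real N))"
      if "u \<in> {0..2} - {2}" for u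
      using that by (auto simp: powr_realpow powr_divide)
  qed
qed (use assms in \<open>auto intro!: continuous_intros\<close>)

lemma jacobi_poly_monom_integral:
  assumes "\<alpha> > - 1"
  shows "jacobi_integral \<alpha> (\<lambda>u. poly (jacobi_poly N \<alpha>) u * u ^ N) =
    (- 1) ^ N * (2 powr (\<alpha> + real N + 1) * Beta (\<alpha> + real N + 1) (real N + 1))"
proof -
  have "jacobi_integral \<alpha> (\<lambda>u. poly (jacobi_poly N \<alpha>) u * u ^ N) =
    (- 1) ^ N / fact N * jacobi_integral (\<alpha> + real N) (\<lambda>u. (1 - u / 2) ^ N * fact N)"
    using jacobi_integral_jacobi_poly_poly[OF assms, of N "monom 1 N"]
    by (simp add: poly_monom pderiv_funpow_monom)
  also have "jacobi_integral (\<alpha> + real N) (\<lambda>u. (1 - u / 2) ^ N * fact N)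
     = fact N * jacobi_integral (\<alpha> + real N) (\<lambda>u. (1 - u / 2) ^ N)"
    unfolding jacobi_integral_def by (subst set_integral_mult_right[symmetric]) (simp add: mult_ac)
  finally show ?thesis using assms by (simp add: jacobi_integral_beta)
qed

text \<open>The sign and the factorial in the N-th derivative of 1 / (u + r) cancel those of
  Rodrigues' formula. The oscillating integrand is thereby replaced by a positive one with an
  explicit N-th power, to which dominated convergence applies.\<close>

lemma jacobi_poly_cauchy_integral:
  assumes "\<alpha> > - 1" "r > 0"
  shows "jacobi_integral \<alpha> (\<lambda>u. poly (jacobi_poly N \<alpha>) u * (1 / (u + r))) =
    (LBINT u:{0<..<2}. u powr \<alpha> / (u + r) * (u * (1 - u / 2) / (u + r)) ^ N)"
proof -
  have "jacobi_integral \<alpha> (\<lambda>u. poly (jacobi_poly N \<alpha>) u * ((- 1) ^ 0 * fact 0 / (u + r) ^ Suc 0)) =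
    (- 1) ^ N / fact N * jacobi_integral (\<alpha> + real N) (\<lambda>u. (1 - u / 2) ^ N * ((- 1) ^ N * fact N / (u + r) ^ Suc N))"
  proof (rule jacobi_integral_jacobi_poly[OF assms(1)])
    show "((\<lambda>u. (- 1) ^ j * fact j / (u + r) ^ Suc j) has_real_derivative (- 1) ^ Suc j * fact (Suc j) / (u + r) ^ Suc (Suc j)) (at u)"
      if "u \<in> {0..2}" for j u
    proof -
      define w where "w = u + r"
      have w: "w > 0" using that assms(2) by (simp add: w_def)
      have "((\<lambda>u. (u + r) ^ Suc j) has_real_derivative real (Suc j) * w ^ j) (at u)"
        unfolding w_def by (rule derivative_eq_intros | simp)+
      from DERIV_divide[OF DERIV_const[of "(- 1) ^ j * fact j"] this] w
      have "((\<lambda>u. (- 1) ^ j * fact j / (u + r) ^ Suc j) has_real_derivative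
          - ((- 1) ^ j * fact j * (real (Suc j) * w ^ j)) / (w ^ Suc j * w ^ Suc j)) (at u)"
        unfolding w_def by simp
      also have "- ((- 1) ^ j * fact j * (real (Suc j) * w ^ j)) / (w ^ Suc j * w ^ Suc j) =
        (- 1) ^ Suc j * fact (Suc j) / w ^ Suc (Suc j)"
        using w by (simp add: field_simps)
      finally show ?thesis unfolding w_def .
    qed
  qed measurable
  also have "\<dots> = (LBINT u:{0<..<2}. u powr \<alpha> / (u + r) * (u * (1 - u / 2) / (u + r)) ^ N)"
    unfolding jacobi_integral_def set_integral_mult_right[symmetric]
    by (intro set_lebesgue_integral_cong)
       (use assms in \<open>auto simp: powr_add powr_realpow power_divide power_mult_distrib\<close>)
  finally show ?thesis by simp
qed

section \<open>Asymptotics of the Cauchy transforms\<close>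

lemma one_plus_over_n_power_tendsto_exp:
  fixes N :: "nat \<Rightarrow> nat" and x :: real
  assumes "(\<lambda>n. real (N n) / real n) \<longlonglongrightarrow> 1"
  shows "(\<lambda>n. (1 + x / real n) ^ N n) \<longlonglongrightarrow> exp x"
proof -
  have "(\<lambda>n. real n * ln (1 + x / real n)) \<longlonglongrightarrow> x" by real_asymp
  hence L: "(\<lambda>n. exp (real (N n) / real n * (real n * ln (1 + x / real n)))) \<longlonglongrightarrow> exp (1 * x)"
    by (intro tendsto_intros assms)
  have "eventually (\<lambda>n. 1 + x / real n > 0) sequentially" by real_asymp
  hence "eventually (\<lambda>n. exp (real (N n) / real n * (real n * ln (1 + x / real n))) = (1 + x / real n) ^ N n) sequentially"
    using eventually_gt_at_top[of 0]
    by eventually_elim (simp add: exp_of_nat_mult)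
  from Lim_transform_eventually[OF L this] show ?thesis by simp
qed

text \<open>The substitution is u = y / n although the pole is at distance of order 1 / n^2. At this
  scale the N-th power splits into (1 - y / (2 * n))^N and (1 + v / (2 * n * y))^(- N), the two
  exponentials of the kernel.\<close>

lemma cauchy_transform_tendsto:
  fixes N :: "nat \<Rightarrow> nat"
  assumes \<alpha>: "\<alpha> > - 1" and v: "v > 0" and lim: "(\<lambda>n. real (N n) / real n) \<longlonglongrightarrow> 1"
  shows "(\<lambda>n. real n powr \<alpha> *
      jacobi_integral \<alpha> (\<lambda>u. poly (jacobi_poly (N n) \<alpha>) u * (1 / (u + v / (2 * (real n)\<^sup>2)))))
    \<longlonglongrightarrow> bessel_transform \<alpha> v"
proof -
  \<comment> \<open>The integrand after u = y / n, with its power of n removed and extended by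
    zero.\<close>
  define F where "F = (\<lambda>n y. indicator {0<..<2 * real n} y * (y powr \<alpha> / (y + v / (2 * real n)) *
    (y * (1 - y / (2 * real n)) / (y + v / (2 * real n))) ^ N n))"
  have [measurable]: "F n \<in> borel_measurable borel" for n unfolding F_def by measurable
  have "eventually (\<lambda>n. real (N n) / real n > 1 / 2) sequentially"
    by (rule order_tendstoD(1)[OF lim]) simp
  hence "eventually (\<lambda>n. n > 0 \<and> real n / 2 < real (N n)) sequentially"
    using eventually_gt_at_top[of 0] by eventually_elim (auto simp: field_simps)
  then obtain n0 where n0: "\<And>n. n \<ge> n0 \<Longrightarrow> n > 0 \<and> real n / 2 < real (N n)"
    by (auto simp: eventually_at_top_linorder)
  have pointwise: "(\<lambda>n. F n y) \<longlonglongrightarrow> bessel_kernel \<alpha> y * exp (- v * (1 / (2 * y)))" if y: "y > 0" for y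
  proof -
    have "(\<lambda>n. v / (2 * real n)) \<longlonglongrightarrow> 0" by real_asymp
    hence lim3: "(\<lambda>n. y powr \<alpha> / (y + v / (2 * real n))) \<longlonglongrightarrow> y powr \<alpha> / (y + 0)"
      using y by (intro tendsto_divide tendsto_add tendsto_const) auto
    have L: "(\<lambda>n. y powr \<alpha> / (y + v / (2 * real n)) *
         ((1 + (- y / 2) / real n) ^ N n / (1 + (v / (2 * y)) / real n) ^ N n))
        \<longlonglongrightarrow> y powr \<alpha> / (y + 0) * (exp (- y / 2) / exp (v / (2 * y)))"
      by (intro tendsto_mult[OF lim3] tendsto_divide one_plus_over_n_power_tendsto_exp lim) auto
    have "eventually (\<lambda>n. y < 2 * real n) sequentially" by real_asymp
    hence "eventually (\<lambda>n. y powr \<alpha> / (y + v / (2 * real n)) *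
         ((1 + (- y / 2) / real n) ^ N n / (1 + (v / (2 * y)) / real n) ^ N n) = F n y) sequentially"
      using eventually_gt_at_top[of 0]
    proof eventually_elim
      case (elim n)
      have "1 + (v / (2 * y)) / real n = (y + v / (2 * real n)) / y"
        using y elim by (simp add: field_simps)
      moreover have "1 + (- y / 2) / real n = 1 - y / (2 * real n)" by simp
      ultimately have "(1 + (- y / 2) / real n) / (1 + (v / (2 * y)) / real n) = y * (1 - y / (2 * real n)) / (y + v / (2 * real n))"
        by simp
      thus ?case using y elim by (simp add: F_def flip: power_divide)
    qed
    from Lim_transform_eventually[OF L this] show ?thesis
      using y by (simp add: bessel_kernel_def powr_diff exp_minus field_simps)
  qed
  \<comment> \<open>Since N n > n / 2, the first power is at most exp (- y / 4). By Bernoulli's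
    inequality the second is at most 4 * y / v; this factor y compensates 1 / (y + h) near 0 and
    keeps the majorant integrable for all \<alpha> > - 1.\<close>
  have bound: "norm (F n y) \<le> 4 / v * (y powr \<alpha> * exp (- (1 / 4) * y))" if y: "y > 0" and n: "n \<ge> n0" for n y
  proof (cases "y < 2 * real n")
    case True
    define h where "h = v / (2 * real n)"
    have n: "n > 0" "real n / 2 < real (N n)" using n0 n by auto
    have h: "h > 0" using v n by (simp add: h_def)
    have "(1 - y / (2 * real n)) ^ N n \<le> exp (- (y / (2 * real n))) ^ N n"
      using True n exp_ge_add_one_self[of "- (y / (2 * real n))"] by (intro power_mono) auto
    also have "\<dots> = exp (- (y / (2 * real n) * real (N n)))"
      by (simp add: exp_of_nat_mult[symmetric] mult.commute)
    also have "\<dots> \<le> exp (- (1 / 4) * y)"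
      using n y by (simp add: field_simps)
    finally have 1: "(1 - y / (2 * real n)) ^ N n \<le> exp (- (1 / 4) * y)" .
    have "v / (4 * y) \<le> real (N n) * (h / y)"
      using n y v by (simp add: h_def field_simps)
    also have "\<dots> \<le> 1 + real (N n) * (h / y)" by simp
    also have "\<dots> \<le> (1 + h / y) ^ N n"
      using h y by (intro Bernoulli_inequality) (simp add: divide_nonneg_pos order.trans[of _ 0])
    finally have "1 / (1 + h / y) ^ N n \<le> 1 / (v / (4 * y))"
      using v y h by (intro divide_left_mono mult_pos_pos zero_less_power add_pos_pos divide_pos_pos) auto
    moreover have "(y / (y + h)) ^ N n = 1 / (1 + h / y) ^ N n"
      using y h by (simp add: power_divide field_simps flip: power_mult_distrib)
    ultimately have 2: "(y / (y + h)) ^ N n \<le> 4 * y / v" by simp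
    have 3: "y powr \<alpha> / (y + h) \<le> y powr \<alpha> / y"
      using y h by (intro divide_left_mono) auto
    have "F n y = y powr \<alpha> / (y + h) * ((1 - y / (2 * real n)) ^ N n * (y / (y + h)) ^ N n)"
      using True y by (simp add: F_def h_def power_divide power_mult_distrib)
    also have "\<dots> \<le> y powr \<alpha> / y * (exp (- (1 / 4) * y) * (4 * y / v))"
      using True y h n v by (intro mult_mono 1 2 3) auto
    also have "\<dots> = 4 / v * (y powr \<alpha> * exp (- (1 / 4) * y))" using y by simp
    finally have "F n y \<le> 4 / v * (y powr \<alpha> * exp (- (1 / 4) * y))" .
    moreover have "F n y \<ge> 0" using True y h n unfolding F_def h_def
      by (intro mult_nonneg_nonneg zero_le_power divide_nonneg_nonneg) auto
    ultimately show ?thesis by (simp only: real_norm_def abs_of_nonneg)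
  next
    case False
    thus ?thesis using v by (simp add: F_def)
  qed
  have "(\<lambda>n. \<integral>y. F (n + n0) y \<partial>halfline) \<longlonglongrightarrow> (\<integral>y. bessel_kernel \<alpha> y * exp (- v * (1 / (2 * y))) \<partial>halfline)"
  proof (rule integral_dominated_convergence)
    show "integrable halfline (\<lambda>y. 4 / v * (y powr \<alpha> * exp (- (1 / 4) * y)))"
      using integrable_gamma_density[of "\<alpha> + 1" "1/4"] \<alpha> by (intro integrable_mult_right) simp
    show "AE y in halfline. (\<lambda>n. F (n + n0) y) \<longlonglongrightarrow> bessel_kernel \<alpha> y * exp (- v * (1 / (2 * y)))"
      using AE_halfline_pos by eventually_elim (intro LIMSEQ_ignore_initial_segment pointwise)
    show "AE y in halfline. norm (F (n + n0) y) \<le> 4 / v * (y powr \<alpha> * exp (- (1 / 4) * y))" for n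
      using AE_halfline_pos by eventually_elim (intro bound, auto)
  qed measurable
  hence L: "(\<lambda>n. \<integral>y. F n y \<partial>halfline) \<longlonglongrightarrow> bessel_transform \<alpha> v"
    unfolding bessel_transform_def by (rule LIMSEQ_offset)
  have "eventually (\<lambda>n. (\<integral>y. F n y \<partial>halfline) = real n powr \<alpha> *
      jacobi_integral \<alpha> (\<lambda>u. poly (jacobi_poly (N n) \<alpha>) u * (1 / (u + v / (2 * (real n)\<^sup>2))))) sequentially"
    using eventually_gt_at_top[of 0]
  proof eventually_elim
    case (elim n)
    define r where "r = v / (2 * (real n)\<^sup>2)"
    have r: "r > 0" using v elim by (simp add: r_def)
    define G where "G = (\<lambda>u. indicator {0<..<2} u *\<^sub>R (u powr \<alpha> / (u + r) * (u * (1 - u / 2) / (u + r)) ^ N n))"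
    have "jacobi_integral \<alpha> (\<lambda>u. poly (jacobi_poly (N n) \<alpha>) u * (1 / (u + r))) = (\<integral>u. G u \<partial>lborel)"
      unfolding jacobi_poly_cauchy_integral[OF \<alpha> r] set_lebesgue_integral_def G_def ..
    also have "\<dots> = (1 / real n) * (\<integral>y. G (0 + (1 / real n) * y) \<partial>lborel)"
      using elim by (subst lborel_integral_real_affine[of "1 / real n" _ 0]) auto
    also have "(\<integral>y. G (0 + (1 / real n) * y) \<partial>lborel) = (\<integral>y. real n powr (1 - \<alpha>) * (indicator {0<..} y *\<^sub>R F n y) \<partial>lborel)"
    proof (intro Bochner_Integration.integral_cong refl)
      fix y :: real
      show "G (0 + (1 / real n) * y) = real n powr (1 - \<alpha>) * (indicator {0<..} y *\<^sub>R F n y)"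
      proof (cases "y > 0 \<and> y < 2 * real n")
        case True
        have "y / real n + r = (y + v / (2 * real n)) / real n"
          using elim by (simp add: r_def power2_eq_square field_simps)
        moreover have "G (y / real n) = (y / real n) powr \<alpha> / (y / real n + r) *
           (y / real n * (1 - y / real n / 2) / (y / real n + r)) ^ N n"
          using True elim by (simp add: G_def divide_less_eq)
        ultimately have "G (0 + (1 / real n) * y) = (y / real n) powr \<alpha> / ((y + v / (2 * real n)) / real n) *
           (y / real n * (1 - y / real n / 2) / ((y + v / (2 * real n)) / real n)) ^ N n"
          by simp
        also have "(y / real n) powr \<alpha> / ((y + v / (2 * real n)) / real n) = real n powr (1 - \<alpha>) * (y powr \<alpha> / (y + v / (2 * real n)))"
          using True elim by (simp add: powr_divide powr_diff)
        also have "y / real n * (1 - y / real n / 2) / ((y + v / (2 * real n)) / real n) = y * (1 - y / (2 * real n)) / (y + v / (2 * real n))"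
          using elim by simp
        finally show ?thesis using True by (simp add: F_def)
      qed (use elim in \<open>auto simp: G_def F_def indicator_def field_simps\<close>)
    qed
    also have "\<dots> = real n powr (1 - \<alpha>) * (\<integral>y. F n y \<partial>halfline)"
      by (simp add: integral_restrict_space)
    finally show ?case
      using elim by (simp add: r_def powr_diff)
  qed
  from Lim_transform_eventually[OF L this] show ?thesis .
qed

section \<open>The Christoffel--Darboux formula\<close>

lemma orthonormal_expansion:
  fixes \<Lambda> :: "real poly \<Rightarrow> real" and P :: "nat \<Rightarrow> real poly"
  assumes add: "\<And>p q. \<Lambda> (p + q) = \<Lambda> p + \<Lambda> q"
    and scale: "\<And>c p. \<Lambda> (Polynomial.smult c p) = c * \<Lambda> p"
    and deg: "\<And>j. degree (P j) = j"
    and orth: "\<And>i j. \<Lambda> (P i * P j) = (if i = j then 1 else 0)"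
    and f: "degree f \<le> k"
  shows "f = (\<Sum>j\<le>k. Polynomial.smult (\<Lambda> (f * P j)) (P j))"
  using f
proof (induction k arbitrary: f)
  have split: "\<exists>c g. f = Polynomial.smult c (P k) + g \<and> (\<forall>i\<ge>k. coeff g i = 0)"
    if "degree f \<le> k" for f k
  proof (intro exI conjI allI impI)
    define c where "c = coeff f k / coeff (P k) k"
    \<comment> \<open>For k = 0 the degree alone does not exclude the zero polynomial; normalisation
      does.\<close>
    have "coeff (P k) k \<noteq> 0"
      using deg[of k] orth[of k k] scale[of 0 0] leading_coeff_0_iff[of "P k"] by auto
    thus "coeff (f - Polynomial.smult c (P k)) i = 0" if "i \<ge> k" for i
      using that \<open>degree f \<le> k\<close> deg[of k] coeff_eq_0[of f i] coeff_eq_0[of "P k" i]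
      by (cases "i = k") (auto simp: c_def)
    show "f = Polynomial.smult c (P k) + (f - Polynomial.smult c (P k))" by simp
  qed
  {
    case 0
    from split[OF this] obtain c g where *: "f = Polynomial.smult c (P 0) + g" "\<forall>i. coeff g i = 0"
      by auto
    hence "g = 0" by (intro poly_eqI) simp
    with * show ?case using orth[of 0 0] by (simp add: scale)
  next
    case (Suc k f)
    from split[OF Suc.prems] obtain c g
      where f: "f = Polynomial.smult c (P (Suc k)) + g" and g: "\<forall>i\<ge>Suc k. coeff g i = 0"
      by auto
    have "degree g \<le> k" using g by (intro degree_le) auto
    note g_exp = Suc.IH[OF this]
    have sum: "\<Lambda> (\<Sum>j\<in>A. h j) = (\<Sum>j\<in>A. \<Lambda> (h j))" if "finite A" for A :: "nat set" and h
      using that scale[of 0 0] by (induction A) (auto simp: add)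
    have "\<Lambda> (g * P (Suc k)) = \<Lambda> ((\<Sum>j\<le>k. Polynomial.smult (\<Lambda> (g * P j)) (P j)) * P (Suc k))"
      using g_exp by simp
    also have "\<dots> = (\<Sum>j\<le>k. \<Lambda> (g * P j) * \<Lambda> (P j * P (Suc k)))"
      by (simp add: sum_distrib_right sum scale)
    also have "\<dots> = 0" by (auto simp: orth)
    finally have top: "\<Lambda> (f * P (Suc k)) = c"
      by (simp add: f add scale orth distrib_right)
    have "\<Lambda> (f * P j) = \<Lambda> (g * P j)" if "j \<le> k" for j
      using that by (simp add: f add scale orth distrib_right)
    thus ?case using g_exp top f by (simp add: add.commute)
  }
qed

text \<open>
  Unlike in the textbook form, \<open>D0\<close> and \<open>D1\<close> need not be the orthonormal polynomials of degrees
  \<open>k\<close> and \<open>k + 1\<close>: a triangular change of basis only rescales the right-hand side.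
\<close>

lemma christoffel_darboux:
  fixes \<Lambda> :: "real poly \<Rightarrow> real" and P :: "nat \<Rightarrow> real poly" and x y :: real
  assumes add: "\<And>p q. \<Lambda> (p + q) = \<Lambda> p + \<Lambda> q"
    and scale: "\<And>c p. \<Lambda> (Polynomial.smult c p) = c * \<Lambda> p"
    and deg: "\<And>j. degree (P j) = j"
    and orth: "\<And>i j. \<Lambda> (P i * P j) = (if i = j then 1 else 0)"
    and D0: "degree D0 \<le> k" "\<And>f. degree f < k \<Longrightarrow> \<Lambda> (D0 * f) = 0"
    and D1: "degree D1 \<le> Suc k" "\<And>f. degree f < k \<Longrightarrow> \<Lambda> (D1 * f) = 0"
    and M: "degree M \<le> k" "coeff M k = 1"
  shows "coeff D1 (Suc k) * \<Lambda> (D0 * M) * ((x - y) * (\<Sum>j\<le>k. poly (P j) x * poly (P j) y)) =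
    poly D1 x * poly D0 y - poly D0 x * poly D1 y"
proof -
  note expansion = orthonormal_expansion[of \<Lambda> P, OF add scale deg orth]
  define \<gamma> where "\<gamma> = (\<lambda>j. coeff (P j) j)"
  \<comment> \<open>The off-diagonal entries of the Jacobi matrix, that is, of multiplication by the
    variable in the basis \<open>P\<close>.\<close>
  define A where "A = (\<lambda>j. \<Lambda> (pCons 0 (P j) * P (Suc j)))"
  have P0: "P j \<noteq> 0" for j using orth[of j j] scale[of 0 0] by auto
  have deg_X: "degree (pCons 0 (P j)) = Suc j" for j
    using deg[of j] P0[of j] by simp
  have swap: "\<Lambda> (pCons 0 f * g) = \<Lambda> (pCons 0 g * f)" for f g
    by (simp add: mult.commute)
  \<comment> \<open>Multiplication by the variable is symmetric for \<Lambda>, so it may be applied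
    to the lower polynomial, whose product still has degree below j.\<close>
  have X_orth: "\<Lambda> (pCons 0 (P j) * P i) = 0" if "Suc i < j" for i j
  proof -
    have "\<Lambda> (pCons 0 (P i) * P j) = \<Lambda> ((\<Sum>l\<le>Suc i. Polynomial.smult (\<Lambda> (pCons 0 (P i) * P l)) (P l)) * P j)"
      using arg_cong[OF expansion[OF eq_refl[OF deg_X[of i]]], of "\<lambda>p. \<Lambda> (p * P j)"] .
    also have "\<dots> = (\<Sum>l\<le>Suc i. \<Lambda> (pCons 0 (P i) * P l) * \<Lambda> (P l * P j))"
    proof -
      have sum: "\<Lambda> (\<Sum>j\<in>B. h j) = (\<Sum>j\<in>B. \<Lambda> (h j))" if "finite B" for B :: "nat set" and h
        using that scale[of 0 0] by (induction B) (auto simp: add)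
      show ?thesis by (simp add: sum_distrib_right sum scale del: sum.atMost_Suc)
    qed
    also have "\<dots> = 0" using that by (intro sum.neutral) (auto simp: orth)
    finally show ?thesis by (subst swap)
  qed
  have recurrence: "x * poly (P j) x = A j * poly (P (Suc j)) x + \<Lambda> (pCons 0 (P j) * P j) * poly (P j) x +
      (if j = 0 then 0 else A (j - 1) * poly (P (j - 1)) x)" for j x
  proof -
    define c where "c = (\<lambda>l. \<Lambda> (pCons 0 (P j) * P l) * poly (P l) x)"
    have "pCons 0 (P j) = (\<Sum>l\<le>Suc j. Polynomial.smult (\<Lambda> (pCons 0 (P j) * P l)) (P l))" 
      by (rule expansion[OF eq_refl[OF deg_X]])
    from arg_cong[OF this, of "\<lambda>p. poly p x"]
    have "x * poly (P j) x = (\<Sum>l\<le>Suc j. c l)"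
      by (simp add: poly_sum c_def)
    also have "\<dots> = c (Suc j) + c j + (\<Sum>l<j. c l)"
      by (simp add: lessThan_Suc_atMost[symmetric])
    also have "(\<Sum>l<j. c l) = (if j = 0 then 0 else c (j - 1))"
    proof (cases j)
      case (Suc i)
      have "(\<Sum>l<i. c l) = 0" using X_orth Suc by (intro sum.neutral) (auto simp: c_def)
      thus ?thesis using Suc by simp
    qed simp
    finally have "x * poly (P j) x = c (Suc j) + c j + (if j = 0 then 0 else c (j - 1))" .
    moreover have "c (j - 1) = A (j - 1) * poly (P (j - 1)) x" if "j \<noteq> 0"
      using swap[of "P j" "P (j - 1)"] that by (simp add: c_def A_def)
    ultimately have "x * poly (P j) x = c (Suc j) + c j + (if j = 0 then 0 else A (j - 1) * poly (P (j - 1)) x)"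
      by (cases "j = 0") auto
    thus ?thesis by (simp only: c_def A_def)
  qed
  have CD: "(x - y) * (\<Sum>j\<le>k. poly (P j) x * poly (P j) y) =
     A k * (poly (P (Suc k)) x * poly (P k) y - poly (P k) x * poly (P (Suc k)) y)" for k
  proof (induction k)
    case 0
    have "(x - y) * (\<Sum>j\<le>0. poly (P j) x * poly (P j) y) =
       (x * poly (P 0) x) * poly (P 0) y - (y * poly (P 0) y) * poly (P 0) x"
      by (simp add: algebra_simps)
    also have "\<dots> = A 0 * (poly (P (Suc 0)) x * poly (P 0) y - poly (P 0) x * poly (P (Suc 0)) y)"
      unfolding recurrence[of x 0] recurrence[of y 0] by (simp add: algebra_simps)
    finally show ?case .
  next
    case (Suc k)
    have "(x - y) * (\<Sum>j\<le>Suc k. poly (P j) x * poly (P j) y) =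
       A k * (poly (P (Suc k)) x * poly (P k) y - poly (P k) x * poly (P (Suc k)) y) +
       (x * poly (P (Suc k)) x) * poly (P (Suc k)) y - (y * poly (P (Suc k)) y) * poly (P (Suc k)) x"
      using Suc by (simp add: algebra_simps)
    also have "\<dots> = A (Suc k) * (poly (P (Suc (Suc k))) x * poly (P (Suc k)) y - poly (P (Suc k)) x * poly (P (Suc (Suc k))) y)"
      unfolding recurrence[of x "Suc k"] recurrence[of y "Suc k"] by (simp add: algebra_simps)
    finally show ?case .
  qed
  have coeff_top: "coeff f k = \<Lambda> (f * P k) * \<gamma> k" if "degree f \<le> k" for f k
  proof -
    have "coeff f k = (\<Sum>j\<le>k. \<Lambda> (f * P j) * coeff (P j) k)"
      using arg_cong[OF expansion[OF that], of "\<lambda>p. coeff p k"] by (simp add: coeff_sum)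
    also have "\<dots> = (\<Sum>j\<in>{k}. \<Lambda> (f * P j) * coeff (P j) k)"
      by (rule sum.mono_neutral_right) (auto simp: coeff_eq_0 deg)
    finally show ?thesis by (simp add: \<gamma>_def)
  qed
  have A_eq: "\<gamma> k = A k * \<gamma> (Suc k)"
    using coeff_top[of "pCons 0 (P k)" "Suc k"] deg_X by (simp add: A_def \<gamma>_def)
  define \<beta> where "\<beta> = \<Lambda> (D0 * P k)"
  define a where "a = \<Lambda> (D1 * P (Suc k))"
  \<comment> \<open>The component of \<open>D1\<close> along \<open>P k\<close> is unrestricted; it
    cancels in the antisymmetric right-hand side because \<open>D0\<close> is a multiple of
    \<open>P k\<close>.\<close>
  define b where "b = \<Lambda> (D1 * P k)"
  have low: "(\<Sum>j<k. Polynomial.smult (\<Lambda> (D * P j)) (P j)) = 0"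
    if "\<And>f. degree f < k \<Longrightarrow> \<Lambda> (D * f) = 0" for D
    using that by (intro sum.neutral) (auto simp: deg)
  have D0_eq: "D0 = Polynomial.smult \<beta> (P k)"
    using expansion[OF D0(1)] low[OF D0(2)] by (simp add: lessThan_Suc_atMost[symmetric] \<beta>_def)
  have D1_eq: "D1 = Polynomial.smult b (P k) + Polynomial.smult a (P (Suc k))"
    using expansion[OF D1(1)] low[OF D1(2)] by (simp add: lessThan_Suc_atMost[symmetric] a_def b_def)
  have "coeff D1 (Suc k) = a * \<gamma> (Suc k)"
    using coeff_top[OF D1(1)] by (simp add: a_def)
  moreover have "\<beta> = \<Lambda> (D0 * M) * \<gamma> k"
  proof -
    \<comment> \<open>Since \<open>M\<close> is monic of degree at most k, its component along
      \<open>P k\<close> is 1 / \<gamma> k. Pairing with \<open>M\<close> thus determines \<beta>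
      without the norm of \<open>D0\<close>.\<close>
    have "\<Lambda> (D0 * M) = \<beta> * \<Lambda> (M * P k)"
      unfolding D0_eq by (simp add: scale mult.commute)
    thus ?thesis using coeff_top[OF M(1)] M(2) by simp
  qed
  ultimately have "a * \<beta> = coeff D1 (Suc k) * \<Lambda> (D0 * M) * A k"
    using A_eq by simp
  moreover have "poly D1 x * poly D0 y - poly D0 x * poly D1 y =
      a * \<beta> * (poly (P (Suc k)) x * poly (P k) y - poly (P k) x * poly (P (Suc k)) y)"
    unfolding D0_eq D1_eq by (simp add: algebra_simps)
  ultimately show ?thesis unfolding CD by simp
qed

section \<open>Linearity of the integral and partial fractions\<close>

lemma jacobi_integral_add:
  assumes "\<alpha> > - 1" "continuous_on {0..2} f" "continuous_on {0..2} g"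
    "f \<in> borel_measurable borel" "g \<in> borel_measurable borel"
  shows "jacobi_integral \<alpha> (\<lambda>u. f u + g u) = jacobi_integral \<alpha> f + jacobi_integral \<alpha> g"
  unfolding jacobi_integral_def distrib_left
  by (intro set_integral_add set_integrable_powr_mult assms)

lemma jacobi_integral_cmult: "jacobi_integral \<alpha> (\<lambda>u. c * f u) = c * jacobi_integral \<alpha> f"
proof -
  have "(\<lambda>u. u powr \<alpha> * (c * f u)) = (\<lambda>u. c * (u powr \<alpha> * f u))" by (simp add: mult_ac)
  thus ?thesis by (simp add: jacobi_integral_def)
qed

lemma jacobi_integral_sum:
  assumes "finite A" "\<alpha> > - 1" "\<And>j. j \<in> A \<Longrightarrow> continuous_on {0..2} (f j)"
    "\<And>j. j \<in> A \<Longrightarrow> f j \<in> borel_measurable borel"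
  shows "jacobi_integral \<alpha> (\<lambda>u. \<Sum>j\<in>A. f j u) = (\<Sum>j\<in>A. jacobi_integral \<alpha> (f j))"
  using assms(1,3,4)
proof (induction A)
  case empty
  thus ?case by (simp add: jacobi_integral_def)
next
  case (insert j A)
  thus ?case using assms(2) by (simp add: jacobi_integral_add continuous_on_sum)
qed

lemma jacobi_integral_cong:
  assumes "\<And>u. u > 0 \<Longrightarrow> u < 2 \<Longrightarrow> f u = g u"
  shows "jacobi_integral \<alpha> f = jacobi_integral \<alpha> g"
  unfolding jacobi_integral_def using assms by (intro set_lebesgue_integral_cong) auto

lemma jacobi_integral_shift:
  "jacobi_integral (\<alpha> + real j) f = jacobi_integral \<alpha> (\<lambda>u. u ^ j * f u)"
  unfolding jacobi_integral_def
  by (intro set_lebesgue_integral_cong) (auto simp: powr_add powr_realpow)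

lemma prod_linear_dvd:
  fixes p :: "real poly" and a :: "'a \<Rightarrow> real"
  assumes "finite A" "inj_on a A" "\<And>i. i \<in> A \<Longrightarrow> poly p (- a i) = 0"
  shows "(\<Prod>i\<in>A. [:a i, 1:]) dvd p"
  using assms
proof (induction A)
  case (insert i A)
  then obtain g where g: "p = (\<Prod>i\<in>A. [:a i, 1:]) * g" by (auto elim: dvdE)
  have "a j \<noteq> a i" if "j \<in> A" for j
    using that insert.hyps(2) insert.prems(1) by (auto simp: inj_on_def)
  hence "poly (\<Prod>j\<in>A. [:a j, 1:]) (- a i) \<noteq> 0"
    by (auto simp: poly_prod prod_zero_iff[OF insert.hyps(1)])
  hence "poly g (- a i) = 0" using insert.prems(2)[of i] g by simp
  hence "[:a i, 1:] dvd g" using poly_eq_0_iff_dvd[of g "- a i"] by simp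
  then obtain g' where "g = [:a i, 1:] * g'" by (elim dvdE)
  hence "p = (\<Prod>j\<in>insert i A. [:a j, 1:]) * g'"
    using g insert.hyps by (simp only: prod.insert[OF insert.hyps(1,2)] mult_ac)
  thus ?case by simp
qed simp

text \<open>Partial fractions of \<open>f / Q\<close>, with \<open>Q\<close> the product of the \<open>u + \<rho> i\<close>, cleared of denominators.\<close>

lemma partial_fractions:
  fixes f :: "real poly" and \<rho> :: "nat \<Rightarrow> real"
  assumes inj: "inj_on \<rho> {..<m}" and deg: "degree f < N + m"
  obtains g A where "g = 0 \<or> degree g < N"
    "f = (\<Prod>i<m. [:\<rho> i, 1:]) * g + (\<Sum>i<m. Polynomial.smult (A i) (\<Prod>k\<in>{..<m} - {i}. [:\<rho> k, 1:]))"
proof -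
  define Q where "Q = (\<Prod>i<m. [:\<rho> i, 1:])"
  define Qi where "Qi = (\<lambda>i. \<Prod>k\<in>{..<m} - {i}. [:\<rho> k, 1:])"
  \<comment> \<open>The residue of f / Q at - \<rho> i.\<close>
  define A where "A = (\<lambda>i. poly f (- \<rho> i) / poly (Qi i) (- \<rho> i))"
  define h where "h = f - (\<Sum>i<m. Polynomial.smult (A i) (Qi i))"
  have Qi0: "poly (Qi i) (- \<rho> i) \<noteq> 0" if "i < m" for i
    using inj that by (auto simp: Qi_def poly_prod prod_zero_iff inj_on_def)
  have Qi1: "poly (Qi i) (- \<rho> k) = 0" if "i < m" "k < m" "i \<noteq> k" for i k
    using that by (auto simp: Qi_def poly_prod prod_zero_iff)
  have "poly h (- \<rho> k) = 0" if "k < m" for k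
  proof -
    have "(\<Sum>i<m. A i * poly (Qi i) (- \<rho> k)) = (\<Sum>i\<in>{k}. A i * poly (Qi i) (- \<rho> k))"
      using that Qi1 by (intro sum.mono_neutral_right) auto
    thus ?thesis using Qi0[OF that] by (simp add: h_def poly_sum A_def)
  qed
  hence "Q dvd h" unfolding Q_def by (intro prod_linear_dvd inj) auto
  then obtain g where g: "h = Q * g" by (elim dvdE)
  have degQ: "degree Q = m" unfolding Q_def by (subst degree_prod_eq_sum_degree) auto
  have "degree (Qi i) < m" if "i < m" for i
    unfolding Qi_def using that by (subst degree_prod_eq_sum_degree) auto
  hence "degree (Polynomial.smult (A i) (Qi i)) < N + m" if "i < m" for i
    using that degree_smult_le[of "A i" "Qi i"] by (meson le_less_trans less_imp_le_nat trans_less_add2)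
  hence "degree h < N + m"
    unfolding h_def using deg
    by (intro degree_diff_less degree_sum_less) auto
  moreover have "degree h = m + degree g" if "g \<noteq> 0"
    unfolding g using that degQ by (subst degree_mult_eq) (auto simp: Q_def)
  ultimately have "g = 0 \<or> degree g < N" by (cases "g = 0") auto
  moreover have "f = Q * g + (\<Sum>i<m. Polynomial.smult (A i) (Qi i))" using g by (simp add: h_def)
  ultimately show ?thesis using that unfolding Q_def Qi_def by blast
qed

section \<open>The Christoffel--Uvarov formula for the weight\<close>

definition bordered :: "nat \<Rightarrow> (nat \<Rightarrow> nat \<Rightarrow> real) \<Rightarrow> (nat \<Rightarrow> nat) \<Rightarrow> (nat \<Rightarrow> real) \<Rightarrow> real mat" where
  "bordered m q c x = Matrix.mat (Suc m) (Suc m) (\<lambda>(i, j). if i < m then q i (c j) else x (c j))"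

text \<open>The columns left when the last column of a derivative chain is differentiated. The same
  pattern therefore gives the second polynomial of the pair and, in the limit, the derivative of the
  Wronskian.\<close>

definition skip :: "nat \<Rightarrow> nat \<Rightarrow> nat" where
  "skip m j = (if j = m then Suc m else j)"

text \<open>The poles in u are at - \<rho> i. The scalings \<open>e\<close> and \<open>K\<close> are
  kept free so that they can later be powers of n that give every determinant entry a finite
  limit.\<close>

locale christoffel_uvarov =
  fixes s :: real and m N :: nat and \<rho> :: "nat \<Rightarrow> real" and e :: "nat \<Rightarrow> real" and K :: real
  assumes s: "s > - 1" and \<rho>_pos: "\<And>i. i < m \<Longrightarrow> \<rho> i > 0" and \<rho>_inj: "inj_on \<rho> {..<m}" and K: "K \<noteq> 0"
begin

definition E :: "nat \<Rightarrow> real poly" where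
  "E j = Polynomial.smult (e j) (monom 1 j * jacobi_poly N (s + real j))"

definition Q :: "real poly" where
  "Q = (\<Prod>i<m. [:\<rho> i, 1:])"

definition \<Lambda> :: "real poly \<Rightarrow> real" where
  "\<Lambda> f = jacobi_integral s (\<lambda>u. poly f u / poly Q u)"

definition q :: "nat \<Rightarrow> nat \<Rightarrow> real" where
  "q i j = K * jacobi_integral s (\<lambda>u. poly (E j) u * (1 / (u + \<rho> i)))"

text \<open>Cofactors along the last row do not depend on that row; the zero function fills
  it.\<close>

definition minor :: "(nat \<Rightarrow> nat) \<Rightarrow> nat \<Rightarrow> real" where
  "minor c j = cofactor (bordered m q c (\<lambda>_. 0)) m j"

definition D :: "(nat \<Rightarrow> nat) \<Rightarrow> real poly" where
  "D c = (\<Sum>j\<le>m. Polynomial.smult (minor c j) (E (c j)))"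

lemma det_bordered: "Determinant.det (bordered m q c x) = (\<Sum>j\<le>m. minor c j * x (c j))"
proof -
  have carrier: "bordered m q c x \<in> carrier_mat (Suc m) (Suc m)" by (simp add: bordered_def)
  have "cofactor (bordered m q c x) m j = minor c j" if "j < Suc m" for j
  proof -
    have "mat_delete (bordered m q c x) m j = mat_delete (bordered m q c (\<lambda>_. 0)) m j"
      using that by (intro eq_matI) (auto simp: mat_delete_def bordered_def)
    thus ?thesis by (simp add: minor_def cofactor_def)
  qed
  thus ?thesis
    unfolding laplace_expansion_row[OF carrier, of m, simplified]
    by (simp add: bordered_def mult_ac flip: lessThan_Suc_atMost)
qed

lemma minor_last: "minor c m = Determinant.det (Matrix.mat m m (\<lambda>(i, j). q i (c j)))"
proof -
  have "mat_delete (bordered m q c (\<lambda>_. 0)) m m = Matrix.mat m m (\<lambda>(i, j). q i (c j))"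
    by (intro eq_matI) (auto simp: mat_delete_def bordered_def)
  thus ?thesis by (simp add: minor_def cofactor_def)
qed

lemma poly_D: "poly (D c) u = Determinant.det (bordered m q c (\<lambda>j. poly (E j) u))"
  by (simp add: det_bordered D_def poly_sum)

text \<open>Expansion of a determinant whose last row repeats row i.\<close>

lemma minor_row_orthogonal:
  assumes "i < m"
  shows "(\<Sum>j\<le>m. minor c j * q i (c j)) = 0"
proof -
  have "Determinant.det (bordered m q c (q i)) = 0"
    by (rule det_identical_rows[of _ "Suc m" i m])
       (use assms in \<open>auto simp: bordered_def intro!: eq_vecI\<close>)
  thus ?thesis by (simp add: det_bordered)
qed

lemma poly_Q_pos: "u \<ge> 0 \<Longrightarrow> poly Q u > 0"
  using \<rho>_pos by (auto simp: Q_def poly_prod intro!: prod_pos add_pos_nonneg)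

lemma continuous_on_div_Q: "continuous_on {0..2} (\<lambda>u. poly f u / poly Q u)"
  by (intro continuous_intros) (use poly_Q_pos in force)

lemma continuous_on_cauchy: "i < m \<Longrightarrow> continuous_on {0..2} (\<lambda>u. c * (poly f u * (1 / (u + \<rho> i))))"
  by (intro continuous_intros) (use \<rho>_pos in force)

lemma \<Lambda>_add: "\<Lambda> (f + g) = \<Lambda> f + \<Lambda> g"
  unfolding \<Lambda>_def poly_add add_divide_distrib
  by (intro jacobi_integral_add s continuous_on_div_Q) measurable

lemma \<Lambda>_smult: "\<Lambda> (Polynomial.smult c f) = c * \<Lambda> f"
  using jacobi_integral_cmult[of s c "\<lambda>u. poly f u / poly Q u"] by (simp add: \<Lambda>_def)

lemma jacobi_integral_E:
  "jacobi_integral s (\<lambda>u. poly (E j) u * f u) =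
     e j * jacobi_integral (s + real j) (\<lambda>u. poly (jacobi_poly N (s + real j)) u * f u)"
  unfolding jacobi_integral_shift jacobi_integral_cmult[symmetric]
  by (rule jacobi_integral_cong) (simp add: E_def poly_monom mult_ac)

lemma q_eq: "q i j = K * e j * jacobi_integral (s + real j)
    (\<lambda>u. poly (jacobi_poly N (s + real j)) u * (1 / (u + \<rho> i)))"
  by (simp only: q_def jacobi_integral_E mult.assoc)

lemma jacobi_integral_D:
  assumes "continuous_on {0..2} f" "f \<in> borel_measurable borel"
  shows "jacobi_integral s (\<lambda>u. poly (D c) u * f u) =
    (\<Sum>j\<le>m. minor c j * jacobi_integral s (\<lambda>u. poly (E (c j)) u * f u))"
proof -
  note [measurable] = assms(2)
  have "jacobi_integral s (\<lambda>u. poly (D c) u * f u) =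
    jacobi_integral s (\<lambda>u. \<Sum>j\<le>m. minor c j * (poly (E (c j)) u * f u))"
    by (simp add: D_def poly_sum sum_distrib_right sum_distrib_left mult_ac)
  also have "\<dots> = (\<Sum>j\<le>m. jacobi_integral s (\<lambda>u. minor c j * (poly (E (c j)) u * f u)))"
    by (intro jacobi_integral_sum s continuous_intros assms) (auto intro: assms)
  finally show ?thesis by (simp only: jacobi_integral_cmult)
qed

text \<open>Division by \<open>Q\<close> splits the test polynomial into a polynomial of degree less
  than N, to which every \<open>E j\<close> is orthogonal, and simple poles, whose contributions
  vanish by the determinant rows.\<close>

lemma D_orthogonal:
  assumes "degree f < N + m"
  shows "\<Lambda> (D c * f) = 0"
proof -
  obtain g A where g: "g = 0 \<or> degree g < N" and
    f: "f = (\<Prod>i<m. [:\<rho> i, 1:]) * g + (\<Sum>i<m. Polynomial.smult (A i) (\<Prod>k\<in>{..<m} - {i}. [:\<rho> k, 1:]))"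
    using partial_fractions[OF \<rho>_inj assms] by blast
  have ratio: "poly f u / poly Q u = poly g u + (\<Sum>i<m. A i * (1 / (u + \<rho> i)))" if u: "u > 0" for u
  proof -
    have "poly (\<Prod>k\<in>{..<m} - {i}. [:\<rho> k, 1:]) u / poly Q u = 1 / (u + \<rho> i)" if i: "i < m" for i
    proof -
      have "Q = [:\<rho> i, 1:] * (\<Prod>k\<in>{..<m} - {i}. [:\<rho> k, 1:])"
        unfolding Q_def using i by (subst prod.remove[of _ i]) auto
      hence "poly Q u = (u + \<rho> i) * poly (\<Prod>k\<in>{..<m} - {i}. [:\<rho> k, 1:]) u" 
        by (simp only: poly_mult) (simp add: add.commute)
      thus ?thesis using poly_Q_pos[of u] u by (auto simp: divide_simps)
    qed
    note inv = this
    have "poly f u = poly Q u * poly g u + (\<Sum>i<m. A i * poly (\<Prod>k\<in>{..<m} - {i}. [:\<rho> k, 1:]) u)"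
      unfolding f Q_def by (simp add: poly_sum)
    hence "poly f u / poly Q u = poly Q u * poly g u / poly Q u +
        (\<Sum>i<m. A i * (poly (\<Prod>k\<in>{..<m} - {i}. [:\<rho> k, 1:]) u / poly Q u))"
      by (simp add: add_divide_distrib sum_divide_distrib)
    thus ?thesis using poly_Q_pos[of u] u inv by simp
  qed
  have "\<Lambda> (D c * f) = jacobi_integral s (\<lambda>u. poly (D c) u * poly g u + (\<Sum>i<m. A i * (poly (D c) u * (1 / (u + \<rho> i)))))"
    unfolding \<Lambda>_def
  proof (rule jacobi_integral_cong)
    fix u :: real assume "u > 0"
    from arg_cong[OF ratio[OF this], of "\<lambda>x. poly (D c) u * x"]
    show "poly (D c * f) u / poly Q u = poly (D c) u * poly g u + (\<Sum>i<m. A i * (poly (D c) u * (1 / (u + \<rho> i))))"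
      by (simp add: distrib_left sum_distrib_left mult_ac)
  qed
  also have "\<dots> = jacobi_integral s (\<lambda>u. poly (D c) u * poly g u) +
      jacobi_integral s (\<lambda>u. \<Sum>i<m. A i * (poly (D c) u * (1 / (u + \<rho> i))))"
    by (intro jacobi_integral_add s continuous_on_sum continuous_on_cauchy continuous_intros) auto
  also have "jacobi_integral s (\<lambda>u. \<Sum>i<m. A i * (poly (D c) u * (1 / (u + \<rho> i)))) =
      (\<Sum>i<m. jacobi_integral s (\<lambda>u. A i * (poly (D c) u * (1 / (u + \<rho> i)))))"
    by (intro jacobi_integral_sum s continuous_on_cauchy) auto
  also have "\<dots> = 0"
  proof (intro sum.neutral ballI)
    fix i assume i: "i \<in> {..<m}"
    have "jacobi_integral s (\<lambda>u. poly (D c) u * (1 / (u + \<rho> i))) =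
       (\<Sum>j\<le>m. minor c j * jacobi_integral s (\<lambda>u. poly (E (c j)) u * (1 / (u + \<rho> i))))"
    proof (rule jacobi_integral_D)
      show "continuous_on {0..2} (\<lambda>u. 1 / (u + \<rho> i))"
        using i \<rho>_pos[of i] by (intro continuous_intros) auto
    qed measurable
    also have "\<dots> = (\<Sum>j\<le>m. minor c j * q i (c j)) / K"
      using K by (simp add: q_def sum_divide_distrib)
    finally show "jacobi_integral s (\<lambda>u. A i * (poly (D c) u * (1 / (u + \<rho> i)))) = 0"
      using i minor_row_orthogonal[of i c] by (simp only: jacobi_integral_cmult) simp
  qed
  also have "jacobi_integral s (\<lambda>u. poly (D c) u * poly g u) = 0"
  proof -
    have "jacobi_integral (s + real j) (\<lambda>u. poly (jacobi_poly N (s + real j)) u * poly g u) = 0" for j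
    proof (cases "g = 0")
      case True
      thus ?thesis by (simp add: jacobi_integral_def)
    next
      case False
      thus ?thesis using g s by (intro jacobi_poly_orthogonal) auto
    qed
    thus ?thesis
      by (subst jacobi_integral_D) (auto simp: jacobi_integral_E intro!: continuous_intros)
  qed
  finally show ?thesis by simp
qed

lemma degree_jacobi_poly_le: "degree (jacobi_poly N \<alpha>) \<le> N"
  unfolding jacobi_poly_def by (intro degree_sum_le) (auto intro: degree_monom_le order.trans)

lemma degree_E_le: "degree (E j) \<le> N + j"
proof -
  have "degree (E j) \<le> degree (monom 1 j * jacobi_poly N (s + real j))"
    unfolding E_def by (rule degree_smult_le)
  also have "\<dots> \<le> degree (monom (1::real) j) + degree (jacobi_poly N (s + real j))"
    by (rule degree_mult_le)
  also have "\<dots> \<le> j + N" by (intro add_mono degree_monom_le degree_jacobi_poly_le)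
  finally show ?thesis by simp
qed

lemma coeff_E: "coeff (E j) (N + j) = e j * jacobi_coeff N (s + real j) N"
  by (simp add: E_def coeff_monom_mult jacobi_poly_def coeff_sum)

lemma degree_D_le:
  assumes "\<And>j. j \<le> m \<Longrightarrow> c j \<le> k"
  shows "degree (D c) \<le> N + k"
  unfolding D_def
proof (intro degree_sum_le)
  fix j assume "j \<in> {..m}"
  hence "N + c j \<le> N + k" using assms by simp
  thus "degree (Polynomial.smult (minor c j) (E (c j))) \<le> N + k"
    using degree_smult_le[of "minor c j" "E (c j)"] degree_E_le[of "c j"] by linarith
qed simp

lemma coeff_D:
  assumes "\<And>j. j < m \<Longrightarrow> c j < c m"
  shows "coeff (D c) (N + c m) = minor c m * (e (c m) * jacobi_coeff N (s + real (c m)) N)"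
proof -
  have "coeff (E (c j)) (N + c m) = 0" if "j < m" for j
    using assms[OF that] degree_E_le[of "c j"] by (intro coeff_eq_0) linarith
  thus ?thesis by (simp add: D_def coeff_sum coeff_E lessThan_Suc_atMost[symmetric])
qed

text \<open>This test polynomial is monic of degree N + m, and its factor \<open>Q\<close> cancels
  the denominator of the weight, so the pairing involves Jacobi polynomials only.\<close>

lemma \<Lambda>_D_Q_monom:
  "\<Lambda> (D c * (Q * monom 1 N)) = (\<Sum>j\<le>m. minor c j * (e (c j) *
     jacobi_integral (s + real (c j)) (\<lambda>u. poly (jacobi_poly N (s + real (c j))) u * u ^ N)))"
proof -
  have "\<Lambda> (D c * (Q * monom 1 N)) = jacobi_integral s (\<lambda>u. poly (D c) u * u ^ N)"
    unfolding \<Lambda>_def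
  proof (rule jacobi_integral_cong)
    fix u :: real assume "u > 0"
    thus "poly (D c * (Q * monom 1 N)) u / poly Q u = poly (D c) u * u ^ N"
      using poly_Q_pos[of u] by (simp add: poly_monom)
  qed
  also have "\<dots> = (\<Sum>j\<le>m. minor c j * jacobi_integral s (\<lambda>u. poly (E (c j)) u * u ^ N))"
    by (intro jacobi_integral_D continuous_intros) measurable
  finally show ?thesis by (simp only: jacobi_integral_E)
qed

lemma christoffel_darboux_D:
  fixes P :: "nat \<Rightarrow> real poly"
  assumes deg: "\<And>j. degree (P j) = j"
    and orth: "\<And>i j. \<Lambda> (P i * P j) = (if i = j then 1 else 0)"
  shows "(minor id m * (e (Suc m) * jacobi_coeff N (s + real (Suc m)) N)) *
     (\<Sum>j\<le>m. minor id j * (e j * jacobi_integral (s + real j) (\<lambda>u. poly (jacobi_poly N (s + real j)) u * u ^ N))) *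
     ((x - y) * (\<Sum>j\<le>N + m. poly (P j) x * poly (P j) y)) =
    poly (D (skip m)) x * poly (D id) y - poly (D id) x * poly (D (skip m)) y"
proof -
  have degQ: "degree Q = m" and monicQ: "coeff Q m = 1"
  proof -
    show d: "degree Q = m" unfolding Q_def by (subst degree_prod_eq_sum_degree) auto
    have "lead_coeff Q = 1"
      using lead_coeff_prod[of "\<lambda>i. [:\<rho> i, 1:]" "{..<m}"] by (simp add: Q_def)
    thus "coeff Q m = 1" by (simp add: d)
  qed
  have "coeff (D (skip m)) (Suc (N + m)) * \<Lambda> (D id * (Q * monom 1 N)) * ((x - y) * (\<Sum>j\<le>N + m. poly (P j) x * poly (P j) y)) =
    poly (D (skip m)) x * poly (D id) y - poly (D id) x * poly (D (skip m)) y"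
  proof (rule christoffel_darboux[of \<Lambda> P, OF \<Lambda>_add \<Lambda>_smult deg orth])
    show "degree (D id) \<le> N + m" by (rule degree_D_le) simp
    show "degree (D (skip m)) \<le> Suc (N + m)" using degree_D_le[of "skip m" "Suc m"] by (simp add: skip_def)
    show "degree (Q * monom 1 N) \<le> N + m"
      using degree_mult_le[of Q "monom 1 N"] degQ degree_monom_le[of "1::real" N] by linarith
    show "coeff (Q * monom 1 N) (N + m) = 1"
      using monicQ by (subst mult.commute) (simp add: coeff_monom_mult)
  qed (auto intro: D_orthogonal)
  moreover have "coeff (D (skip m)) (Suc (N + m)) = minor id m * (e (Suc m) * jacobi_coeff N (s + real (Suc m)) N)"
  proof -
    \<comment> \<open>This minor omits the last column, and the two column choices differ only
      there.\<close>
    have "minor (skip m) m = minor id m"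
      unfolding minor_last by (intro arg_cong[where f = Determinant.det] eq_matI) (auto simp: skip_def)
    thus ?thesis using coeff_D[of "skip m"] by (simp add: skip_def)
  qed
  ultimately show ?thesis by (simp add: \<Lambda>_D_Q_monom)
qed

end

section \<open>Wronskians\<close>

text \<open>
  Differentiating any column but the last duplicates its right neighbour, so only the
  term in which the last column is differentiated survives.
\<close>

lemma has_derivative_det_chain:
  fixes \<phi> :: "nat \<Rightarrow> nat \<Rightarrow> real \<Rightarrow> real"
  assumes "\<And>i j. i \<le> m \<Longrightarrow> j \<le> m \<Longrightarrow> (\<phi> i j has_real_derivative \<phi> i (Suc j) w) (at w)"
  shows "((\<lambda>w. Determinant.det (Matrix.mat (Suc m) (Suc m) (\<lambda>(i, j). \<phi> i j w))) has_real_derivative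
     Determinant.det (Matrix.mat (Suc m) (Suc m) (\<lambda>(i, j). \<phi> i (if j = m then Suc m else j) w))) (at w)"
proof -
  let ?n = "Suc m" and ?S = "{p. p permutes {0..<Suc m}}"
  let ?M = "\<lambda>k. Matrix.mat ?n ?n (\<lambda>(j, i). \<phi> i (if j = k then Suc j else j) w)"
  have less: "p j < ?n" if "p \<in> ?S" "j < ?n" for p j
    using that permutes_in_image[of p "{0..<?n}" j] by auto
  have det_eq: "Determinant.det (Matrix.mat ?n ?n (\<lambda>(i, j). f i j)) =
      (\<Sum>p\<in>?S. signof p * (\<Prod>j = 0..<?n. f (p j) j))" for f :: "nat \<Rightarrow> nat \<Rightarrow> real"
  proof -
    have "Determinant.det (Matrix.mat ?n ?n (\<lambda>(i, j). f i j)) = Determinant.det (Matrix.mat ?n ?n (\<lambda>(j, i). f i j))"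
      by (subst det_transpose[symmetric, of _ ?n]) (auto intro!: arg_cong[where f = Determinant.det])
    also have "\<dots> = (\<Sum>p\<in>?S. signof p * (\<Prod>j = 0..<?n. f (p j) j))"
      by (subst det_def'[of _ ?n]) (auto intro!: sum.cong prod.cong simp: less)
    finally show ?thesis .
  qed
  have "((\<lambda>w. \<Sum>p\<in>?S. signof p * (\<Prod>j = 0..<?n. \<phi> (p j) j w)) has_real_derivative
      (\<Sum>p\<in>?S. signof p * (\<Sum>k = 0..<?n. \<phi> (p k) (Suc k) w * (\<Prod>j\<in>{0..<?n} - {k}. \<phi> (p j) j w)))) (at w)"
  proof (intro DERIV_sum DERIV_cmult has_field_derivative_prod)
    fix p k assume "p \<in> ?S" "k \<in> {0..<?n}"
    hence "p k < Suc m" "k < Suc m" by (auto simp: less)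
    thus "(\<phi> (p k) k has_real_derivative \<phi> (p k) (Suc k) w) (at w)"
      by (intro assms) auto
  qed
  also have "(\<Sum>p\<in>?S. signof p * (\<Sum>k = 0..<?n. \<phi> (p k) (Suc k) w * (\<Prod>j\<in>{0..<?n} - {k}. \<phi> (p j) j w)))
      = (\<Sum>p\<in>?S. signof p * (\<Sum>k = 0..<?n. \<Prod>j = 0..<?n. \<phi> (p j) (if j = k then Suc j else j) w))"
    by (intro sum.cong refl arg_cong2[where f = "(*)"])
       (subst prod.remove[of "{0..<?n}"], auto intro!: prod.cong)
  also have "\<dots> = (\<Sum>k = 0..<?n. \<Sum>p\<in>?S. signof p * (\<Prod>j = 0..<?n. \<phi> (p j) (if j = k then Suc j else j) w))"
    by (simp only: sum_distrib_left) (rule sum.swap)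
  also have "\<dots> = (\<Sum>k = 0..<?n. Determinant.det (Matrix.mat ?n ?n (\<lambda>(i, j). \<phi> i (if j = k then Suc j else j) w)))"
    by (simp only: det_eq)
  also have "\<dots> = (\<Sum>k\<in>{m}. Determinant.det (Matrix.mat ?n ?n (\<lambda>(i, j). \<phi> i (if j = k then Suc j else j) w)))"
  proof (rule sum.mono_neutral_right)
    show "\<forall>k\<in>{0..<?n} - {m}. Determinant.det (Matrix.mat ?n ?n (\<lambda>(i, j). \<phi> i (if j = k then Suc j else j) w)) = 0"
    proof
      fix k assume k: "k \<in> {0..<?n} - {m}"
      show "Determinant.det (Matrix.mat ?n ?n (\<lambda>(i, j). \<phi> i (if j = k then Suc j else j) w)) = 0"
        by (rule det_identical_columns[of _ ?n k "Suc k"])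
           (use k in \<open>auto intro!: eq_vecI\<close>)
    qed
  qed auto
  finally have "((\<lambda>w. \<Sum>p\<in>?S. signof p * (\<Prod>j = 0..<?n. \<phi> (p j) j w)) has_real_derivative
     Determinant.det (Matrix.mat ?n ?n (\<lambda>(i, j). \<phi> i (if j = m then Suc j else j) w))) (at w)"
    by simp
  also have "Matrix.mat ?n ?n (\<lambda>(i, j). \<phi> i (if j = m then Suc j else j) w) =
      Matrix.mat ?n ?n (\<lambda>(i, j). \<phi> i (if j = m then Suc m else j) w)"
    by (intro eq_matI) auto
  finally show ?thesis unfolding det_eq .
qed

text \<open>
  The coefficients of $f^{(j)}(\kappa) = \sum_{i \le j} c_{j,i}\, \kappa^{s-j+2i}\, \varphi^{(i)}(\kappa^2)$
  for $f(\kappa) = \kappa^s \varphi(\kappa^2)$.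
\<close>

fun chain_coeff :: "real \<Rightarrow> nat \<Rightarrow> nat \<Rightarrow> real" where
  "chain_coeff s 0 i = (if i = 0 then 1 else 0)"
| "chain_coeff s (Suc j) 0 = (s - real j) * chain_coeff s j 0"
| "chain_coeff s (Suc j) (Suc i) =
     (s - real j + 2 * real (Suc i)) * chain_coeff s j (Suc i) + 2 * chain_coeff s j i"

lemma chain_coeff_eq_0: "j < i \<Longrightarrow> chain_coeff s j i = 0"
  by (induction s j i rule: chain_coeff.induct) auto

lemma chain_coeff_diag: "chain_coeff s j j = 2 ^ j"
  by (induction j) (auto simp: chain_coeff_eq_0)

text \<open>The derivative of \<kappa>^a * \<phi> i (\<kappa>^2) is a * \<kappa>^(a - 1) * \<phi> i
  (\<kappa>^2) + 2 * \<kappa>^(a + 1) * \<phi> (i + 1) (\<kappa>^2); collecting terms gives the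
  recursion of \<open>chain_coeff\<close>.\<close>

lemma funpow_deriv_powr_square:
  fixes \<phi> :: "nat \<Rightarrow> real \<Rightarrow> real"
  assumes \<phi>: "\<And>i w. w > 0 \<Longrightarrow> (\<phi> i has_real_derivative \<phi> (Suc i) w) (at w)"
    and f: "\<And>\<kappa>. \<kappa> > 0 \<Longrightarrow> f \<kappa> = \<kappa> powr s * \<phi> 0 (\<kappa>\<^sup>2)"
    and "\<kappa> > 0"
  shows "(deriv ^^ j) f \<kappa> = (\<Sum>i\<le>j. chain_coeff s j i * \<kappa> powr (s - real j + 2 * real i) * \<phi> i (\<kappa>\<^sup>2))"
  using assms(3)
proof (induction j arbitrary: \<kappa>)
  case 0
  thus ?case by (simp add: f)
next
  case (Suc j)
  let ?F = "\<lambda>\<kappa>. \<Sum>i\<le>j. chain_coeff s j i * \<kappa> powr (s - real j + 2 * real i) * \<phi> i (\<kappa>\<^sup>2)"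
  let ?t = "\<lambda>i. \<kappa> powr (s - real (Suc j) + 2 * real i) * \<phi> i (\<kappa>\<^sup>2)"
  have "(?F has_real_derivative (\<Sum>i\<le>j. chain_coeff s j i *
      ((s - real j + 2 * real i) * ?t i + 2 * ?t (Suc i)))) (at \<kappa>)"
  proof (intro DERIV_sum)
    fix i
    have d1: "((\<lambda>\<kappa>. \<phi> i (\<kappa>\<^sup>2)) has_real_derivative \<phi> (Suc i) (\<kappa>\<^sup>2) * (2 * \<kappa>)) (at \<kappa>)"
      by (rule DERIV_chain2[OF \<phi>]) (use Suc.prems in \<open>auto intro!: derivative_eq_intros\<close>)
    have d2: "((\<lambda>\<kappa>. \<kappa> powr (s - real j + 2 * real i)) has_real_derivative
        (s - real j + 2 * real i) * \<kappa> powr (s - real j + 2 * real i - 1)) (at \<kappa>)"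
      using Suc.prems by (rule has_real_derivative_powr)
    have "\<kappa> powr (s - real j + 2 * real i) * \<kappa> = \<kappa> powr (s - real (Suc j) + 2 * real (Suc i))"
      using Suc.prems powr_add[of \<kappa> "s - real j + 2 * real i" 1] by (simp add: algebra_simps)
    hence B: "2 * ?t (Suc i) = \<kappa> powr (s - real j + 2 * real i) * (\<phi> (Suc i) (\<kappa>\<^sup>2) * (2 * \<kappa>))"
      by simp
    have A: "s - real j + 2 * real i - 1 = s - real (Suc j) + 2 * real i" by simp
    have "(s - real j + 2 * real i) * \<kappa> powr (s - real j + 2 * real i - 1) * \<phi> i (\<kappa>\<^sup>2) +
        \<phi> (Suc i) (\<kappa>\<^sup>2) * (2 * \<kappa>) * \<kappa> powr (s - real j + 2 * real i) =
        (s - real j + 2 * real i) * ?t i + 2 * ?t (Suc i)"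
      unfolding A B by (simp only: mult_ac)
    from DERIV_cmult[OF DERIV_mult[OF d2 d1], of "chain_coeff s j i", unfolded this]
    show "((\<lambda>\<kappa>. chain_coeff s j i * \<kappa> powr (s - real j + 2 * real i) * \<phi> i (\<kappa>\<^sup>2)) has_real_derivative
        chain_coeff s j i * ((s - real j + 2 * real i) * ?t i + 2 * ?t (Suc i))) (at \<kappa>)"
      by (simp only: mult.assoc)
  qed
  moreover have "eventually (\<lambda>x. (deriv ^^ j) f x = ?F x) (nhds \<kappa>)"
    using eventually_nhds_in_open[of "{0<..}" \<kappa>] Suc.prems
    by (auto elim!: eventually_mono intro: Suc.IH)
  ultimately have step: "deriv ((deriv ^^ j) f) \<kappa> = (\<Sum>i\<le>j. chain_coeff s j i *
      ((s - real j + 2 * real i) * ?t i + 2 * ?t (Suc i)))"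
    by (subst deriv_cong_ev) (auto intro: DERIV_imp_deriv)
  have regroup: "c * (a * X + 2 * Y) = a * c * X + 2 * c * Y" for a c X Y :: real
    by (simp add: algebra_simps)
  have "(\<Sum>i\<le>j. chain_coeff s j i * ((s - real j + 2 * real i) * ?t i + 2 * ?t (Suc i)))
    = (\<Sum>i\<le>j. (s - real j + 2 * real i) * chain_coeff s j i * ?t i) + (\<Sum>i\<le>j. 2 * chain_coeff s j i * ?t (Suc i))"
    unfolding sum.distrib[symmetric] by (intro sum.cong refl regroup)
  also have "(\<Sum>i\<le>j. (s - real j + 2 * real i) * chain_coeff s j i * ?t i) =
     (\<Sum>i\<le>Suc j. (s - real j + 2 * real i) * chain_coeff s j i * ?t i)"
    by (simp add: chain_coeff_eq_0)
  also have "\<dots> = (s - real j) * chain_coeff s j 0 * ?t 0 + (\<Sum>i\<le>j. (s - real j + 2 * real (Suc i)) * chain_coeff s j (Suc i) * ?t (Suc i))"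
    by (subst sum.atMost_Suc_shift) (simp del: of_nat_Suc)
  finally have "deriv ((deriv ^^ j) f) \<kappa> = chain_coeff s (Suc j) 0 * ?t 0 + (\<Sum>i\<le>j. chain_coeff s (Suc j) (Suc i) * ?t (Suc i))"
    unfolding step by (simp add: sum.distrib[symmetric] distrib_right del: of_nat_Suc)
  thus ?case
    by (subst sum.atMost_Suc_shift) (simp add: mult.assoc del: of_nat_Suc chain_coeff.simps)
qed

text \<open>The matrix of derivatives in \<kappa> is the matrix of derivatives in w = \<kappa>^2
  times an upper triangular matrix that is the same for all functions. The prefactor is the product
  of its diagonal.\<close>

lemma wronskian_powr_square:
  fixes \<phi> :: "nat \<Rightarrow> nat \<Rightarrow> real \<Rightarrow> real" and fs :: "(real \<Rightarrow> real) list"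
  assumes \<phi>: "\<And>k i w. k < length fs \<Longrightarrow> w > 0 \<Longrightarrow> (\<phi> k i has_real_derivative \<phi> k (Suc i) w) (at w)"
    and f: "\<And>k \<kappa>. k < length fs \<Longrightarrow> \<kappa> > 0 \<Longrightarrow> (fs ! k) \<kappa> = \<kappa> powr s * \<phi> k 0 (\<kappa>\<^sup>2)"
    and \<kappa>: "\<kappa> > 0"
  shows "wronskian fs \<kappa> = (\<Prod>j<length fs. 2 ^ j * \<kappa> powr (s + real j)) *
     Determinant.det (Matrix.mat (length fs) (length fs) (\<lambda>(k, i). \<phi> k i (\<kappa>\<^sup>2)))"
proof -
  let ?n = "length fs"
  define T where "T = Matrix.mat ?n ?n (\<lambda>(i, j). chain_coeff s j i * \<kappa> powr (s - real j + 2 * real i))"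
  define \<Phi> where "\<Phi> = Matrix.mat ?n ?n (\<lambda>(k, i). \<phi> k i (\<kappa>\<^sup>2))"
  have carrier: "T \<in> carrier_mat ?n ?n" "\<Phi> \<in> carrier_mat ?n ?n" by (auto simp: T_def \<Phi>_def)
  have "Matrix.mat ?n ?n (\<lambda>(i, j). (deriv ^^ j) (fs ! i) \<kappa>) = \<Phi> * T"
  proof (rule eq_matI)
    fix k j assume "k < dim_row (\<Phi> * T)" "j < dim_col (\<Phi> * T)"
    hence kj: "k < ?n" "j < ?n" by (auto simp: \<Phi>_def T_def)
    have "(deriv ^^ j) (fs ! k) \<kappa> = (\<Sum>i\<le>j. chain_coeff s j i * \<kappa> powr (s - real j + 2 * real i) * \<phi> k i (\<kappa>\<^sup>2))"
      by (rule funpow_deriv_powr_square) (use kj \<phi> f \<kappa> in auto)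
    also have "\<dots> = (\<Sum>i<?n. chain_coeff s j i * \<kappa> powr (s - real j + 2 * real i) * \<phi> k i (\<kappa>\<^sup>2))"
      using kj by (intro sum.mono_neutral_left) (auto simp: chain_coeff_eq_0)
    finally show "Matrix.mat ?n ?n (\<lambda>(i, j). (deriv ^^ j) (fs ! i) \<kappa>) $$ (k, j) = (\<Phi> * T) $$ (k, j)"
      using kj by (simp add: \<Phi>_def T_def scalar_prod_def atLeast0LessThan mult_ac)
  qed (auto simp: \<Phi>_def T_def)
  hence "wronskian fs \<kappa> = Determinant.det \<Phi> * Determinant.det T"
    unfolding wronskian_def by (simp add: det_mult[OF carrier(2,1)])
  also have "Determinant.det T = (\<Prod>j<?n. 2 ^ j * \<kappa> powr (s + real j))"
  proof -
    have "upper_triangular T" by (auto simp: upper_triangular_def T_def chain_coeff_eq_0)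
    hence "Determinant.det T = prod_list (diag_mat T)" by (rule det_upper_triangular[OF _ carrier(1)])
    thus ?thesis
      by (auto simp: prod_list_diag_prod T_def chain_coeff_diag atLeast0LessThan algebra_simps intro!: prod.cong)
  qed
  finally show ?thesis by (simp add: \<Phi>_def mult.commute)
qed

lemma det_scale_rows_columns:
  fixes f :: "nat \<Rightarrow> nat \<Rightarrow> real"
  shows "Determinant.det (Matrix.mat n n (\<lambda>(i, j). a i * b j * f i j)) =
    (\<Prod>i<n. a i) * (\<Prod>j<n. b j) * Determinant.det (Matrix.mat n n (\<lambda>(i, j). f i j))"
proof -
  have "(\<Prod>i = 0..<n. a i * b (p i) * f i (p i)) = (\<Prod>i<n. a i) * (\<Prod>j<n. b j) * (\<Prod>i = 0..<n. f i (p i))"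
    if "p permutes {0..<n}" for p
    using prod.permute[OF that, of b] by (simp add: prod.distrib o_def atLeast0LessThan)
  moreover have "p i < n" if "p permutes {0..<n}" "i < n" for p i
    using permutes_in_image[OF that(1), of i] that(2) by auto
  ultimately show ?thesis
    by (subst (1 2) det_def'[of _ n]) (auto simp: sum_distrib_left mult_ac intro!: sum.cong)
qed

section \<open>Derivative chains of the Bessel functions in the squared variable\<close>

lemma bessel_K_minus: "bessel_K (- \<beta>) x = bessel_K \<beta> x"
  by (simp add: bessel_K_def)

lemma bessel_transform_minus:
  assumes "w > 0"
  shows "bessel_transform (- \<beta>) w = w powr (- \<beta>) * bessel_transform \<beta> w"
  using assms by (simp add: bessel_transform_eq_bessel_K bessel_K_minus powr_add[symmetric] mult.assoc[symmetric])

text \<open>The i-th derivative in w of w^(- s / 2) * K_s (sqrt (w * v)). The index is negative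
  because differentiation lowers it; K is even in its order.\<close>

definition K_chain :: "real \<Rightarrow> real \<Rightarrow> nat \<Rightarrow> real \<Rightarrow> real" where
  "K_chain s v i w = v powr (s / 2) / 2 * (- v / 2) ^ i * bessel_transform (- (s + real i)) (w * v)"

text \<open>The i-th derivative in w of w^(- s / 2) * J_s (sqrt (w * z)).\<close>

definition J_chain :: "real \<Rightarrow> real \<Rightarrow> nat \<Rightarrow> real \<Rightarrow> real" where
  "J_chain s z i w = (sqrt z / 2) powr s * (- z / 4) ^ i * bessel_series (s + real i) (w * z)"

lemma has_derivative_K_chain:
  assumes "v > 0" "w > 0"
  shows "(K_chain s v i has_real_derivative K_chain s v (Suc i) w) (at w)"
proof -
  have "((\<lambda>w. bessel_transform (- (s + real i)) (w * v)) has_real_derivative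
      - bessel_transform (- (s + real i) - 1) (w * v) / 2 * v) (at w)"
    by (rule DERIV_chain2[OF has_derivative_bessel_transform])
       (use assms in \<open>auto intro!: derivative_eq_intros\<close>)
  from DERIV_cmult[OF this, of "v powr (s / 2) / 2 * (- v / 2) ^ i"]
  moreover have "- (s + real i) - 1 = - (s + real (Suc i))" by simp
  ultimately show ?thesis unfolding K_chain_def[abs_def] by (simp only:) (simp add: algebra_simps)
qed

lemma has_derivative_J_chain:
  assumes "s > - 1"
  shows "(J_chain s z i has_real_derivative J_chain s z (Suc i) w) (at w)"
proof -
  have "((\<lambda>w. bessel_series (s + real i) (w * z)) has_real_derivative
      - bessel_series (s + real i + 1) (w * z) / 4 * z) (at w)"
    by (rule DERIV_chain2[OF has_derivative_bessel_series])
       (use assms in \<open>auto intro!: derivative_eq_intros\<close>)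
  from DERIV_cmult[OF this, of "(sqrt z / 2) powr s * (- z / 4) ^ i"]
  show ?thesis unfolding J_chain_def[abs_def] by (simp add: algebra_simps)
qed

lemma bessel_K_eq_K_chain:
  assumes "v > 0" "\<kappa> > 0"
  shows "bessel_K s (\<kappa> * sqrt v) = \<kappa> powr s * K_chain s v 0 (\<kappa>\<^sup>2)"
proof -
  have "sqrt (\<kappa>\<^sup>2 * v) = \<kappa> * sqrt v" using assms by (simp add: real_sqrt_mult)
  moreover have "(\<kappa>\<^sup>2) powr (- s / 2) = \<kappa> powr (- s)"
    using assms powr_realpow[of \<kappa> 2] by (simp add: powr_powr flip: powr_numeral)
  ultimately have "bessel_transform (- s) (\<kappa>\<^sup>2 * v) = 2 * (\<kappa> powr (- s) * v powr (- s / 2)) * bessel_K s (\<kappa> * sqrt v)"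
    using assms by (simp add: bessel_transform_eq_bessel_K bessel_K_minus powr_mult)
  thus ?thesis using assms by (simp add: K_chain_def powr_minus field_simps)
qed

lemma bessel_J_eq_J_chain:
  assumes "s > - 1" "z > 0" "\<kappa> > 0"
  shows "bessel_J s (\<kappa> * sqrt z) = \<kappa> powr s * J_chain s z 0 (\<kappa>\<^sup>2)"
proof -
  have "(\<kappa> * sqrt z)\<^sup>2 = \<kappa>\<^sup>2 * z" using assms by (simp add: power_mult_distrib)
  moreover have "(\<kappa> * sqrt z / 2) powr s = \<kappa> powr s * (sqrt z / 2) powr s"
    using assms powr_mult[of \<kappa> "sqrt z / 2" s] by simp
  ultimately show ?thesis
    using assms by (simp add: bessel_J_eq_bessel_series J_chain_def)
qed

text \<open>Reflecting the index produces powers of v that cancel those of the chain. What remains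
  besides the limit entry is a row factor and the column factor (- 1 / 2)^i, the same as for J, so
  both can be pulled out of the determinant.\<close>

lemma K_chain_1:
  assumes "v > 0"
  shows "K_chain s v i 1 = (v powr (- s / 2) / 2) * (- 1 / 2) ^ i * bessel_transform (s + real i) v"
proof -
  have "(- v / 2) ^ i = (- 1 / 2) ^ i * v ^ i"
    by (simp flip: power_mult_distrib)
  moreover have "v powr (s / 2) * (v ^ i * v powr (- (s + real i))) = v powr (- s / 2)"
    using assms by (simp add: powr_realpow[symmetric] powr_add[symmetric])
  ultimately show ?thesis
    unfolding K_chain_def mult_1 bessel_transform_minus[OF assms]
    by (simp add: mult_ac)
qed

lemma J_chain_1:
  "J_chain s z i 1 = (sqrt z / 2) powr s * (- 1 / 2) ^ i * ((z / 2) ^ i * bessel_series (s + real i) z)"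
proof -
  have "(- z / 4) ^ i = (- 1 / 2) ^ i * (z / 2) ^ i"
    by (simp flip: power_mult_distrib)
  thus ?thesis by (simp add: J_chain_def)
qed

text \<open>The limit of the scaled Cauchy transforms; \<open>J_entry\<close> is that of the scaled
  polynomial values. Rows count from 0, the points v from 1.\<close>

definition K_entry :: "real \<Rightarrow> (nat \<Rightarrow> real) \<Rightarrow> nat \<Rightarrow> nat \<Rightarrow> real" where
  "K_entry s v i j = bessel_transform (s + real j) (v (Suc i))"

definition J_entry :: "real \<Rightarrow> real \<Rightarrow> nat \<Rightarrow> real" where
  "J_entry s z j = (z / 2) ^ j * bessel_series (s + real j) z"

text \<open>Row factors of K and signs cancel in the quotient. The derivative of the Wronskian
  prefactor adds to B a multiple of A, which drops out of the antisymmetric numerator; the rest of B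
  is the determinant with columns \<open>skip m\<close>.\<close>

lemma wronskian_ratio:
  fixes s :: real and v :: "nat \<Rightarrow> real"
  assumes s: "s > - 1" and v: "\<And>i. i \<in> {1..m} \<Longrightarrow> v i > 0" and z: "z1 > 0" "z2 > 0"
  shows "(A_II s m v 1 z1 * B_II s m v 1 z2 - A_II s m v 1 z2 * B_II s m v 1 z1) / (C_II s m v 1)\<^sup>2 =
    (sqrt z1 / 2) powr s * (sqrt z2 / 2) powr s *
    (Determinant.det (bordered m (K_entry s v) (skip m) (J_entry s z1)) *
       Determinant.det (bordered m (K_entry s v) id (J_entry s z2)) -
     Determinant.det (bordered m (K_entry s v) id (J_entry s z1)) *
       Determinant.det (bordered m (K_entry s v) (skip m) (J_entry s z2))) /
    (Determinant.det (Matrix.mat m m (\<lambda>(i, j). K_entry s v i j)))\<^sup>2"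
proof -
  define \<phi> where "\<phi> = (\<lambda>z k i w. if k < m then K_chain s (v (Suc k)) i w else J_chain s z i w)"
  define R where "R = (\<Prod>k<m. v (Suc k) powr (- s / 2) / 2)"
  define Rz where "Rz = (\<lambda>z. (sqrt z / 2) powr s)"
  define pref where "pref = (\<lambda>\<kappa>. \<Prod>j<Suc m. (2::real) ^ j * \<kappa> powr (s + real j))"
  define \<Delta> where "\<Delta> = (\<lambda>z w. Determinant.det (Matrix.mat (Suc m) (Suc m) (\<lambda>(k, i). \<phi> z k i w)))"
  define G where "G = (\<lambda>c z. Determinant.det (bordered m (K_entry s v) c (J_entry s z)))"
  define h where "h = (\<Prod>j<m. (- 1 / 2 :: real) ^ j)"
  define t where "t = (\<Prod>j<m. (2 :: real) ^ j)"
  have v': "v (Suc k) > 0" if "k < m" for k using v[of "Suc k"] that by simp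
  have R0: "R \<noteq> 0" by (auto simp: R_def prod_zero_iff dest: v')
  \<comment> \<open>The product t * h is a product of signs (- 1)^j, and only its square
    enters.\<close>
  have th: "(t * h)\<^sup>2 = 1"
  proof -
    have "(t * h)\<^sup>2 = (\<Prod>j<m. ((2 ^ j * (- 1 / 2) ^ j)\<^sup>2))"
      unfolding t_def h_def prod.distrib[symmetric] prod_power_distrib ..
    also have "\<dots> = (\<Prod>j<m. 1)"
      by (intro prod.cong refl) (simp add: power_mult_distrib[symmetric] power_mult[symmetric] mult.commute[of _ 2])
    finally show ?thesis by simp
  qed
  have length_K: "length (K_family s m v) = m" by (simp add: K_family_def)
  have nth_K: "(K_family s m v ! k) \<kappa> = bessel_K s (\<kappa> * sqrt (v (Suc k)))" if "k < m" for k \<kappa>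
    using that by (simp add: K_family_def del: upt_Suc)
  have \<phi>_deriv: "(\<phi> z k i has_real_derivative \<phi> z k (Suc i) w) (at w)" if "w > 0" for z k i w
    using that v by (auto simp: \<phi>_def s intro!: has_derivative_K_chain has_derivative_J_chain)
  have A: "A_II s m v \<kappa> z = pref \<kappa> * \<Delta> z (\<kappa>\<^sup>2)" if "\<kappa> > 0" "z > 0" for \<kappa> z
  proof -
    let ?fs = "K_family s m v @ [\<lambda>\<kappa>. bessel_J s (\<kappa> * sqrt z)]"
    have "wronskian ?fs \<kappa> = (\<Prod>j<length ?fs. 2 ^ j * \<kappa> powr (s + real j)) *
      Determinant.det (Matrix.mat (length ?fs) (length ?fs) (\<lambda>(k, i). \<phi> z k i (\<kappa>\<^sup>2)))"
    proof (rule wronskian_powr_square)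
      show "(?fs ! k) \<kappa> = \<kappa> powr s * \<phi> z k 0 (\<kappa>\<^sup>2)" if "k < length ?fs" "\<kappa> > 0" for k \<kappa>
        using that v \<open>z > 0\<close> s
        by (auto simp: \<phi>_def nth_append length_K nth_K bessel_K_eq_K_chain bessel_J_eq_J_chain)
    qed (use that \<phi>_deriv in auto)
    thus ?thesis by (simp add: A_II_def length_K pref_def \<Delta>_def)
  qed
  have C: "C_II s m v 1 = t * (R * h * Determinant.det (Matrix.mat m m (\<lambda>(i, j). K_entry s v i j)))"
  proof -
    let ?fs = "K_family s m v"
    have "wronskian ?fs 1 = (\<Prod>j<length ?fs. 2 ^ j * 1 powr (s + real j)) *
      Determinant.det (Matrix.mat (length ?fs) (length ?fs) (\<lambda>(k, i). K_chain s (v (Suc k)) i (1\<^sup>2)))"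
      by (rule wronskian_powr_square)
         (use v in \<open>auto simp: length_K nth_K bessel_K_eq_K_chain has_derivative_K_chain\<close>)
    also have "Matrix.mat (length ?fs) (length ?fs) (\<lambda>(k, i). K_chain s (v (Suc k)) i (1\<^sup>2)) =
      Matrix.mat m m (\<lambda>(k, i). (v (Suc k) powr (- s / 2) / 2) * (- 1 / 2) ^ i * K_entry s v k i)"
      using v by (intro eq_matI) (auto simp: length_K K_chain_1 K_entry_def)
    finally show ?thesis
      unfolding det_scale_rows_columns by (simp add: C_II_def t_def R_def h_def length_K)
  qed
  have \<Delta>_1: "Determinant.det (Matrix.mat (Suc m) (Suc m) (\<lambda>(k, i). \<phi> z k (c i) 1)) =
      R * Rz z * (\<Prod>j<Suc m. (- 1 / 2) ^ c j) * G c z" for c z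
  proof -
    have eq: "Matrix.mat (Suc m) (Suc m) (\<lambda>(k, i). \<phi> z k (c i) 1) = Matrix.mat (Suc m) (Suc m)
      (\<lambda>(k, i). (if k < m then v (Suc k) powr (- s / 2) / 2 else Rz z) * (- 1 / 2) ^ c i *
        (if k < m then K_entry s v k (c i) else J_entry s z (c i)))"
      using v by (intro eq_matI) (auto simp: \<phi>_def K_chain_1 J_chain_1 K_entry_def J_entry_def Rz_def)
    show ?thesis
      unfolding eq det_scale_rows_columns by (simp add: G_def bordered_def R_def)
  qed
  have A1: "A_II s m v 1 z = t * 2 ^ m * (R * Rz z * (h * (- 1 / 2) ^ m) * G id z)" if "z > 0" for z
    using A[of 1 z] \<Delta>_1[of z id] that by (simp add: pref_def \<Delta>_def t_def h_def)
  obtain c where c: "(pref has_real_derivative c) (at 1)"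
  proof -
    have "(pref has_real_derivative (\<Sum>k<Suc m. (2 ^ k * ((s + real k) * 1 powr (s + real k - 1))) *
        (\<Prod>j\<in>{..<Suc m} - {k}. 2 ^ j * 1 powr (s + real j)))) (at 1)"
      unfolding pref_def
      by (intro has_field_derivative_prod DERIV_cmult has_real_derivative_powr) auto
    thus ?thesis using that by blast
  qed
  have pref_1: "pref 1 = t * 2 ^ m" by (simp add: pref_def t_def)
  \<comment> \<open>The logarithmic derivative of the prefactor at 1.\<close>
  define b where "b = c / (t * 2 ^ m)"
  have t0: "t * 2 ^ m \<noteq> 0" by (simp add: t_def prod_zero_iff)
  have B1: "B_II s m v 1 z = b * A_II s m v 1 z + t * 2 ^ m * (2 * (R * Rz z * (h * (- 1 / 2) ^ Suc m) * G (skip m) z))"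
    if z: "z > 0" for z
  proof -
    have prod_skip: "(\<Prod>j<Suc m. (- 1 / 2 :: real) ^ skip m j) = h * (- 1 / 2) ^ Suc m"
      by (simp add: skip_def h_def)
    have "(\<Delta> z has_real_derivative Determinant.det (Matrix.mat (Suc m) (Suc m) (\<lambda>(k, i). \<phi> z k (skip m i) 1))) (at 1)"
      unfolding \<Delta>_def skip_def by (rule has_derivative_det_chain) (use \<phi>_deriv in auto)
    hence d: "(\<Delta> z has_real_derivative R * Rz z * (h * (- 1 / 2) ^ Suc m) * G (skip m) z) (at (1\<^sup>2))"
      unfolding \<Delta>_1[where c = "skip m"] prod_skip by simp
    have "((\<lambda>\<kappa>. \<kappa>\<^sup>2) has_real_derivative 2) (at (1 :: real))"
      by (auto intro!: derivative_eq_intros)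
    from DERIV_mult[OF c DERIV_chain2[OF d this]]
    have "((\<lambda>\<kappa>. pref \<kappa> * \<Delta> z (\<kappa>\<^sup>2)) has_real_derivative
       c * \<Delta> z 1 + R * Rz z * (h * (- 1 / 2) ^ Suc m) * G (skip m) z * 2 * pref 1) (at 1)" by simp
    moreover have "eventually (\<lambda>\<kappa>. A_II s m v \<kappa> z = pref \<kappa> * \<Delta> z (\<kappa>\<^sup>2)) (nhds 1)"
      using eventually_nhds_in_open[of "{0<..}" "1::real"] z by (auto elim!: eventually_mono intro: A)
    ultimately have "B_II s m v 1 z = c * \<Delta> z 1 + R * Rz z * (h * (- 1 / 2) ^ Suc m) * G (skip m) z * 2 * pref 1"
      unfolding B_II_def by (subst deriv_cong_ev) (auto intro: DERIV_imp_deriv)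
    moreover have "c * \<Delta> z 1 = b * A_II s m v 1 z"
      using A[of 1 z] z t0 by (simp add: b_def pref_1)
    ultimately show ?thesis by (simp add: pref_1 mult_ac)
  qed
  \<comment> \<open>The chain rule contributes 2 and the raised column index an extra - 1 / 2. The
    resulting sign is why the two determinants trade places in the final difference.\<close>
  have half: "2 ^ m * (- 1 / 2) ^ m = ((- 1) ^ m :: real)" "2 ^ m * (2 * (- 1 / 2) ^ Suc m) = - ((- 1) ^ m :: real)"
    by (simp_all flip: power_mult_distrib)
  define k where "k = (- 1) ^ m * (t * h) * R"
  have k2: "k\<^sup>2 = R\<^sup>2" unfolding k_def power_mult_distrib[of _ R] power_mult_distrib[of _ "t * h"] th
    by (simp add: minus_one_power_iff)
  define X where "X = (\<lambda>z. k * (Rz z * G id z))"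
  define Y where "Y = (\<lambda>z. - (k * (Rz z * G (skip m) z)))"
  have AX: "A_II s m v 1 z = X z" if "z > 0" for z
    unfolding A1[OF that] X_def k_def half(1)[symmetric] by (simp only: mult_ac)
  have BY: "B_II s m v 1 z = b * X z + Y z" if "z > 0" for z
  proof -
    have "t * 2 ^ m * (2 * (R * Rz z * (h * (- 1 / 2) ^ Suc m) * G (skip m) z)) =
       (2 ^ m * (2 * (- 1 / 2) ^ Suc m)) * (t * h * R * Rz z * G (skip m) z)" by (simp only: mult_ac)
    thus ?thesis unfolding B1[OF that] AX[OF that] half(2) Y_def k_def by (simp add: mult_ac)
  qed
  have "X z1 * Y z2 - X z2 * Y z1 =
      k\<^sup>2 * (Rz z1 * Rz z2 * (G (skip m) z1 * G id z2 - G id z1 * G (skip m) z2))"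
    by (simp add: X_def Y_def power2_eq_square algebra_simps)
  hence "A_II s m v 1 z1 * B_II s m v 1 z2 - A_II s m v 1 z2 * B_II s m v 1 z1 =
      R\<^sup>2 * (Rz z1 * Rz z2 * (G (skip m) z1 * G id z2 - G id z1 * G (skip m) z2))"
    unfolding AX[OF z(1)] AX[OF z(2)] BY[OF z(1)] BY[OF z(2)] k2 by (simp add: algebra_simps)
  moreover have "(C_II s m v 1)\<^sup>2 = R\<^sup>2 * (Determinant.det (Matrix.mat m m (\<lambda>(i, j). K_entry s v i j)))\<^sup>2"
  proof -
    have "(C_II s m v 1)\<^sup>2 = (t * h)\<^sup>2 * (R\<^sup>2 * (Determinant.det (Matrix.mat m m (\<lambda>(i, j). K_entry s v i j)))\<^sup>2)"
      unfolding C power_mult_distrib by (simp only: mult_ac)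
    thus ?thesis unfolding th by simp
  qed
  ultimately show ?thesis using R0 by (simp add: Rz_def G_def)
qed

section \<open>The scaling limit\<close>

lemma tendsto_det:
  fixes f :: "'a \<Rightarrow> nat \<Rightarrow> nat \<Rightarrow> real"
  assumes "\<And>i j. i < k \<Longrightarrow> j < k \<Longrightarrow> ((\<lambda>n. f n i j) \<longlongrightarrow> g i j) F"
  shows "((\<lambda>n. Determinant.det (Matrix.mat k k (\<lambda>(i, j). f n i j))) \<longlongrightarrow>
     Determinant.det (Matrix.mat k k (\<lambda>(i, j). g i j))) F"
proof -
  have less: "p i < k" if "p permutes {0..<k}" "i < k" for p i
    using permutes_in_image[OF that(1), of i] that(2) by auto
  have eq: "Determinant.det (Matrix.mat k k (\<lambda>(i, j). h i j)) =
      (\<Sum>p\<in>{p. p permutes {0..<k}}. signof p * (\<Prod>i = 0..<k. h i (p i)))" for h :: "nat \<Rightarrow> nat \<Rightarrow> real"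
    by (subst det_def'[of _ k]) (auto intro!: sum.cong prod.cong simp: less)
  show ?thesis unfolding eq
    by (intro tendsto_sum tendsto_mult tendsto_const tendsto_prod assms) (auto simp: less)
qed

lemma tendsto_det_bordered:
  assumes "\<And>i j. i < m \<Longrightarrow> ((\<lambda>n. q n i j) \<longlongrightarrow> q' i j) F" "\<And>j. ((\<lambda>n. x n j) \<longlongrightarrow> x' j) F"
  shows "((\<lambda>n. Determinant.det (bordered m (q n) c (x n))) \<longlongrightarrow> Determinant.det (bordered m q' c x')) F"
  unfolding bordered_def by (rule tendsto_det) (use assms in auto)

section \<open>Leading coefficients and moments of Jacobi polynomials\<close>

definition jacobi_moment :: "nat \<Rightarrow> real \<Rightarrow> real" where
  "jacobi_moment N \<alpha> = jacobi_integral \<alpha> (\<lambda>u. poly (jacobi_poly N \<alpha>) u * u ^ N)"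

lemma jacobi_moment_eq:
  assumes "\<alpha> > - 1"
  shows "jacobi_moment N \<alpha> = (- 1) ^ N * (2 powr (\<alpha> + real N + 1) * Beta (\<alpha> + real N + 1) (real N + 1))"
  unfolding jacobi_moment_def by (rule jacobi_poly_monom_integral[OF assms])

lemma jacobi_moment_nonzero: "\<alpha> > - 1 \<Longrightarrow> jacobi_moment N \<alpha> \<noteq> 0"
proof -
  assume "\<alpha> > - 1"
  hence "Beta (\<alpha> + real N + 1) (real N + 1) > 0"
    unfolding Beta_def by (intro divide_pos_pos mult_pos_pos Gamma_real_pos) auto
  thus ?thesis using \<open>\<alpha> > - 1\<close> by (simp add: jacobi_moment_eq)
qed

text \<open>The parameters differ by one because the leading coefficient comes from column m + 1 and
  the dominant moment from column m. For this combination all Gamma factors cancel exactly.\<close>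

lemma jacobi_coeff_moment:
  assumes \<alpha>: "\<alpha> > - 1"
  shows "jacobi_coeff N (\<alpha> + 1) N * jacobi_moment N \<alpha> = 2 powr (\<alpha> + 1) / (real N + \<alpha> + 1)"
proof -
  define a where "a = \<alpha> + real N + 1"
  have a: "a > 0" using \<alpha> by (simp add: a_def)
  hence nonint: "a \<notin> \<int>\<^sub>\<le>\<^sub>0" "a + 1 \<notin> \<int>\<^sub>\<le>\<^sub>0"
    using nonpos_Ints_nonpos[of a] nonpos_Ints_nonpos[of "a + 1"] by auto
  have pos: "Gamma a > 0" "Gamma (a + real N + 1) > 0"
    using a by (auto intro!: Gamma_real_pos)
  have "pochhammer (\<alpha> + 1 + real N + 1) N = pochhammer (a + 1) N"
    by (simp add: a_def add_ac)
  also have "\<dots> = Gamma (a + 1 + real N) / Gamma (a + 1)"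
    by (rule pochhammer_Gamma[OF nonint(2)])
  also have "\<dots> = Gamma (a + real N + 1) / (a * Gamma a)"
    using Gamma_plus1[OF nonint(1)] by (simp add: add_ac)
  finally have 1: "pochhammer (\<alpha> + 1 + real N + 1) N = Gamma (a + real N + 1) / (a * Gamma a)" .
  have 2: "Beta a (real N + 1) = Gamma a * fact N / Gamma (a + real N + 1)"
    using Gamma_fact[of N, where 'a = real] by (simp add: Beta_def add_ac)
  have 3: "(- 1 / 2) ^ N * ((- 1) ^ N * 2 powr a) = 2 powr (\<alpha> + 1)"
  proof -
    have "2 powr a = 2 powr (\<alpha> + 1) * 2 ^ N"
      by (simp add: a_def powr_add powr_realpow)
    hence "(- 1 / 2) ^ N * ((- 1) ^ N * 2 powr a) = 2 powr (\<alpha> + 1) * ((- 1 / 2) ^ N * ((- 1) ^ N * 2 ^ N))"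
      by simp
    also have "(- 1 / 2) ^ N * ((- 1) ^ N * 2 ^ N) = (1 :: real)"
      by (simp flip: power_mult_distrib)
    finally show ?thesis by simp
  qed
  have "jacobi_coeff N (\<alpha> + 1) N * jacobi_moment N \<alpha> =
     ((- 1 / 2) ^ N * ((- 1) ^ N * 2 powr a)) * (Gamma (a + real N + 1) / (a * Gamma a) / fact N * (Gamma a * fact N / Gamma (a + real N + 1)))"
    unfolding jacobi_coeff_def 1 jacobi_moment_eq[OF \<alpha>] a_def[symmetric] 2 by simp
  also have "\<dots> = 2 powr (\<alpha> + 1) / a"
  proof -
    have "g' / (a * g) / f * (g * f / g') = 1 / a" if "g > 0" "g' > 0" "f > 0" for g g' f :: real
      using that a by (simp add: field_simps)
    from this[OF pos, of "fact N"] show ?thesis unfolding 3 by simp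
  qed
  finally show ?thesis by (simp add: a_def add_ac)
qed

lemma jacobi_moment_ratio:
  assumes \<alpha>: "\<alpha> > - 1"
  shows "jacobi_moment N \<alpha> / jacobi_moment N (\<alpha> + 1) = (2 * real N + \<alpha> + 2) / (2 * (real N + \<alpha> + 1))"
proof -
  define a where "a = \<alpha> + real N + 1"
  have a: "a > 0" using \<alpha> by (simp add: a_def)
  hence "a \<notin> \<int>\<^sub>\<le>\<^sub>0" using nonpos_Ints_nonpos[of a] by auto
  from Beta_plus1_left[OF this, of "real N + 1"]
  have B: "Beta a (real N + 1) = (a + real N + 1) / a * Beta (a + 1) (real N + 1)"
    using a by (simp add: field_simps)
  have "Beta (a + 1) (real N + 1) > 0"
    unfolding Beta_def using a by (intro divide_pos_pos mult_pos_pos Gamma_real_pos) auto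
  moreover have "jacobi_moment N (\<alpha> + 1) = (- 1) ^ N * (2 powr a * 2 * Beta (a + 1) (real N + 1))"
    using jacobi_moment_eq[of "\<alpha> + 1" N] \<alpha> powr_add[of 2 a 1] by (simp add: a_def add_ac)
  moreover have "jacobi_moment N \<alpha> = (- 1) ^ N * (2 powr a * Beta a (real N + 1))"
    using jacobi_moment_eq[OF \<alpha>] by (simp add: a_def)
  ultimately have "jacobi_moment N \<alpha> / jacobi_moment N (\<alpha> + 1) = (a + real N + 1) / (2 * a)"
    unfolding B by simp
  thus ?thesis by (simp add: a_def algebra_simps)
qed

text \<open>The moments of the different columns are asymptotically equal, so the scalings alone
  decide which of them dominates.\<close>

lemma jacobi_moment_ratio_tendsto:
  fixes N :: "nat \<Rightarrow> nat"
  assumes \<alpha>: "\<alpha> > - 1" and N: "filterlim (\<lambda>n. real (N n)) at_top sequentially"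
  shows "(\<lambda>n. jacobi_moment (N n) \<alpha> / jacobi_moment (N n) (\<alpha> + real d)) \<longlonglongrightarrow> 1"
proof (induction d)
  case 0
  show ?case using jacobi_moment_nonzero[OF \<alpha>] by simp
next
  case (Suc d)
  have "((\<lambda>x. (2 * x + (\<alpha> + real d) + 2) / (2 * (x + (\<alpha> + real d) + 1))) \<longlongrightarrow> 1) at_top"
    by real_asymp
  from filterlim_compose[OF this N]
  have "(\<lambda>n. jacobi_moment (N n) (\<alpha> + real d) / jacobi_moment (N n) (\<alpha> + real d + 1)) \<longlonglongrightarrow> 1"
    using \<alpha> by (subst jacobi_moment_ratio) auto
  from tendsto_mult[OF Suc this]
  show ?case using jacobi_moment_nonzero[of "\<alpha> + real d"] \<alpha> by (simp add: add_ac)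
qed

lemma set_integral_reflect_unit:
  fixes f :: "real \<Rightarrow> real"
  shows "(LBINT t:{-1<..<1}. f t) = (LBINT u:{0<..<2}. f (1 - u))"
proof -
  have "(LBINT t:{-1<..<1}. f t) = (\<integral>u. indicator {-1<..<1} (1 + (- 1) * u) *\<^sub>R f (1 + (- 1) * u) \<partial>lborel)"
    unfolding set_lebesgue_integral_def by (subst lborel_integral_real_affine[of "- 1" _ 1]) auto
  also have "\<dots> = (LBINT u:{0<..<2}. f (1 - u))"
    unfolding set_lebesgue_integral_def by (intro Bochner_Integration.integral_cong) (auto simp: indicator_def)
  finally show ?thesis .
qed

lemma orthonormal_polys_reflect:
  fixes r :: "nat \<Rightarrow> real" and p :: "nat \<Rightarrow> real poly"
  assumes "orthonormal_polys (weight s m r) p"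
  defines "P \<equiv> \<lambda>j. pcompose (p j) [:1, - 1:]"
  shows "degree (P j) = j"
    and "jacobi_integral s (\<lambda>u. poly (P i * P j) u / poly (\<Prod>i<m. [:r (Suc i), 1:]) u) = (if i = j then 1 else 0)"
    and "poly (P j) u = poly (p j) (1 - u)"
proof -
  show poly_P: "poly (P j) u = poly (p j) (1 - u)" for j u
    by (simp add: P_def poly_pcompose)
  show "degree (P j) = j"
    using assms(1) by (simp add: P_def degree_pcompose orthonormal_polys_def)
  have "weight s m r (1 - u) = u powr s / poly (\<Prod>i<m. [:r (Suc i), 1:]) u" for u
    by (simp add: weight_def poly_prod prod.atLeast1_atMost_eq add.commute)
  hence "jacobi_integral s (\<lambda>u. poly (P i * P j) u / poly (\<Prod>i<m. [:r (Suc i), 1:]) u) =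
      (LBINT u:{0<..<2}. poly (p i) (1 - u) * poly (p j) (1 - u) * weight s m r (1 - u))"
    unfolding jacobi_integral_def by (simp add: poly_P mult_ac)
  also have "\<dots> = (LBINT t:{-1<..<1}. poly (p i) t * poly (p j) t * weight s m r t)"
    by (rule set_integral_reflect_unit[symmetric])
  finally show "jacobi_integral s (\<lambda>u. poly (P i * P j) u / poly (\<Prod>i<m. [:r (Suc i), 1:]) u) = (if i = j then 1 else 0)"
    using assms(1) by (simp add: orthonormal_polys_def)
qed

lemma sqrt_weight_mult:
  fixes v :: "nat \<Rightarrow> real"
  assumes v: "\<And>i. i \<in> {1..m} \<Longrightarrow> v i > 0" and z: "z1 > 0" "z2 > 0" and c: "c > 0"
    and r: "\<And>i. i \<in> {1..m} \<Longrightarrow> r i = v i / c"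
  shows "sqrt (weight s m r (1 - z1 / c) * weight s m r (1 - z2 / c)) =
    c powr (real m - s) * (sqrt z1 powr s * sqrt z2 powr s) / (\<Prod>i=1..m. sqrt ((v i + z1) * (v i + z2)))"
proof -
  have W: "weight s m r (1 - z / c) = c powr (real m - s) * z powr s / (\<Prod>i=1..m. v i + z)" if "z > 0" for z
  proof -
    have "(\<Prod>i=1..m. 1 + r i - (1 - z / c)) = (\<Prod>i=1..m. (v i + z) / c)"
      using r by (intro prod.cong) (auto simp: add_divide_distrib)
    also have "\<dots> = (\<Prod>i=1..m. v i + z) / c ^ m"
      by (simp add: prod_dividef)
    finally show ?thesis using that c
      by (simp add: weight_def powr_divide powr_diff powr_realpow)
  qed
  have sq: "sqrt z powr s * sqrt z powr s = z powr s" if "z > 0" for z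
    using that by (simp add: powr_mult[symmetric])
  have P: "(\<Prod>i=1..m. v i + z) > 0" if "z > 0" for z
    using v that by (intro prod_pos) (auto intro: add_pos_pos)
  have "weight s m r (1 - z1 / c) * weight s m r (1 - z2 / c) =
     (c powr (real m - s) * (sqrt z1 powr s * sqrt z2 powr s))\<^sup>2 / ((\<Prod>i=1..m. (v i + z1) * (v i + z2)))"
    unfolding W[OF z(1)] W[OF z(2)] prod.distrib sq[OF z(1), symmetric] sq[OF z(2), symmetric]
    by (simp add: power2_eq_square mult_ac)
  also have "sqrt \<dots> = (c powr (real m - s) * (sqrt z1 powr s * sqrt z2 powr s)) / sqrt (\<Prod>i=1..m. (v i + z1) * (v i + z2))"
    by (simp add: real_sqrt_divide)
  also have "sqrt (\<Prod>i=1..m. (v i + z1) * (v i + z2)) = (\<Prod>i=1..m. sqrt ((v i + z1) * (v i + z2)))"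
    by (induction m) (simp_all add: real_sqrt_mult)
  finally show ?thesis .
qed

theorem theorem4p18:
  fixes s :: real and m :: nat and v :: "nat \<Rightarrow> real"
    and r :: "nat \<Rightarrow> nat \<Rightarrow> real" and p :: "nat \<Rightarrow> nat \<Rightarrow> real poly" and z1 z2 :: real
  assumes s: "s > - 1"
    and v_pos: "\<And>i. i \<in> {1..m} \<Longrightarrow> v i > 0"
    and v_distinct: "inj_on v {1..m}"
    and r: "\<And>n i. n \<ge> 1 \<Longrightarrow> i \<in> {1..m} \<Longrightarrow> r n i = v i / (2 * (real n)\<^sup>2)"
    and p: "\<And>n. n \<ge> 1 \<Longrightarrow> orthonormal_polys (weight s m (r n)) (p n)"
    and z: "z1 > 0" "z2 > 0" "z1 \<noteq> z2"
  shows "(\<lambda>n. scaled_CD_kernel (weight s m (r n)) (p n) n z1 z2) \<longlonglongrightarrow>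
    (A_II s m v 1 z1 * B_II s m v 1 z2 - A_II s m v 1 z2 * B_II s m v 1 z1) /
    (2 * (\<Prod>i=1..m. sqrt ((v i + z1) * (v i + z2))) * (C_II s m v 1)\<^sup>2 * (z1 - z2))"
proof -
  \<comment> \<open>Chosen so that N + m = n - 1 is the top degree in the kernel. The subtraction is
    truncated, so this holds only for n > m, which suffices for the limit.\<close>
  define N where "N = (\<lambda>n. n - Suc m)"
  define \<rho> where "\<rho> = (\<lambda>n i. v (Suc i) / (2 * (real n)\<^sup>2))"
  \<comment> \<open>By Mehler--Heine, u^j times the Jacobi polynomial has size n^(- 2 * j) * n^(s +
    j) = n^(s - j), which \<open>e\<close> undoes. The Cauchy transform has size n^(- (s + j));
    after multiplication by \<open>e\<close> it is n^(- 2 * s), which \<open>K\<close>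
    undoes.\<close>
  define e where "e = (\<lambda>n j. real n powr (real j - s))"
  define K where "K = (\<lambda>n. real n powr (2 * s))"
  define q where "q = (\<lambda>n. christoffel_uvarov.q s (N n) (\<rho> n) (e n) (K n))"
  define E where "E = (\<lambda>n. christoffel_uvarov.E s (N n) (e n))"
  define D where "D = (\<lambda>n. christoffel_uvarov.D s m (N n) (\<rho> n) (e n) (K n))"
  define M where "M = (\<lambda>n. christoffel_uvarov.minor s m (N n) (\<rho> n) (e n) (K n) id)"
  define C where "C = Determinant.det (Matrix.mat m m (\<lambda>(i, j). K_entry s v i j))"
  define G where "G = (\<lambda>c z. Determinant.det (bordered m (K_entry s v) c (J_entry s z)))"
  have v: "v (Suc i) > 0" if "i < m" for i using v_pos[of "Suc i"] that by simp
  have v_inj: "inj_on (\<lambda>i. v (Suc i)) {..<m}"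
  proof (rule inj_onI)
    fix i k assume ik: "i \<in> {..<m}" "k \<in> {..<m}" "v (Suc i) = v (Suc k)"
    from inj_onD[OF v_distinct ik(3)] ik(1,2) show "i = k" by simp
  qed
  have C0: "C \<noteq> 0"
    unfolding C_def K_entry_def by (rule det_bessel_transform_nonzero[OF v_inj v])
  have loc: "christoffel_uvarov s m (\<rho> n) (K n)" if "n \<ge> 1" for n
  proof
    show "inj_on (\<rho> n) {..<m}"
    proof (rule inj_onI)
      fix i k assume ik: "i \<in> {..<m}" "k \<in> {..<m}" "\<rho> n i = \<rho> n k"
      hence "v (Suc i) = v (Suc k)" using that by (simp add: \<rho>_def)
      thus "i = k" by (rule inj_onD[OF v_inj _ ik(1,2)])
    qed
  qed (use s v that in \<open>auto simp: \<rho>_def K_def\<close>)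
  have N_le: "N n \<le> n" for n by (simp add: N_def)
  have N_ev: "eventually (\<lambda>n. real (N n) = real n - real m - 1) sequentially"
    using eventually_ge_at_top[of "Suc m"] by eventually_elim (simp add: N_def of_nat_diff)
  have N_lim: "(\<lambda>n. real (N n) / real n) \<longlonglongrightarrow> 1"
  proof (rule Lim_transform_eventually)
    show "(\<lambda>n. (real n - real m - 1) / real n) \<longlonglongrightarrow> 1" by real_asymp
    show "eventually (\<lambda>n. (real n - real m - 1) / real n = real (N n) / real n) sequentially"
      using N_ev by eventually_elim simp
  qed
  have N_top: "filterlim (\<lambda>n. real (N n)) at_top sequentially"
  proof (rule filterlim_at_top_mono)
    show "filterlim (\<lambda>n. real n - real m - 1) at_top sequentially" by real_asymp
    show "eventually (\<lambda>n. real n - real m - 1 \<le> real (N n)) sequentially"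
      using N_ev by eventually_elim simp
  qed
  have q_lim: "(\<lambda>n. q n i j) \<longlonglongrightarrow> K_entry s v i j" if i: "i < m" for i j
  proof (rule Lim_transform_eventually)
    show "(\<lambda>n. real n powr (s + real j) * jacobi_integral (s + real j)
        (\<lambda>u. poly (jacobi_poly (N n) (s + real j)) u * (1 / (u + v (Suc i) / (2 * (real n)\<^sup>2))))) \<longlonglongrightarrow> K_entry s v i j"
      unfolding K_entry_def using s v[OF i] by (intro cauchy_transform_tendsto N_lim) auto
    show "eventually (\<lambda>n. real n powr (s + real j) * jacobi_integral (s + real j)
        (\<lambda>u. poly (jacobi_poly (N n) (s + real j)) u * (1 / (u + v (Suc i) / (2 * (real n)\<^sup>2)))) = q n i j) sequentially"
      using eventually_ge_at_top[of 1]
    proof eventually_elim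
      case (elim n)
      have Ke: "K n * e n j = real n powr (s + real j)"
        by (simp add: K_def e_def powr_add[symmetric])
      show ?case
        unfolding q_def christoffel_uvarov.q_eq[OF loc[OF elim]] Ke unfolding \<rho>_def ..
    qed
  qed
  have E_lim: "(\<lambda>n. poly (E n j) (z / (2 * (real n)\<^sup>2))) \<longlonglongrightarrow> J_entry s z j" for z j
  proof (rule Lim_transform_eventually)
    show "(\<lambda>n. (z / 2) ^ j * (real n powr (- (s + real j)) *
       poly (jacobi_poly (N n) (s + real j)) (z / (2 * (real n)\<^sup>2)))) \<longlonglongrightarrow> J_entry s z j"
      unfolding J_entry_def using s by (intro tendsto_mult tendsto_const mehler_heine N_le N_lim) auto
    show "eventually (\<lambda>n. (z / 2) ^ j * (real n powr (- (s + real j)) *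
       poly (jacobi_poly (N n) (s + real j)) (z / (2 * (real n)\<^sup>2))) = poly (E n j) (z / (2 * (real n)\<^sup>2))) sequentially"
      using eventually_ge_at_top[of 1]
    proof eventually_elim
      case (elim n)
      have "((real n)\<^sup>2) ^ j = real n powr (2 * real j)"
        using elim powr_realpow[of "real n" "2 * j"] by (simp add: power_mult)
      hence "e n j = real n powr (- (s + real j)) * ((real n)\<^sup>2) ^ j"
        by (simp add: e_def powr_add[symmetric])
      moreover have "(z / (2 * (real n)\<^sup>2)) ^ j = (z / 2) ^ j / ((real n)\<^sup>2) ^ j"
        by (simp flip: power_divide)
      ultimately have "e n j * (z / (2 * (real n)\<^sup>2)) ^ j = (z / 2) ^ j * real n powr (- (s + real j))"
        using elim by simp
      thus ?case
        by (simp add: E_def christoffel_uvarov.E_def[OF loc[OF elim]] poly_monom flip: mult.assoc)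
    qed
  qed
  have D_lim: "(\<lambda>n. poly (D n c) (z / (2 * (real n)\<^sup>2))) \<longlonglongrightarrow> G c z" for c z
  proof (rule Lim_transform_eventually)
    show "(\<lambda>n. Determinant.det (bordered m (q n) c (\<lambda>j. poly (E n j) (z / (2 * (real n)\<^sup>2))))) \<longlonglongrightarrow> G c z"
      unfolding G_def by (intro tendsto_det_bordered q_lim E_lim)
    show "eventually (\<lambda>n. Determinant.det (bordered m (q n) c (\<lambda>j. poly (E n j) (z / (2 * (real n)\<^sup>2)))) =
        poly (D n c) (z / (2 * (real n)\<^sup>2))) sequentially"
      using eventually_ge_at_top[of 1]
      by eventually_elim (simp add: D_def q_def E_def christoffel_uvarov.poly_D[OF loc])
  qed
  \<comment> \<open>A minor is the bordered determinant with a unit vector as last row. For k < m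
    the limit matters only as a bound, since the term gets a vanishing factor below.\<close>
  have M_lim: "(\<lambda>n. M n k) \<longlonglongrightarrow> Determinant.det (bordered m (K_entry s v) id (\<lambda>j. if j = k then 1 else 0))"
    if "k \<le> m" for k
  proof (rule Lim_transform_eventually)
    show "(\<lambda>n. Determinant.det (bordered m (q n) id (\<lambda>j. if j = k then 1 else 0))) \<longlonglongrightarrow>
        Determinant.det (bordered m (K_entry s v) id (\<lambda>j. if j = k then 1 else 0))"
      by (intro tendsto_det_bordered q_lim tendsto_const)
    show "eventually (\<lambda>n. Determinant.det (bordered m (q n) id (\<lambda>j. if j = k then 1 else 0)) = M n k) sequentially"
      using eventually_ge_at_top[of 1]
    proof eventually_elim
      case (elim n)
      have "Determinant.det (bordered m (q n) id (\<lambda>j. if j = k then 1 else 0)) = (\<Sum>j\<le>m. M n j * (if id j = k then 1 else 0))"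
        unfolding q_def M_def by (rule christoffel_uvarov.det_bordered[OF loc[OF elim]])
      also have "\<dots> = (\<Sum>j\<in>{k}. M n j * (if id j = k then 1 else 0))"
        using that by (intro sum.mono_neutral_right) auto
      also have "\<dots> = M n k" by simp
      finally show ?case .
    qed
  qed
  have Mm_lim: "(\<lambda>n. M n m) \<longlonglongrightarrow> C"
  proof (rule Lim_transform_eventually)
    show "(\<lambda>n. Determinant.det (Matrix.mat m m (\<lambda>(i, j). q n i j))) \<longlonglongrightarrow> C"
      unfolding C_def by (rule tendsto_det) (use q_lim in auto)
    show "eventually (\<lambda>n. Determinant.det (Matrix.mat m m (\<lambda>(i, j). q n i j)) = M n m) sequentially"
      using eventually_ge_at_top[of 1]
      by eventually_elim (simp add: M_def q_def christoffel_uvarov.minor_last[OF loc])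
  qed
  define Z where "Z = (\<lambda>n. M n m * (e n (Suc m) * jacobi_coeff (N n) (s + real (Suc m)) (N n)) *
     (\<Sum>j\<le>m. M n j * (e n j * jacobi_moment (N n) (s + real j))))"
  \<comment> \<open>The scalings of columns m + 1 and m contribute n^(2 * m + 1 - 2 * s), and the
    coefficient times the moment contributes 1 / n. Terms with j < m are smaller by n^(j -
    m).\<close>
  have Z_lim: "(\<lambda>n. real n powr (2 * s - 2 * real m) * Z n) \<longlonglongrightarrow> 2 powr (s + real m + 1) * C\<^sup>2"
  proof (rule Lim_transform_eventually)
    let ?S = "\<lambda>n. \<Sum>j\<le>m. M n j * (real n powr (real j - real m) * (jacobi_moment (N n) (s + real j) / jacobi_moment (N n) (s + real m)))"
    have "(\<lambda>n. M n j * (real n powr (real j - real m) * (jacobi_moment (N n) (s + real j) / jacobi_moment (N n) (s + real m))))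
        \<longlonglongrightarrow> (if j = m then C else 0)" if "j \<le> m" for j
    proof -
      have ratio: "(\<lambda>n. jacobi_moment (N n) (s + real j) / jacobi_moment (N n) (s + real m)) \<longlonglongrightarrow> 1"
        using jacobi_moment_ratio_tendsto[of "s + real j" N "m - j"] s N_top that by (simp add: of_nat_diff)
      show ?thesis
      proof (cases "j = m")
        case True
        have "eventually (\<lambda>n. 1 = real n powr (real j - real m)) sequentially"
          using eventually_ge_at_top[of 1] by eventually_elim (simp add: True)
        hence "(\<lambda>n. real n powr (real j - real m)) \<longlonglongrightarrow> 1"
          by (rule Lim_transform_eventually[OF tendsto_const])
        from tendsto_mult[OF Mm_lim tendsto_mult[OF this ratio]] True
        show ?thesis by simp
      next
        case False
        hence "real j - real m < 0" using that by simp
        hence "(\<lambda>n. real n powr (real j - real m)) \<longlonglongrightarrow> 0"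
          by (intro tendsto_neg_powr filterlim_real_sequentially)
        from tendsto_mult[OF M_lim[OF that] tendsto_mult[OF this ratio]] False
        show ?thesis by simp
      qed
    qed
    hence "?S \<longlonglongrightarrow> (\<Sum>j\<le>m. if j = m then C else 0)"
      by (intro tendsto_sum) auto
    hence S: "?S \<longlonglongrightarrow> C" by simp
    have "(\<lambda>n. real n / (real n + s)) \<longlonglongrightarrow> 1" by real_asymp
    from tendsto_mult[OF tendsto_mult[OF Mm_lim tendsto_mult[OF tendsto_const[of "2 powr (s + real m + 1)"] this]] S]
    show "(\<lambda>n. M n m * (2 powr (s + real m + 1) * (real n / (real n + s))) * ?S n) \<longlonglongrightarrow> 2 powr (s + real m + 1) * C\<^sup>2"
      by (simp add: power2_eq_square mult_ac)
    show "eventually (\<lambda>n. M n m * (2 powr (s + real m + 1) * (real n / (real n + s))) * ?S n =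
        real n powr (2 * s - 2 * real m) * Z n) sequentially"
      using eventually_ge_at_top[of 1] N_ev
    proof eventually_elim
      case (elim n)
      let ?L = "jacobi_coeff (N n) (s + real (Suc m)) (N n)" and ?t = "\<lambda>j. jacobi_moment (N n) (s + real j)"
      \<comment> \<open>The denominator is N n + (s + m) + 1, which equals n + s.\<close>
      have Lt: "?L * ?t m = 2 powr (s + real m + 1) / (real n + s)"
        using jacobi_coeff_moment[of "s + real m" "N n"] s elim(2) by (simp add: add_ac)
      have t0: "?t m \<noteq> 0" using s by (intro jacobi_moment_nonzero) auto
      have summand: "M n j * (e n j * ?t j) = real n powr (real m - s) * ?t m *
         (M n j * (real n powr (real j - real m) * (?t j / ?t m)))" for j
      proof -
        have "e n j = real n powr (real m - s) * real n powr (real j - real m)"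
          by (simp add: e_def powr_add[symmetric])
        thus ?thesis using t0 by simp
      qed
      have "(\<Sum>j\<le>m. M n j * (e n j * ?t j)) = real n powr (real m - s) * ?t m * ?S n"
        unfolding summand by (rule sum_distrib_left[symmetric])
      hence "real n powr (2 * s - 2 * real m) * Z n =
         M n m * ((real n powr (2 * s - 2 * real m) * (e n (Suc m) * real n powr (real m - s))) * (?L * ?t m)) * ?S n"
        unfolding Z_def by (simp only: mult_ac)
      also have "real n powr (2 * s - 2 * real m) * (e n (Suc m) * real n powr (real m - s)) = real n"
        using elim(1) by (simp add: e_def powr_add[symmetric])
      finally show ?case unfolding Lt by simp
    qed
  qed
  have kernel: "eventually (\<lambda>n. Z n * ((z1 - z2) / (2 * (real n)\<^sup>2) *
      (\<Sum>j<n. poly (p n j) (1 - z1 / (2 * (real n)\<^sup>2)) * poly (p n j) (1 - z2 / (2 * (real n)\<^sup>2)))) =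
      poly (D n (skip m)) (z1 / (2 * (real n)\<^sup>2)) * poly (D n id) (z2 / (2 * (real n)\<^sup>2)) -
      poly (D n id) (z1 / (2 * (real n)\<^sup>2)) * poly (D n (skip m)) (z2 / (2 * (real n)\<^sup>2))) sequentially"
    using eventually_ge_at_top[of "Suc m"]
  proof eventually_elim
    case (elim n)
    hence n: "n \<ge> 1" by simp
    define P where "P = (\<lambda>j. pcompose (p n j) [:1, - 1:])"
    have Q: "christoffel_uvarov.Q m (\<rho> n) = (\<Prod>i<m. [:r n (Suc i), 1:])"
      unfolding christoffel_uvarov.Q_def[OF loc[OF n]] using n by (intro prod.cong) (auto simp: r \<rho>_def)
    have P_deg: "degree (P j) = j" for j
      unfolding P_def by (rule orthonormal_polys_reflect(1)[OF p[OF n]])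
    have P_orth: "christoffel_uvarov.\<Lambda> s m (\<rho> n) (P i * P j) = (if i = j then 1 else 0)" for i j
      unfolding christoffel_uvarov.\<Lambda>_def[OF loc[OF n]] Q P_def
      by (rule orthonormal_polys_reflect(2)[OF p[OF n]])
    have poly_P: "poly (P j) u = poly (p n j) (1 - u)" for j u
      unfolding P_def by (rule orthonormal_polys_reflect(3)[OF p[OF n]])
    have range: "{..N n + m} = {..<n}" using elim by (auto simp: N_def)
    from christoffel_uvarov.christoffel_darboux_D[where N = "N n" and e = "e n" and x = "z1 / (2 * (real n)\<^sup>2)" and y = "z2 / (2 * (real n)\<^sup>2)",
        OF loc[OF n] P_deg P_orth]
    show ?case
      unfolding Z_def M_def D_def jacobi_moment_def diff_divide_distrib poly_P range .
  qed
  define X where "X = (\<lambda>n. poly (D n (skip m)) (z1 / (2 * (real n)\<^sup>2)) * poly (D n id) (z2 / (2 * (real n)\<^sup>2)) -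
      poly (D n id) (z1 / (2 * (real n)\<^sup>2)) * poly (D n (skip m)) (z2 / (2 * (real n)\<^sup>2)))"
  define X' where "X' = G (skip m) z1 * G id z2 - G id z1 * G (skip m) z2"
  have X_lim: "X \<longlonglongrightarrow> X'"
    unfolding X_def X'_def by (intro tendsto_intros D_lim)
  define V where "V = (\<Prod>i=1..m. sqrt ((v i + z1) * (v i + z2)))"
  define R where "R = sqrt z1 powr s * sqrt z2 powr s"
  have "(\<lambda>n. 2 powr (real m - s) * R / V * X n / (z1 - z2) / (real n powr (2 * s - 2 * real m) * Z n))
     \<longlonglongrightarrow> 2 powr (real m - s) * R / V * X' / (z1 - z2) / (2 powr (s + real m + 1) * C\<^sup>2)"
    using C0 z(3) by (intro tendsto_divide tendsto_mult tendsto_const X_lim Z_lim) auto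
  moreover have "eventually (\<lambda>n. 2 powr (real m - s) * R / V * X n / (z1 - z2) / (real n powr (2 * s - 2 * real m) * Z n) =
      scaled_CD_kernel (weight s m (r n)) (p n) n z1 z2) sequentially"
  proof -
    \<comment> \<open>Here the nonvanishing Wronskian enters: only eventually may the
      Christoffel--Darboux identity be divided by \<open>Z n\<close>.\<close>
    have "eventually (\<lambda>n. real n powr (2 * s - 2 * real m) * Z n \<noteq> 0) sequentially"
      by (rule tendsto_imp_eventually_ne[OF Z_lim]) (use C0 in simp)
    thus ?thesis using kernel eventually_ge_at_top[of 1]
    proof eventually_elim
      case (elim n)
      define k where "k = (\<Sum>j<n. poly (p n j) (1 - z1 / (2 * (real n)\<^sup>2)) * poly (p n j) (1 - z2 / (2 * (real n)\<^sup>2)))"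
      have Z: "Z n \<noteq> 0" using elim(1) by simp
      have n: "real n > 0" using elim(3) by simp
      have X: "X n = Z n * ((z1 - z2) / (2 * (real n)\<^sup>2) * k)"
        unfolding X_def k_def by (rule elim(2)[symmetric])
      have "(real n)\<^sup>2 = real n powr 2" using n by simp
      hence "(2 * (real n)\<^sup>2) powr (real m - s) = 2 powr (real m - s) * real n powr (2 * (real m - s))"
        by (simp only: powr_mult powr_powr)
      also have "2 * (real m - s) = 2 * real m - 2 * s" by simp
      also have "real n powr (2 * real m - 2 * s) = 1 / real n powr (2 * s - 2 * real m)"
        using powr_minus_divide[of "real n" "2 * s - 2 * real m"] by simp
      finally have c: "(2 * (real n)\<^sup>2) powr (real m - s) = 2 powr (real m - s) / real n powr (2 * s - 2 * real m)"
        by simp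
      have "sqrt (weight s m (r n) (1 - z1 / (2 * (real n)\<^sup>2)) * weight s m (r n) (1 - z2 / (2 * (real n)\<^sup>2))) =
        (2 * (real n)\<^sup>2) powr (real m - s) * R / V"
        unfolding R_def V_def using elim(3) z v_pos n by (intro sqrt_weight_mult) (auto simp: r)
      hence "scaled_CD_kernel (weight s m (r n)) (p n) n z1 z2 =
         1 / (2 * (real n)\<^sup>2) * (2 powr (real m - s) / real n powr (2 * s - 2 * real m) * R / V * k)"
        by (simp add: scaled_CD_kernel_def CD_kernel_def k_def c)
      also have "\<dots> = 2 powr (real m - s) * R / V * X n / (z1 - z2) / (real n powr (2 * s - 2 * real m) * Z n)"
        unfolding X using Z z(3) by (simp add: mult_ac)
      finally show ?case ..
    qed
  qed
  ultimately have "(\<lambda>n. scaled_CD_kernel (weight s m (r n)) (p n) n z1 z2) \<longlonglongrightarrow>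
      2 powr (real m - s) * R / V * X' / (z1 - z2) / (2 powr (s + real m + 1) * C\<^sup>2)"
    by (rule Lim_transform_eventually)
  also have "2 powr (real m - s) * R / V * X' / (z1 - z2) / (2 powr (s + real m + 1) * C\<^sup>2) =
      ((sqrt z1 / 2) powr s * (sqrt z2 / 2) powr s * X' / C\<^sup>2) / (2 * V * (z1 - z2))"
  proof -
    \<comment> \<open>The quotient of the two powers of 2 is 2^(2 * s + 1): each factor 2^s belongs
      to one sqrt z / 2, and the remaining 2 is the one in the denominator of the limit.\<close>
    have "(2 :: real) powr (s + real m + 1) = 2 powr (real m - s) * (2 powr s * 2 powr s * 2)"
    proof -
      have "(2 :: real) powr (s + real m + 1) = 2 powr ((real m - s) + (s + s + 1))"
        by (rule arg_cong[where f = "\<lambda>x. 2 powr x"]) simp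
      also have "\<dots> = 2 powr (real m - s) * (2 powr s * 2 powr s * 2)"
        by (subst powr_add) (simp only: powr_add powr_one)
      finally show ?thesis .
    qed
    moreover have "(sqrt z1 / 2) powr s * (sqrt z2 / 2) powr s = R / (2 powr s * 2 powr s)"
      using z by (simp add: R_def powr_divide)
    ultimately show ?thesis by simp
  qed
  also have "(sqrt z1 / 2) powr s * (sqrt z2 / 2) powr s * X' / C\<^sup>2 =
     (A_II s m v 1 z1 * B_II s m v 1 z2 - A_II s m v 1 z2 * B_II s m v 1 z1) / (C_II s m v 1)\<^sup>2"
    unfolding X'_def G_def C_def by (rule wronskian_ratio[OF s v_pos z(1,2), symmetric])
  finally show ?thesis by (simp add: V_def mult_ac)
qed

end
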